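(* Let $m\ge2$ be an integer and $K:=\lfloor\log z_m/\log 2\rfloor$. Then \[\theta(z_m)+\sum_{k=2}^K k\,\theta(z_m^{1/k})-\frac{(\log z_m)^2}{\log 2}\le\psi_Z(z_m)<\theta(z_m)+\sum_{k=2}^K k\,\theta(z_m^{1/k})+\frac{2\log z_m\log\log z_m}{\log 2}.\] Moreover, as $m\to\infty$, \[\psi_Z(z_m)=\theta(z_m)+2\sqrt{z_m}+O\left(\frac{\sqrt{z_m}}{\log^2 z_m}\right).\]
   Context: $\theta(x):=\sum_{p\le x}\log p$ is the Chebyshev theta function. Consider all pairs $(q,k)$ with $q$ prime and $k\ge 1$ an integer, with value $z_{q,k}:=q+q^2+\cdots+q^k$. Enumerate these pairs as $(q_1,k_1),(q_2,k_2),\dots$ so that $z_i:=z_{q_i,k_i}$ is nondecreasing in $i$; if $z_{q,k}=z_{p,j}$ with $q>p$, then $(q,k)$ comes before $(p,j)$. Define $\psi_Z(x):=\sum_{i:\,z_i\le x}\log z_i$ (values counted with multiplicity). *)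

theory Defs
  imports
    "HOL-Analysis.Analysis"
    "HOL-Computational_Algebra.Primes"
    "HOL-Library.Infinite_Set"
    "HOL-Library.Landau_Symbols"
begin

definition chebyshev_theta :: "real \<Rightarrow> real" where
  "chebyshev_theta x = (\<Sum>p | prime p \<and> real p \<le> x. ln (real p))"

definition prime_exp_pairs :: "(nat \<times> nat) set" where
  "prime_exp_pairs = {(q, k). prime q \<and> 1 \<le> k}"

definition zval :: "nat \<times> nat \<Rightarrow> nat" where
  "zval = (\<lambda>(q, k). \<Sum>j = 1..k. q ^ j)"

(* Indices start at 1; the value e 0 is irrelevant. *)
definition z_enumeration :: "(nat \<Rightarrow> nat \<times> nat) \<Rightarrow> bool" where
  "z_enumeration e \<longleftrightarrow>
     bij_betw e {1..} prime_exp_pairs \<and>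
     (\<forall>i\<ge>1. \<forall>j\<ge>i. zval (e i) \<le> zval (e j)) \<and>
     (\<forall>i\<ge>1. \<forall>j\<ge>1. zval (e i) = zval (e j) \<and> fst (e i) > fst (e j) \<longrightarrow> i < j)"

(* Summing over indices rather than over values counts coinciding values with multiplicity.
   The index set is finite whenever e is an enumeration (lemma finite_z_enumeration_le). *)
definition psi_Z :: "(nat \<Rightarrow> nat \<times> nat) \<Rightarrow> real \<Rightarrow> real" where
  "psi_Z e x = (\<Sum>i | 1 \<le> i \<and> real (zval (e i)) \<le> x. ln (real (zval (e i))))"

lemma zval_ge:
  assumes "(q, k) \<in> prime_exp_pairs"
  shows "q \<le> zval (q, k)" and "k \<le> zval (q, k)"
proof -
  have q: "q \<ge> 1" and k: "1 \<le> k"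
    using assms prime_ge_1_nat by (auto simp: prime_exp_pairs_def)
  have "(\<Sum>j\<in>{1}. q ^ j) \<le> (\<Sum>j = 1..k. q ^ j)"
    using k by (intro sum_mono2) auto
  then show "q \<le> zval (q, k)" by (simp add: zval_def)
  have "(\<Sum>j = 1..k. 1) \<le> (\<Sum>j = 1..k. q ^ j)"
    using q by (intro sum_mono) simp
  then show "k \<le> zval (q, k)" by (simp add: zval_def)
qed

lemma zval_strict_mono:
  assumes "prime q" "k < k'"
  shows "zval (q, k) < zval (q, k')"
proof -
  have "(\<Sum>j = 1..k. q ^ j) < (\<Sum>j = 1..k'. q ^ j)"
    using assms by (intro sum_strict_mono2[where b = k']) (auto simp: prime_gt_0_nat)
  then show ?thesis by (simp add: zval_def)
qed

lemma finite_z_enumeration_le: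
  assumes "z_enumeration e"
  shows "finite {i. 1 \<le> i \<and> real (zval (e i)) \<le> x}"
proof (rule finite_imageD)
  have bij: "bij_betw e {1..} prime_exp_pairs"
    using assms by (simp add: z_enumeration_def)
  show "inj_on e {i. 1 \<le> i \<and> real (zval (e i)) \<le> x}"
    using bij by (auto simp: bij_betw_def inj_on_def)
  have "e ` {i. 1 \<le> i \<and> real (zval (e i)) \<le> x} \<subseteq> {..nat \<lfloor>x\<rfloor>} \<times> {..nat \<lfloor>x\<rfloor>}"
  proof (rule image_subsetI)
    fix i assume i: "i \<in> {i. 1 \<le> i \<and> real (zval (e i)) \<le> x}"
    obtain q k where qk: "e i = (q, k)" by fastforce
    have "(q, k) \<in> prime_exp_pairs"
      using bij_betwE[OF bij] i qk by (metis (no_types, lifting) atLeast_iff mem_Collect_eq)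
    then have "q \<le> zval (e i)" "k \<le> zval (e i)"
      using zval_ge qk by auto
    moreover have "zval (e i) \<le> nat \<lfloor>x\<rfloor>"
      using i by (simp add: le_nat_floor)
    ultimately show "e i \<in> {..nat \<lfloor>x\<rfloor>} \<times> {..nat \<lfloor>x\<rfloor>}"
      by (simp add: qk)
  qed
  then show "finite (e ` {i. 1 \<le> i \<and> real (zval (e i)) \<le> x})"
    by (rule finite_subset) simp
qed

lemma z_enumeration_exists: "\<exists>e. z_enumeration e"
proof -
  (* c embeds the required order of the pairs into the natural numbers *)
  define c where "c = (\<lambda>p. zval p * (zval p + 1) + (zval p - fst p))"
  have c_less: "c p < c p'" if "zval p < zval p'" for p p'
  proof -
    have "c p < (zval p + 1) * (zval p + 1)"
      by (simp add: c_def)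
    also have "\<dots> \<le> zval p' * (zval p' + 1)"
      using that by (intro mult_mono) auto
    also have "\<dots> \<le> c p'" by (simp add: c_def)
    finally show ?thesis .
  qed
  have fst_le: "fst p \<le> zval p" if "p \<in> prime_exp_pairs" for p
    using zval_ge(1)[of "fst p" "snd p"] that by simp
  have inj: "inj_on c prime_exp_pairs"
  proof (rule inj_onI)
    fix p p' assume p: "p \<in> prime_exp_pairs" "p' \<in> prime_exp_pairs" "c p = c p'"
    have z: "zval p = zval p'"
      using c_less[of p p'] c_less[of p' p] p(3) by (metis less_irrefl nat_neq_iff)
    then have f: "fst p = fst p'"
      using p fst_le[of p] fst_le[of p'] by (simp add: c_def)
    have "prime (fst p)" using p by (auto simp: prime_exp_pairs_def)
    then have "snd p = snd p'"
      using z f zval_strict_mono[of "fst p" "snd p" "snd p'"]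
        zval_strict_mono[of "fst p" "snd p'" "snd p"]
      by (metis less_irrefl nat_neq_iff prod.collapse)
    with f show "p = p'" by (simp add: prod_eq_iff)
  qed
  have "infinite ((\<lambda>q. (q, 1)) ` {q :: nat. prime q})"
    using primes_infinite by (subst finite_image_iff) (auto simp: inj_on_def)
  then have "infinite prime_exp_pairs"
    by (rule contrapos_nn) (erule rev_finite_subset, auto simp: prime_exp_pairs_def)
  then have S: "infinite (c ` prime_exp_pairs)"
    using inj by (simp add: finite_image_iff)
  define g where "g = enumerate (c ` prime_exp_pairs)"
  define e where "e = (\<lambda>i. inv_into prime_exp_pairs c (g (i - 1)))"
  have g: "bij_betw g UNIV (c ` prime_exp_pairs)" and gm: "strict_mono g"
    using S by (simp_all add: g_def bij_enumerate strict_mono_enumerate)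
  have shift: "bij_betw (\<lambda>i. i - 1 :: nat) {1..} UNIV"
    by (rule bij_betwI[where g = Suc]) auto
  have "bij_betw (inv_into prime_exp_pairs c) (c ` prime_exp_pairs) prime_exp_pairs"
    using inj by (simp add: bij_betw_inv_into bij_betw_imageI)
  then have bij: "bij_betw e {1..} prime_exp_pairs"
    using bij_betw_trans[OF bij_betw_trans[OF shift g]] by (simp add: e_def o_def)
  have ce: "c (e i) = g (i - 1)" for i
    using g by (auto simp: e_def bij_betw_def intro!: f_inv_into_f)
  have "zval (e i) \<le> zval (e j)" if "i \<le> j" for i j
  proof (rule ccontr)
    assume "\<not> ?thesis"
    then have "c (e j) < c (e i)" by (intro c_less) simp
    moreover have "c (e i) \<le> c (e j)"
      using that gm by (simp add: ce strict_mono_less_eq diff_le_mono)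
    ultimately show False by simp
  qed
  moreover have "i < j"
    if "1 \<le> i" "1 \<le> j" "zval (e i) = zval (e j)" "fst (e i) > fst (e j)" for i j
  proof -
    have "e i \<in> prime_exp_pairs"
      using bij_betwE[OF bij] that(1) by simp
    then have "c (e i) < c (e j)"
      using that fst_le[of "e i"] by (simp add: c_def)
    then have "i - 1 < j - 1" using gm by (simp add: ce strict_mono_less)
    then show ?thesis by simp
  qed
  ultimately show ?thesis using bij by (auto simp: z_enumeration_def)
qed

end

theory Submission
  imports
    Defs
    "HOL-Complex_Analysis.Complex_Analysis"
    "HOL-Number_Theory.Prime_Powers"
    "HOL-Probability.Probability"
    "HOL-Real_Asymp.Real_Asymp"
begin

text \<open>
  The \<open>k\<close>-th layer, that is the set of primes \<open>q\<close> with \<open>q + \<dots> + q\<^sup>k \<le> z\<close>, differs from the set of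
  primes with \<open>q\<^sup>k \<le> z\<close> by at most one prime, and \<open>ln (q + \<dots> + q\<^sup>k)\<close> exceeds \<open>k ln q\<close> by at most
  \<open>ln (q / (q - 1))\<close>. The first fact costs at most \<open>ln z\<close> per layer. The second telescopes over all
  integers up to the \<open>k\<close>-th root of \<open>z\<close> to \<open>(ln z) / k\<close>, and the sum over \<open>k\<close> is harmonic. This gives
  the two inequalities.

  In the asymptotic formula the layer \<open>k = 2\<close> contributes \<open>2 \<theta>(\<surd>z)\<close>, so it amounts to the prime
  number theorem in the form \<open>\<theta>(x) = x + O(x / ln\<^sup>2 x)\<close>. This is derived from the Dirichlet series
  \<open>D(s)\<close> with coefficients \<open>\<Lambda>(n) - 1\<close>, which is \<open>-\<zeta>'/\<zeta> - \<zeta>\<close>. On the half plane \<open>Re s > 1\<close> all derivatives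
  of \<open>D\<close> are \<open>O(\<bar>s\<bar>\<^sup>\<delta>)\<close> for every \<open>\<delta> > 0\<close>: \<open>\<zeta>\<close> is \<open>O(\<bar>s\<bar>\<^sup>\<delta>)\<close> slightly to the left of the line
  \<open>Re s = 1\<close>, the inequality \<open>3 + 4 cos t + cos 2t \<ge> 0\<close> bounds \<open>\<bar>\<zeta>\<bar>\<close> from below, and Cauchy's estimates
  on small discs do the rest. As the \<open>k\<close>-th derivative of \<open>D\<close> has the coefficients
  \<open>\<plusminus>ln\<^sup>k n (\<Lambda>(n) - 1)\<close>, smoothed sums of these are bounded as if the weight were absent, and removing
  first the smoothing and then the weight still leaves a saving of \<open>ln\<^sup>2 x\<close> when \<open>k = 5\<close>.
\<close>

section \<open>Dirichlet series on the half plane to the right of 1\<close>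

text \<open>No contour is moved. All bounds on the Dirichlet series hold for Re s > 1 with constants
  independent of Re s, so inversion is done to the right of 1 and Re s tends to 1 only in the finite
  weighted sums. Zeta is kept away from 0 only on discs whose radius is a small negative power of
  the height, which is why the bounds are powers of the height and not of its logarithm. The
  inversion kernel decays like t^(-2), so any total exponent below 1 would do; 1/2 is used. The
  exponent 5 comes from a balance. With the weight ln^k n, inversion bounds the sum up to N by a
  multiple of N^2 / h plus h ln^(k+1) N, where h is the width of the smoothing and the second term
  is the trivial bound on a short interval. The choice h = N / ln^((k+1)/2) N makes both equal, and
  division by ln^k N leaves N / ln^((k-1)/2) N, so k = 5 is the first weight for which this argument
  saves ln^2 N. The prime number theorem enters at k = 2 only: the errors in the two inequalities
  are polylogarithmic, and the layers k >= 3 together are x^(1/3) up to logarithms.\<close>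

text \<open>The summand for \<open>n = 0\<close> vanishes since \<open>0 powr s = 0\<close>.\<close>

definition dirichlet_series :: "(nat \<Rightarrow> complex) \<Rightarrow> complex \<Rightarrow> complex" where
  "dirichlet_series c s = (\<Sum>n. c n * of_nat n powr (-s))"

text \<open>In classical terms: the abscissa of absolute convergence is at most 1.\<close>

definition summable_right_of_1 :: "(nat \<Rightarrow> complex) \<Rightarrow> bool" where
  "summable_right_of_1 c \<longleftrightarrow> (\<forall>\<sigma>>1. summable (\<lambda>n. norm (c n) * real n powr (-\<sigma>)))"

lemma norm_nat_powr: "norm (of_nat n powr s :: complex) = real n powr Re s"
  by (cases "n = 0") (auto simp: norm_powr_real_powr)

lemma summable_right_of_1_summable_norm:
  assumes "summable_right_of_1 c" "Re s > 1"
  shows "summable (\<lambda>n. norm (c n * of_nat n powr (-s)))"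
  using assms by (auto simp: summable_right_of_1_def norm_mult norm_nat_powr)

lemma summable_right_of_1_summable:
  assumes "summable_right_of_1 c" "Re s > 1"
  shows "summable (\<lambda>n. c n * of_nat n powr (-s))"
  using summable_right_of_1_summable_norm[OF assms] by (rule summable_norm_cancel)

lemma summable_right_of_1_1: "summable_right_of_1 (\<lambda>_. 1)"
  by (auto simp: summable_right_of_1_def summable_real_powr_iff)

lemma summable_right_of_1_mono:
  assumes "summable_right_of_1 c" "\<And>n. n > 0 \<Longrightarrow> norm (d n) \<le> norm (c n)"
  shows "summable_right_of_1 d"
  unfolding summable_right_of_1_def
proof (intro allI impI)
  fix \<sigma> :: real assume "\<sigma> > 1"
  with assms(1) have "summable (\<lambda>n. norm (c n) * real n powr (-\<sigma>))" by (simp add: summable_right_of_1_def)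
  then show "summable (\<lambda>n. norm (d n) * real n powr (-\<sigma>))"
  proof (rule summable_comparison_test')
    fix n :: nat assume "n \<ge> 0"
    show "norm (norm (d n) * real n powr (-\<sigma>)) \<le> norm (c n) * real n powr (-\<sigma>)"
      using assms(2)[of n] by (cases "n = 0") (auto intro!: mult_right_mono)
  qed
qed

lemma summable_right_of_1_add:
  assumes "summable_right_of_1 c" "summable_right_of_1 d"
  shows "summable_right_of_1 (\<lambda>n. c n + d n)"
  unfolding summable_right_of_1_def
proof (intro allI impI)
  fix \<sigma> :: real assume "\<sigma> > 1"
  with assms have "summable (\<lambda>n. norm (c n) * real n powr (-\<sigma>) + norm (d n) * real n powr (-\<sigma>))" 
    by (intro summable_add) (auto simp: summable_right_of_1_def)
  then show "summable (\<lambda>n. norm (c n + d n) * real n powr (-\<sigma>))"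
    by (rule summable_comparison_test'[where N = 0])
       (auto simp: abs_mult simp flip: distrib_right intro!: mult_right_mono norm_triangle_ineq)
qed

lemma summable_right_of_1_uminus [simp]: "summable_right_of_1 (\<lambda>n. - c n) \<longleftrightarrow> summable_right_of_1 c"
  by (simp add: summable_right_of_1_def)

text \<open>A logarithm is absorbed by \<open>n powr \<eta>\<close>, where \<open>\<eta>\<close> is
  half the distance from the exponent to 1.\<close>

lemma summable_right_of_1_ln:
  assumes "summable_right_of_1 c"
  shows "summable_right_of_1 (\<lambda>n. of_real (ln (real n)) * c n)"
  unfolding summable_right_of_1_def
proof (intro allI impI)
  fix \<sigma> :: real assume \<sigma>: "\<sigma> > 1"
  define \<eta> where "\<eta> = (\<sigma> - 1) / 2"
  have \<eta>: "\<eta> > 0" "\<sigma> - \<eta> > 1" using \<sigma> by (auto simp: \<eta>_def field_simps)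
  have "summable (\<lambda>n. (norm (c n) * real n powr (-(\<sigma>-\<eta>))) * (1 / \<eta>))"
    using assms \<eta> unfolding summable_right_of_1_def by (intro summable_mult2) auto
  then show "summable (\<lambda>n. norm (of_real (ln (real n)) * c n) * real n powr (-\<sigma>))"
  proof (rule summable_comparison_test'[where N = 1])
    fix n :: nat assume n: "n \<ge> 1"
    have "ln (real n) \<le> real n powr \<eta> / \<eta>" using n \<eta> by (intro ln_powr_bound) auto
    then have "ln (real n) * (norm (c n) * real n powr (-\<sigma>)) \<le> real n powr \<eta> / \<eta> * (norm (c n) * real n powr (-\<sigma>))"
      by (intro mult_right_mono) auto
    also have "\<dots> = norm (c n) * (real n powr \<eta> * real n powr (-\<sigma>)) * (1 / \<eta>)" by simp
    also have "real n powr \<eta> * real n powr (-\<sigma>) = real n powr (-(\<sigma>-\<eta>))"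
      by (simp flip: powr_add)
    finally show "norm (norm (of_real (ln (real n)) * c n) * real n powr (-\<sigma>))
        \<le> (norm (c n) * real n powr (-(\<sigma>-\<eta>))) * (1 / \<eta>)"
      using n by (simp add: norm_mult abs_mult mult_ac)
  qed
qed

lemma summable_right_of_1_ln_power:
  assumes "summable_right_of_1 c"
  shows "summable_right_of_1 (\<lambda>n. of_real (ln (real n)) ^ k * c n)"
  using assms by (induction k) (auto simp: mult.assoc dest: summable_right_of_1_ln)

lemma dirichlet_series_add:
  assumes "summable_right_of_1 c" "summable_right_of_1 d" "Re s > 1"
  shows "dirichlet_series (\<lambda>n. c n + d n) s = dirichlet_series c s + dirichlet_series d s"
  unfolding dirichlet_series_def using assms
  by (subst suminf_add) (auto simp: distrib_right summable_right_of_1_summable)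

lemma dirichlet_series_uminus:
  assumes "summable_right_of_1 c" "Re s > 1"
  shows "dirichlet_series (\<lambda>n. - c n) s = - dirichlet_series c s"
  unfolding dirichlet_series_def using suminf_minus[OF summable_right_of_1_summable[OF assms]] by simp

lemma dirichlet_series_cong: "(\<And>n. n > 0 \<Longrightarrow> c n = d n) \<Longrightarrow> dirichlet_series c = dirichlet_series d"
  unfolding dirichlet_series_def fun_eq_iff by (intro allI suminf_cong) (metis bot_nat_0.not_eq_extremum mult_zero_right of_nat_0 powr_0)

text \<open>Termwise differentiation. On the half plane to the right of the midpoint between 1 and
  Re s, the differentiated series is majorised by its value at that midpoint.\<close>

lemma has_field_derivative_dirichlet_series:
  assumes c: "summable_right_of_1 c" and s: "Re s > 1"
  shows "(dirichlet_series c has_field_derivative dirichlet_series (\<lambda>n. - of_real (ln (real n)) * c n) s) (at s)"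
proof -
  define \<sigma> where "\<sigma> = (1 + Re s) / 2"
  have \<sigma>: "\<sigma> > 1" "\<sigma> < Re s" using s by (auto simp: \<sigma>_def field_simps)
  define S where "S = {w. Re w > \<sigma>}"
  have S: "open S" "convex S" "s \<in> S"
    using \<sigma> by (auto simp: S_def open_halfspace_Re_gt convex_halfspace_Re_gt)
  have ln: "summable_right_of_1 (\<lambda>n. - of_real (ln (real n)) * c n)"
    using summable_right_of_1_ln[OF c] by simp
  show ?thesis
    unfolding dirichlet_series_def
  proof (rule has_field_derivative_series'(2)[of S _ _ s])
    fix n w assume w: "w \<in> S"
    show "((\<lambda>z. c n * of_nat n powr (-z)) has_field_derivative
             - of_real (ln (real n)) * c n * of_nat n powr (-w)) (at w within S)"
    proof (cases "n = 0")
      case False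
      then have "((\<lambda>z. of_nat n powr (-z)) has_field_derivative
          Ln (of_nat n) * of_nat n powr (-w) * (-1)) (at w within S)"
        by (intro DERIV_chain'[of uminus "-1" w S "\<lambda>z. of_nat n powr z"] has_field_derivative_powr_right)
           (auto intro!: derivative_eq_intros)
      from DERIV_cmult[OF this, of "c n"] False show ?thesis
        by (simp add: mult_ac flip: Ln_of_nat)
    qed auto
  next
    show "uniformly_convergent_on S (\<lambda>n w. \<Sum>i<n. - of_real (ln (real i)) * c i * of_nat i powr (-w))"
    proof (rule Weierstrass_m_test'_ev)
      show "summable (\<lambda>n. norm (- of_real (ln (real n)) * c n) * real n powr (-\<sigma>))"
        using ln \<sigma> unfolding summable_right_of_1_def by blast
      show "\<forall>\<^sub>F n in sequentially. \<forall>x\<in>S. norm (- of_real (ln (real n)) * c n * of_nat n powr (-x)) \<le>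
          norm (- of_real (ln (real n)) * c n) * real n powr (-\<sigma>)"
        using eventually_gt_at_top[of 0]
      proof eventually_elim
        case (elim n)
        show ?case
        proof
          fix x assume "x \<in> S"
          then have "real n powr (- Re x) \<le> real n powr (-\<sigma>)"
            using elim by (intro powr_mono) (auto simp: S_def)
          then show "norm (- of_real (ln (real n)) * c n * of_nat n powr (-x)) \<le>
            norm (- of_real (ln (real n)) * c n) * real n powr (-\<sigma>)"
            by (simp only: norm_mult norm_nat_powr) (simp add: mult_left_mono)
        qed
      qed
    qed
  next
    show "summable (\<lambda>n. c n * of_nat n powr (-s))" using summable_right_of_1_summable[OF c s] .
  qed (use S in \<open>auto simp: interior_open\<close>)
qed

lemma open_Re_gt_1: "open {s::complex. Re s > 1}"
  by (rule open_halfspace_Re_gt)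

lemma holomorphic_dirichlet_series: "summable_right_of_1 c \<Longrightarrow> dirichlet_series c holomorphic_on {s. Re s > 1}"
  by (rule holomorphic_onI)
     (meson has_field_derivative_dirichlet_series field_differentiable_def field_differentiable_at_within mem_Collect_eq)

lemma higher_deriv_dirichlet_series:
  assumes "summable_right_of_1 c" "Re s > 1"
  shows "(deriv ^^ k) (dirichlet_series c) s = dirichlet_series (\<lambda>n. (- of_real (ln (real n))) ^ k * c n) s"
  using assms(2)
proof (induction k arbitrary: s)
  case (Suc k)
  have "(deriv ^^ Suc k) (dirichlet_series c) s = deriv ((deriv ^^ k) (dirichlet_series c)) s" by simp
  also have "\<dots> = deriv (dirichlet_series (\<lambda>n. (- of_real (ln (real n))) ^ k * c n)) s"
    by (rule complex_derivative_transform_within_open[OF _ _ open_Re_gt_1])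
       (use Suc assms in \<open>auto intro!: holomorphic_higher_deriv holomorphic_dirichlet_series open_Re_gt_1
          summable_right_of_1_mono[OF summable_right_of_1_ln_power[of c k]] simp: norm_mult norm_power\<close>)
  also have "\<dots> = dirichlet_series (\<lambda>n. - of_real (ln (real n)) * ((- of_real (ln (real n))) ^ k * c n)) s"
    by (intro DERIV_imp_deriv has_field_derivative_dirichlet_series Suc.prems)
       (auto intro!: summable_right_of_1_mono[OF summable_right_of_1_ln_power[of c k]] assms(1) simp: norm_mult norm_power)
  finally show ?case by (simp add: mult.assoc)
qed simp

section \<open>The zeta function and its logarithm\<close>

text \<open>The double sum over pairs (a, b) converges absolutely and may be regrouped according to
  the product n = a b.\<close>

lemma dirichlet_series_mult:
  assumes c: "summable_right_of_1 c" and d: "summable_right_of_1 d" and s: "Re s > 1"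
  shows "dirichlet_series c s * dirichlet_series d s = dirichlet_series (\<lambda>n. \<Sum>a | a dvd n. c a * d (n div a)) s"
proof -
  \<comment> \<open>Zero is excluded before regrouping because it has infinitely many
    factorisations. It is put back at the end, where its summand vanishes.\<close>
  define A :: "nat set" where "A = {0<..}"
  define F where "F = (\<lambda>n. c n * of_nat n powr (-s))"
  define G where "G = (\<lambda>n. d n * of_nat n powr (-s))"
  have nF: "summable (\<lambda>n. norm (F n))" and nG: "summable (\<lambda>n. norm (G n))"
    unfolding F_def G_def using c d s by (blast intro: summable_right_of_1_summable_norm)+
  have F0: "F 0 = 0" and G0: "G 0 = 0" by (auto simp: F_def G_def)
  have restr: "(f has_sum x) A \<longleftrightarrow> (f has_sum x) UNIV" if "f 0 = 0" for f :: "nat \<Rightarrow> 'z::{topological_comm_monoid_add}" and x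
    by (rule has_sum_cong_neutral) (use that in \<open>auto simp: A_def\<close>)
  have F: "(F has_sum dirichlet_series c s) A"
    using norm_summable_imp_has_sum[OF nF summable_sums[OF summable_norm_cancel[OF nF]]]
    by (subst restr) (simp_all add: F0, simp add: F_def dirichlet_series_def)
  have G: "(G has_sum dirichlet_series d s) A"
    using norm_summable_imp_has_sum[OF nG summable_sums[OF summable_norm_cancel[OF nG]]]
    by (subst restr) (simp_all add: G0, simp add: G_def dirichlet_series_def)
  have absF: "(\<lambda>n. norm (F n)) summable_on A" and absG: "(\<lambda>n. norm (G n)) summable_on A"
    using summable_nonneg_imp_summable_on[OF nF] summable_nonneg_imp_summable_on[OF nG]
    by (auto intro: summable_on_subset_banach)
  define f where "f = (\<lambda>(a, b). F a * G b)"
  have "Infinite_Sum.abs_summable_on f (A \<times> A)"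
    unfolding Infinite_Sum.abs_summable_on_Sigma_iff f_def using absF absG
    by (auto simp: norm_mult infsum_cmult_right' abs_mult infsum_nonneg
             intro!: summable_on_cmult_right summable_on_cmult_left)
  then have sm: "f summable_on (A \<times> A)" by (rule abs_summable_summable)
  have "(f has_sum (dirichlet_series c s * dirichlet_series d s)) (A \<times> A)"
  proof (rule has_sum_SigmaI[OF _ _ sm])
    show "((\<lambda>y. f (x, y)) has_sum F x * dirichlet_series d s) A" for x
      unfolding f_def using has_sum_cmult_right[OF G] by simp
    show "((\<lambda>x. F x * dirichlet_series d s) has_sum (dirichlet_series c s * dirichlet_series d s)) A"
      using has_sum_cmult_left[OF F] by simp
  qed
  also have "?this \<longleftrightarrow> ((\<lambda>(n, a). f (a, n div a)) has_sum (dirichlet_series c s * dirichlet_series d s)) (Sigma A (\<lambda>n. {a. a dvd n}))"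
    by (rule has_sum_reindex_bij_witness[where i = "\<lambda>(n, a). (a, n div a)" and j = "\<lambda>(a, b). (a * b, a)"])
       (auto simp: A_def dvd_div_eq_0_iff elim!: dvdE)
  finally have "((\<lambda>n. \<Sum>a | a dvd n. f (a, n div a)) has_sum (dirichlet_series c s * dirichlet_series d s)) A"
    by (rule has_sum_SigmaD) (auto simp: A_def intro!: has_sum_finite)
  also have "?this \<longleftrightarrow> ((\<lambda>n. (\<Sum>a | a dvd n. c a * d (n div a)) * of_nat n powr (-s)) has_sum (dirichlet_series c s * dirichlet_series d s)) A"
  proof (rule has_sum_cong)
    fix n assume "n \<in> A"
    have "f (a, n div a) = c a * d (n div a) * of_nat n powr (-s)" if "a dvd n" for a
    proof -
      from that obtain b where n: "n = a * b" by (auto elim: dvdE)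
      have "of_nat n powr (-s) = of_nat a powr (-s) * of_nat b powr (-s)"
        unfolding n of_nat_mult by (rule powr_times_real) auto
      then show ?thesis using \<open>n \<in> A\<close> by (auto simp: f_def F_def G_def n A_def)
    qed
    then show "(\<Sum>a | a dvd n. f (a, n div a)) = (\<Sum>a | a dvd n. c a * d (n div a)) * of_nat n powr (-s)"
      by (simp add: sum_distrib_right)
  qed
  also have "\<dots> \<longleftrightarrow> ((\<lambda>n. (\<Sum>a | a dvd n. c a * d (n div a)) * of_nat n powr (-s)) has_sum (dirichlet_series c s * dirichlet_series d s)) UNIV"
    by (rule restr) auto
  finally have "(\<lambda>n. (\<Sum>a | a dvd n. c a * d (n div a)) * of_nat n powr (-s)) sums (dirichlet_series c s * dirichlet_series d s)"
    by (rule has_sum_imp_sums)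
  then show ?thesis by (simp add: dirichlet_series_def sums_iff)
qed

abbreviation zeta :: "complex \<Rightarrow> complex" where
  "zeta \<equiv> dirichlet_series (\<lambda>_. 1)"

lemma summable_right_of_1_of_ln_power: "summable_right_of_1 (\<lambda>n. of_real (ln (real n)) ^ k)"
  using summable_right_of_1_ln_power[OF summable_right_of_1_1, of k] by simp

lemma summable_right_of_1_mangoldt: "summable_right_of_1 mangoldt"
  by (rule summable_right_of_1_mono[OF summable_right_of_1_of_ln_power[of 1]]) (use mangoldt_le in \<open>auto simp: abs_if\<close>)

text \<open>The divisor sum of the von Mangoldt function is the logarithm. This identity takes the
  place of the Euler product.\<close>

lemma zeta_mult_mangoldt:
  assumes "Re s > 1"
  shows "zeta s * dirichlet_series mangoldt s = - deriv zeta s"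
proof -
  have "zeta s * dirichlet_series mangoldt s = dirichlet_series mangoldt s * zeta s" by simp
  also have "\<dots> = dirichlet_series (\<lambda>n. \<Sum>a | a dvd n. mangoldt a * 1) s"
    by (rule dirichlet_series_mult) (use assms in \<open>auto intro: summable_right_of_1_1 summable_right_of_1_mangoldt\<close>)
  also have "\<dots> = dirichlet_series (\<lambda>n. - (- of_real (ln (real n)) * 1)) s"
    by (rule fun_cong[OF dirichlet_series_cong]) (simp add: mangoldt_sum)
  also have "\<dots> = - dirichlet_series (\<lambda>n. - of_real (ln (real n)) * 1) s"
    by (rule dirichlet_series_uminus) (use assms summable_right_of_1_of_ln_power[of 1] in auto)
  also have "dirichlet_series (\<lambda>n. - of_real (ln (real n)) * 1) s = deriv zeta s"
    using DERIV_imp_deriv[OF has_field_derivative_dirichlet_series[OF summable_right_of_1_1 assms]] by simp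
  finally show ?thesis .
qed

text \<open>A logarithm of zeta up to an additive constant: the coefficient at a prime power p^m is
  1/m. At n = 1 the quotient is 0/0 = 0. The coefficients are nonnegative, which is what the 3-4-1
  inequality requires.\<close>

definition log_zeta :: "complex \<Rightarrow> complex" where
  "log_zeta = dirichlet_series (\<lambda>n. mangoldt n / of_real (ln (real n)))"

lemma summable_right_of_1_log_zeta: "summable_right_of_1 (\<lambda>n. mangoldt n / of_real (ln (real n)))"
  by (rule summable_right_of_1_mono[OF summable_right_of_1_1])
     (use mangoldt_le in \<open>auto simp: norm_divide divide_le_eq_1 abs_if not_less\<close>)

lemma has_field_derivative_log_zeta:
  assumes "Re s > 1"
  shows "(log_zeta has_field_derivative - dirichlet_series mangoldt s) (at s)"
proof -
  have "(log_zeta has_field_derivative dirichlet_series (\<lambda>n. - of_real (ln (real n)) * (mangoldt n / of_real (ln (real n)))) s) (at s)"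
    unfolding log_zeta_def by (rule has_field_derivative_dirichlet_series[OF summable_right_of_1_log_zeta assms])
  also have "dirichlet_series (\<lambda>n. - of_real (ln (real n)) * (mangoldt n / of_real (ln (real n)))) = dirichlet_series (\<lambda>n. - mangoldt n)"
  proof (rule dirichlet_series_cong)
    fix n :: nat assume "n > 0"
    then show "- complex_of_real (ln (real n)) * (mangoldt n / of_real (ln (real n))) = - mangoldt n"
      by (cases "n = 1") auto
  qed
  also have "\<dots> s = - dirichlet_series mangoldt s"
    by (rule dirichlet_series_uminus[OF summable_right_of_1_mangoldt assms])
  finally show ?thesis .
qed

text \<open>Excludes the constant 0 in \<open>zeta_eq_exp\<close>: the term n = 1 is positive and
  the others are nonnegative.\<close>

lemma Re_zeta_2: "Re (zeta 2) > 0"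
proof -
  have s: "summable (\<lambda>n. 1 * of_nat n powr (-2) :: complex)"
    by (rule summable_right_of_1_summable[OF summable_right_of_1_1]) auto
  have pos: "Re (of_nat n powr (-2)) \<ge> 0" for n
  proof (cases "n = 0")
    case False
    then have "Ln (of_nat n) = of_real (ln (real n))" by (simp add: Ln_of_nat)
    then show ?thesis using False by (simp add: powr_def Re_exp)
  qed auto
  have "0 < (\<Sum>n. Re (1 * of_nat n powr (-2)))"
    by (rule suminf_pos2[where i = 1]) (use summable_Re[OF s] pos in auto)
  also have "\<dots> = Re (zeta 2)"
    unfolding dirichlet_series_def using sums_unique[OF sums_Re[OF summable_sums[OF s]]] by simp
  finally show ?thesis .
qed

text \<open>Both sides have the same logarithmic derivative.\<close>

lemma zeta_eq_exp: "\<exists>C. C \<noteq> 0 \<and> (\<forall>s. Re s > 1 \<longrightarrow> zeta s = C * exp (log_zeta s))"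
proof -
  have "\<exists>C. \<forall>s\<in>{s. Re s > 1}. zeta s * exp (- log_zeta s) = C"
  proof (rule has_field_derivative_zero_constant)
    show "convex {s. Re s > 1}" by (rule convex_halfspace_Re_gt)
    fix s :: complex assume "s \<in> {s. Re s > 1}"
    then have s: "Re s > 1" by simp
    have 1: "(zeta has_field_derivative deriv zeta s) (at s)"
      using has_field_derivative_dirichlet_series[OF summable_right_of_1_1 s] DERIV_imp_deriv by metis
    have "((\<lambda>s. zeta s * exp (- log_zeta s)) has_field_derivative
        (deriv zeta s * exp (- log_zeta s) + (exp (- log_zeta s) * (- (- dirichlet_series mangoldt s))) * zeta s)) (at s)"
      by (intro DERIV_mult 1 DERIV_chain'[where f = "\<lambda>s. - log_zeta s"] DERIV_minus has_field_derivative_log_zeta s DERIV_exp)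
    also have "deriv zeta s * exp (- log_zeta s) + (exp (- log_zeta s) * (- (- dirichlet_series mangoldt s))) * zeta s
        = exp (- log_zeta s) * (deriv zeta s + zeta s * dirichlet_series mangoldt s)" by (simp add: algebra_simps)
    also have "\<dots> = 0" by (simp add: zeta_mult_mangoldt[OF s])
    finally show "((\<lambda>s. zeta s * exp (- log_zeta s)) has_field_derivative 0) (at s within {s. Re s > 1})"
      by (rule has_field_derivative_at_within)
  qed
  then obtain C where C: "\<And>s. Re s > 1 \<Longrightarrow> zeta s * exp (- log_zeta s) = C" by auto
  then have eq: "zeta s = C * exp (log_zeta s)" if "Re s > 1" for s
    using C[OF that] by (auto simp: exp_minus field_simps)
  have "C \<noteq> 0" using Re_zeta_2 eq[of 2] by auto
  with eq show ?thesis by blast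
qed

lemma zeta_nonzero: "Re s > 1 \<Longrightarrow> zeta s \<noteq> 0"
  using zeta_eq_exp by (metis exp_not_eq_zero mult_eq_0_iff)

section \<open>The 3-4-1 inequality\<close>

lemma Re_nat_powr:
  assumes "n > 0"
  shows "Re (of_nat n powr (-s)) = real n powr (- Re s) * cos (Im s * ln (real n))"
proof -
  have "Ln (of_nat n) = of_real (ln (real n))" using assms by (simp add: Ln_of_nat)
  then show ?thesis using assms by (simp add: powr_def Re_exp)
qed

text \<open>The inequality holds term by term: each coefficient is nonnegative and is multiplied by
  3 + 4 cos u + cos 2u = 2 (1 + cos u)^2 with u = t ln n.\<close>

lemma log_zeta_341:
  assumes "\<sigma> > 1"
  shows "Re (3 * log_zeta (of_real \<sigma>) + 4 * log_zeta (Complex \<sigma> t) + log_zeta (Complex \<sigma> (2*t))) \<ge> 0"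
proof -
  let ?c = "\<lambda>n. mangoldt n / of_real (ln (real n)) :: complex"
  have sm: "summable (\<lambda>n. ?c n * of_nat n powr (- Complex \<sigma> u))" for u
    by (rule summable_right_of_1_summable[OF summable_right_of_1_log_zeta]) (use assms in auto)
  have sums: "(\<lambda>n. Re (?c n * of_nat n powr (- Complex \<sigma> u))) sums Re (log_zeta (Complex \<sigma> u))" for u
    unfolding log_zeta_def dirichlet_series_def by (intro sums_Re summable_sums sm)
  have eq: "Re (3 * log_zeta (of_real \<sigma>) + 4 * log_zeta (Complex \<sigma> t) + log_zeta (Complex \<sigma> (2*t)))
    = 3 * Re (log_zeta (Complex \<sigma> 0)) + 4 * Re (log_zeta (Complex \<sigma> t)) + Re (log_zeta (Complex \<sigma> (2*t)))"
    by (simp add: complex_of_real_def)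
  have "(\<lambda>n. 3 * Re (?c n * of_nat n powr (- Complex \<sigma> 0)) + 4 * Re (?c n * of_nat n powr (- Complex \<sigma> t))
      + Re (?c n * of_nat n powr (- Complex \<sigma> (2*t)))) sums
     (3 * Re (log_zeta (Complex \<sigma> 0)) + 4 * Re (log_zeta (Complex \<sigma> t)) + Re (log_zeta (Complex \<sigma> (2*t))))"
    by (intro sums_add sums_mult sums)
  moreover have "0 \<le> 3 * Re (?c n * of_nat n powr (- Complex \<sigma> 0)) + 4 * Re (?c n * of_nat n powr (- Complex \<sigma> t))
      + Re (?c n * of_nat n powr (- Complex \<sigma> (2*t)))" for n
  proof (cases "n = 0")
    case False
    define r :: real where "r = mangoldt n / ln (real n)"
    have r: "r \<ge> 0" using False mangoldt_nonneg[of n] by (auto simp: r_def)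
    have cr: "?c n = of_real r" by (simp add: r_def)
    have Re: "Re (?c n * of_nat n powr (- Complex \<sigma> u)) = r * (real n powr (- \<sigma>) * cos (u * ln (real n)))" for u
      unfolding cr using Re_nat_powr[of n "Complex \<sigma> u"] False by simp
    define \<theta> where "\<theta> = t * ln (real n)"
    have "3 + 4 * cos \<theta> + cos (2 * \<theta>) = 2 * (1 + cos \<theta>)\<^sup>2"
      unfolding cos_double_cos by (simp add: power2_eq_square algebra_simps)
    then have "3 + 4 * cos \<theta> + cos (2 * \<theta>) \<ge> 0" by simp
    then have "0 \<le> r * real n powr (-\<sigma>) * (3 + 4 * cos \<theta> + cos (2 * \<theta>))"
      using r by simp
    also have "\<dots> = 3 * (r * (real n powr (- \<sigma>) * cos (0 * ln (real n)))) + 4 * (r * (real n powr (- \<sigma>) * cos (t * ln (real n))))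
       + r * (real n powr (- \<sigma>) * cos (2 * t * ln (real n)))"
      by (simp add: \<theta>_def algebra_simps)
    finally show ?thesis unfolding Re .
  qed auto
  ultimately show ?thesis unfolding eq by (metis (no_types, lifting) sums_le sums_zero)
qed

text \<open>The constant of \<open>zeta_eq_exp\<close> enters with the exponent 3 + 4 + 1 = 8, so
  its value never has to be determined.\<close>

lemma zeta_341:
  obtains \<delta> where "\<delta> > 0"
    "\<And>\<sigma> t. \<sigma> > 1 \<Longrightarrow> norm (zeta (of_real \<sigma>)) ^ 3 * norm (zeta (Complex \<sigma> t)) ^ 4 * norm (zeta (Complex \<sigma> (2*t))) \<ge> \<delta>"
proof -
  obtain C where C: "C \<noteq> 0" "\<And>s. Re s > 1 \<Longrightarrow> zeta s = C * exp (log_zeta s)"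
    using zeta_eq_exp by blast
  show ?thesis
  proof (rule that[of "norm C ^ 8"])
    fix \<sigma> t :: real assume \<sigma>: "\<sigma> > 1"
    have "norm (zeta (of_real \<sigma>)) ^ 3 * norm (zeta (Complex \<sigma> t)) ^ 4 * norm (zeta (Complex \<sigma> (2*t))) =
      norm ((C * exp (log_zeta (of_real \<sigma>))) ^ 3 * (C * exp (log_zeta (Complex \<sigma> t))) ^ 4 * (C * exp (log_zeta (Complex \<sigma> (2*t)))))"
      using \<sigma> by (simp add: C norm_mult norm_power)
    also have "(C * exp (log_zeta (of_real \<sigma>))) ^ 3 * (C * exp (log_zeta (Complex \<sigma> t))) ^ 4 * (C * exp (log_zeta (Complex \<sigma> (2*t)))) =
      C ^ 8 * exp (3 * log_zeta (of_real \<sigma>) + 4 * log_zeta (Complex \<sigma> t) + log_zeta (Complex \<sigma> (2*t)))"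
      by (simp add: exp_add exp_of_nat_mult[of 3, simplified] exp_of_nat_mult[of 4, simplified] power_mult_distrib)
         (simp add: eval_nat_numeral mult_ac)
    also have "norm \<dots> = norm C ^ 8 * exp (Re (3 * log_zeta (of_real \<sigma>) + 4 * log_zeta (Complex \<sigma> t) + log_zeta (Complex \<sigma> (2*t))))"
      by (simp add: norm_mult norm_power)
    also have "\<dots> \<ge> norm C ^ 8 * 1"
      using log_zeta_341[OF \<sigma>, of t] by (intro mult_left_mono) auto
    finally show "norm (zeta (of_real \<sigma>)) ^ 3 * norm (zeta (Complex \<sigma> t)) ^ 4 * norm (zeta (Complex \<sigma> (2*t))) \<ge> norm C ^ 8"
      by simp
  qed (use C in auto)
qed

section \<open>Continuation of the zeta function across the line Re s = 1\<close>

lemma closed_segment_Suc: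
  assumes "w \<in> closed_segment (of_nat n) (of_nat n + 1 :: complex)"
  obtains x where "w = of_real x" "real n \<le> x" "x \<le> real n + 1"
proof -
  from assms obtain u where u: "0 \<le> u" "u \<le> 1" "w = (1 - of_real u) * of_nat n + of_real u * (of_nat n + 1)"
    by (auto simp: in_segment scaleR_conv_of_real)
  then have "w = of_real (real n + u)" by (simp add: algebra_simps)
  then show ?thesis using u by (intro that[of "real n + u"]) auto
qed

text \<open>The mean value bound, good when n exceeds the norm of s. For smaller n the trivial bound
  \<open>norm_powr_diff_le2\<close> is better; \<open>norm_zeta_summand_le\<close> interpolates
  between the two.\<close>

lemma norm_powr_diff_le:
  assumes n: "n > 0" and s: "Re s > 0" and w: "w \<in> closed_segment (of_nat n) (of_nat n + 1 :: complex)"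
  shows "norm (w powr (-s) - of_nat n powr (-s)) \<le> norm s * real n powr (- Re s - 1)"
proof -
  let ?S = "closed_segment (of_nat n) (of_nat n + 1 :: complex)"
  have "norm (w powr (-s) - of_nat n powr (-s)) \<le> norm s * real n powr (- Re s - 1) * norm (w - of_nat n)"
  proof (rule field_differentiable_bound[of ?S])
    fix z assume "z \<in> ?S"
    then obtain x where x: "z = of_real x" "real n \<le> x" "x \<le> real n + 1" by (rule closed_segment_Suc)
    show "((\<lambda>z. z powr (-s)) has_field_derivative (-s) * z powr (-s-1)) (at z within ?S)"
      using x n by (intro has_field_derivative_at_within[OF has_field_derivative_powr]) (auto simp: complex_nonpos_Reals_iff)
    have "norm ((-s) * z powr (-s-1)) = norm s * x powr (- Re s - 1)"
      using x n by (simp add: norm_mult norm_powr_real_powr)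
    also have "\<dots> \<le> norm s * real n powr (- Re s - 1)"
      using x n s by (intro mult_left_mono powr_mono2') auto
    finally show "norm ((-s) * z powr (-s-1)) \<le> norm s * real n powr (- Re s - 1)" .
  qed (use w in auto)
  also have "norm (w - of_nat n) \<le> 1"
  proof -
    from w obtain x where x: "w = of_real x" "real n \<le> x" "x \<le> real n + 1" by (rule closed_segment_Suc)
    have "norm (w - of_nat n) = norm (of_real (x - real n) :: complex)" using x by simp
    then show ?thesis using x unfolding norm_of_real by simp
  qed
  then have "norm s * real n powr (- Re s - 1) * norm (w - of_nat n) \<le> norm s * real n powr (- Re s - 1) * 1"
    by (intro mult_left_mono) auto
  finally show ?thesis by simp
qed

lemma norm_powr_diff_le2:
  assumes n: "n > 0" and s: "Re s > 0" and w: "w \<in> closed_segment (of_nat n) (of_nat n + 1 :: complex)"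
  shows "norm (w powr (-s) - of_nat n powr (-s)) \<le> 2 * real n powr (- Re s)"
proof -
  from w obtain x where x: "w = of_real x" "real n \<le> x" "x \<le> real n + 1" by (rule closed_segment_Suc)
  have "norm (w powr (-s)) \<le> real n powr (- Re s)"
    using x n s by (simp add: norm_powr_real_powr powr_mono2')
  then show ?thesis
    using norm_triangle_ineq4[of "w powr (-s)" "of_nat n powr (-s)"] by (simp add: norm_nat_powr)
qed

text \<open>\<^term>\<open>zeta_summand n s\<close> is \<open>s - 1\<close> times the difference of \<open>k\<^sup>-\<^sup>s\<close> and the integral
  of \<open>x\<^sup>-\<^sup>s\<close> over \<open>[k, k + 1]\<close>, where \<open>k = n + 1\<close>.\<close>

definition zeta_summand :: "nat \<Rightarrow> complex \<Rightarrow> complex" where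
  "zeta_summand n s = (s - 1) * of_nat (Suc n) powr (-s) + of_nat (Suc (Suc n)) powr (1 - s) - of_nat (Suc n) powr (1 - s)"

lemma norm_zeta_summand_aux:
  assumes s: "Re s > 0" 
   and B: "\<And>w. w \<in> closed_segment (of_nat (Suc n)) (of_nat (Suc n) + 1 :: complex) \<Longrightarrow> norm (w powr (-s) - of_nat (Suc n) powr (-s)) \<le> B"
  shows "norm (zeta_summand n s) \<le> norm (s - 1) * B"
proof -
  let ?k = "of_nat (Suc n) :: complex"
  let ?S = "closed_segment ?k (?k + 1)"
  \<comment> \<open>The increment of this function over the segment is the summand, and its
    derivative is -(s - 1) times the difference of powers bounded by \<open>B\<close>. The mean
    value bound thus replaces an integral.\<close>
  let ?f = "\<lambda>w. w powr (1 - s) + (w - ?k) * ((s - 1) * ?k powr (-s))"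
  have "norm (?f (?k + 1) - ?f ?k) \<le> norm (s - 1) * B * norm (?k + 1 - ?k)"
  proof (rule field_differentiable_bound[of ?S])
    fix z assume z: "z \<in> ?S"
    then obtain x where x: "z = of_real x" "real (Suc n) \<le> x" by (rule closed_segment_Suc)
    have "((\<lambda>z. z powr (1 - s)) has_field_derivative (1 - s) * z powr (1 - s - 1)) (at z within ?S)"
      using x by (intro has_field_derivative_at_within[OF has_field_derivative_powr]) (auto simp: complex_nonpos_Reals_iff)
    then show "(?f has_field_derivative (1 - s) * z powr (1 - s - 1) + (1 - 0) * ((s - 1) * ?k powr (-s))) (at z within ?S)"
      by (intro DERIV_add DERIV_cmult_right DERIV_diff) auto
    have "(1 - s) * z powr (1 - s - 1) + (1 - 0) * ((s - 1) * ?k powr (-s)) = - ((s - 1) * (z powr (-s) - ?k powr (-s)))"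
      by (simp add: algebra_simps)
    also have "norm \<dots> = norm (s - 1) * norm (z powr (-s) - ?k powr (-s))"
      by (simp only: norm_minus_cancel norm_mult)
    also have "\<dots> \<le> norm (s - 1) * B"
      by (intro mult_left_mono B z) auto
    finally show "norm ((1 - s) * z powr (1 - s - 1) + (1 - 0) * ((s - 1) * ?k powr (-s))) \<le> norm (s - 1) * B" .
  qed auto
  also have "?f (?k + 1) - ?f ?k = zeta_summand n s"
    by (simp add: zeta_summand_def algebra_simps)
  finally show ?thesis by simp
qed

text \<open>With x = norm s / k, the two bounds for the difference of powers are multiples of min(1,
  x), and min(1, x) \<le> \<open>x powr \<epsilon>\<close>. The factor
  \<open>k powr (-\<epsilon>)\<close> gained here gives convergence to the left of Re s = 1, at the
  price of the growth \<open>norm s powr \<epsilon>\<close>.\<close>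

lemma norm_zeta_summand_le:
  assumes s: "Re s > 0" and \<epsilon>: "0 < \<epsilon>" "\<epsilon> \<le> 1"
  shows "norm (zeta_summand n s) \<le> 2 * norm (s - 1) * norm s powr \<epsilon> * real (Suc n) powr (- Re s - \<epsilon>)"
proof -
  define k where "k = real (Suc n)"
  have k: "k > 0" by (simp add: k_def)
  have s0: "norm s > 0" using s by auto
  have eq: "norm s powr \<epsilon> * k powr (- Re s - \<epsilon>) = (norm s / k) powr \<epsilon> * k powr (- Re s)"
    using k s0 by (simp add: powr_diff powr_divide)
  have "\<exists>B. (\<forall>w\<in>closed_segment (of_nat (Suc n)) (of_nat (Suc n) + 1 :: complex). norm (w powr (-s) - of_nat (Suc n) powr (-s)) \<le> B) \<and>
      B \<le> 2 * (norm s powr \<epsilon> * k powr (- Re s - \<epsilon>))"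
  proof (cases "norm s \<ge> k")
    case True
    have "1 \<le> (norm s / k) powr \<epsilon>" using True k \<epsilon> by (intro ge_one_powr_ge_zero) auto
    then have "2 * (1 * k powr (- Re s)) \<le> 2 * ((norm s / k) powr \<epsilon> * k powr (- Re s))"
      by (intro mult_left_mono mult_right_mono) auto
    then show ?thesis
      using norm_powr_diff_le2[OF _ s, of "Suc n"]
      unfolding eq by (intro exI[of _ "2 * k powr (- Re s)"]) (auto simp: k_def simp del: of_nat_Suc)
  next
    case False
    have "norm s / k \<le> (norm s / k) powr \<epsilon>"
      using powr_mono'[of \<epsilon> 1 "norm s / k"] \<epsilon> False k s0 by (simp add: divide_le_eq_1)
    then have "norm s / k * k powr (- Re s) \<le> (norm s / k) powr \<epsilon> * k powr (- Re s)"
      by (intro mult_right_mono) auto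
    moreover have "norm s * k powr (- Re s - 1) = norm s / k * k powr (- Re s)"
      using k by (simp add: powr_diff)
    moreover have "0 \<le> (norm s / k) powr \<epsilon> * k powr (- Re s)" by simp
    ultimately have "norm s * k powr (- Re s - 1) \<le> 2 * ((norm s / k) powr \<epsilon> * k powr (- Re s))"
      by linarith
    then show ?thesis
      using norm_powr_diff_le[OF _ s, of "Suc n"]
      unfolding eq by (intro exI[of _ "norm s * k powr (- Re s - 1)"]) (auto simp: k_def simp del: of_nat_Suc)
  qed
  then obtain B where B: "\<And>w. w \<in> closed_segment (of_nat (Suc n)) (of_nat (Suc n) + 1 :: complex) \<Longrightarrow> norm (w powr (-s) - of_nat (Suc n) powr (-s)) \<le> B"
     "B \<le> 2 * (norm s powr \<epsilon> * k powr (- Re s - \<epsilon>))" by blast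
  have "norm (zeta_summand n s) \<le> norm (s - 1) * B" by (rule norm_zeta_summand_aux[OF s B(1)])
  also have "\<dots> \<le> norm (s - 1) * (2 * (norm s powr \<epsilon> * k powr (- Re s - \<epsilon>)))"
    by (intro mult_left_mono B(2)) auto
  finally show ?thesis by (simp add: k_def mult_ac)
qed

text \<open>This is (s - 1) zeta(s), continued. The leading 1 is s - 1 times the integral of x^(-s)
  over x \<ge> 1.\<close>

definition zeta_without_pole :: "complex \<Rightarrow> complex" where
  "zeta_without_pole s = 1 + (\<Sum>n. zeta_summand n s)"

lemma summable_Suc_powr: "a < -1 \<Longrightarrow> summable (\<lambda>n. real (Suc n) powr a)"
  using summable_real_powr_iff[of a] by (subst summable_Suc_iff) auto

lemma holomorphic_zeta_without_pole: "zeta_without_pole holomorphic_on {s. Re s > 1/2}"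
proof (rule holomorphic_uniform_sequence)
  show op: "open {s::complex. Re s > 1/2}" by (rule open_halfspace_Re_gt)
  show "(\<lambda>s. 1 + (\<Sum>i<n. zeta_summand i s)) holomorphic_on {s. Re s > 1/2}" for n
    unfolding zeta_summand_def by (intro holomorphic_intros)
  fix x :: complex assume "x \<in> {s. Re s > 1/2}"
  then obtain d where d: "d > 0" "cball x d \<subseteq> {s. Re s > 1/2}"
    using op open_contains_cball by blast
  define R where "R = norm x + d"
  have R: "norm s \<le> R" if "s \<in> cball x d" for s
    using that norm_triangle_sub[of s x] by (auto simp: R_def dist_norm norm_minus_commute)
  have R0: "R \<ge> 0" using d by (simp add: R_def)
  have "uniform_limit (cball x d) (\<lambda>n s. \<Sum>i<n. zeta_summand i s) (\<lambda>s. \<Sum>n. zeta_summand n s) sequentially"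
  proof (rule Weierstrass_m_test)
    show "summable (\<lambda>n. (2 * (R + 1) * R) * real (Suc n) powr (- 3/2))"
      by (intro summable_mult summable_Suc_powr) auto
    fix n s assume s: "s \<in> cball x d"
    then have re: "Re s > 1/2" using d by auto
    \<comment> \<open>Exponent \<epsilon> = 1 is the best for convergence: with Re s > 1/2 the power
      of n + 1 is below -3/2.\<close>
    have "norm (zeta_summand n s) \<le> 2 * norm (s - 1) * norm s powr 1 * real (Suc n) powr (- Re s - 1)"
      using re by (intro norm_zeta_summand_le) auto
    also have "\<dots> \<le> 2 * (R + 1) * R * real (Suc n) powr (-3/2)"
    proof (intro mult_mono powr_mono)
      show "norm (s - 1) \<le> R + 1"
        using R[OF s] norm_triangle_ineq4[of s 1] by simp
      show "norm s powr 1 \<le> R" using R[OF s] by simp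
    qed (use re R0 in auto)
    finally show "norm (zeta_summand n s) \<le> (2 * (R + 1) * R) * real (Suc n) powr (-3/2)" .
  qed
  then have "uniform_limit (cball x d) (\<lambda>n s. 1 + (\<Sum>i<n. zeta_summand i s)) zeta_without_pole sequentially"
    unfolding zeta_without_pole_def by (intro uniform_limit_intros)
  with d show "\<exists>d>0. cball x d \<subseteq> {s. Re s > 1/2} \<and>
      uniform_limit (cball x d) (\<lambda>n s. 1 + (\<Sum>i<n. zeta_summand i s)) zeta_without_pole sequentially" by blast
qed

lemma zeta_without_pole_1 [simp]: "zeta_without_pole 1 = 1"
proof -
  have "zeta_summand n 1 = 0" for n by (simp add: zeta_summand_def del: of_nat_Suc)
  then show ?thesis by (simp add: zeta_without_pole_def)
qed

text \<open>One half of \<epsilon> pays for moving to the left of Re s = 1, the other half keeps the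
  sum over n convergent.\<close>

lemma zeta_without_pole_bound:
  assumes "0 < \<epsilon>" "\<epsilon> \<le> 1"
  obtains C where "C > 0" "\<And>s. Re s \<ge> 1 - \<epsilon> / 2 \<Longrightarrow> norm (zeta_without_pole s - 1) \<le> C * norm (s - 1) * norm s powr \<epsilon>"
proof -
  define K where "K = (\<Sum>n. real (Suc n) powr (- 1 - \<epsilon> / 2))"
  have sm: "summable (\<lambda>n. real (Suc n) powr (- 1 - \<epsilon> / 2))"
    by (intro summable_Suc_powr) (use assms in auto)
  have K: "K > 0" unfolding K_def by (intro suminf_pos sm) auto
  show ?thesis
  proof (rule that[of "2 * K"])
    fix s :: complex assume s: "Re s \<ge> 1 - \<epsilon> / 2"
    then have s0: "Re s > 0" using assms by auto
    have le: "norm (zeta_summand n s) \<le> 2 * norm (s - 1) * norm s powr \<epsilon> * real (Suc n) powr (-1 - \<epsilon> / 2)" for n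
    proof -
      have "norm (zeta_summand n s) \<le> 2 * norm (s - 1) * norm s powr \<epsilon> * real (Suc n) powr (- Re s - \<epsilon>)"
        by (intro norm_zeta_summand_le s0 assms)
      also have "\<dots> \<le> 2 * norm (s - 1) * norm s powr \<epsilon> * real (Suc n) powr (-1 - \<epsilon> / 2)"
        using s by (intro mult_left_mono powr_mono) auto
      finally show ?thesis .
    qed
    have "norm (zeta_without_pole s - 1) \<le> (\<Sum>n. 2 * norm (s - 1) * norm s powr \<epsilon> * real (Suc n) powr (-1 - \<epsilon> / 2))"
      unfolding zeta_without_pole_def using le by (simp del: of_nat_Suc) (intro norm_suminf_le summable_mult sm, auto)
    also have "\<dots> = 2 * norm (s - 1) * norm s powr \<epsilon> * K"
      unfolding K_def by (rule suminf_mult[OF sm])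
    finally show "norm (zeta_without_pole s - 1) \<le> 2 * K * norm (s - 1) * norm s powr \<epsilon>" by (simp add: mult_ac)
  qed (use K in auto)
qed

text \<open>In the partial sums the powers with exponent 1 - s telescope. Their upper boundary term
  tends to 0 and the lower one cancels the leading 1.\<close>

lemma zeta_without_pole_eq_zeta:
  assumes s: "Re s > 1"
  shows "zeta_without_pole s = (s - 1) * zeta s"
proof -
  have part: "(\<Sum>i<N. zeta_summand i s) = (s - 1) * (\<Sum>i<N. of_nat (Suc i) powr (-s)) + of_nat (Suc N) powr (1 - s) - 1" for N
    by (induction N) (simp_all add: zeta_summand_def algebra_simps)
  have "(\<lambda>n. 1 * of_nat n powr (-s)) sums zeta s"
    unfolding dirichlet_series_def by (intro summable_sums summable_right_of_1_summable summable_right_of_1_1 s)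
  then have "(\<lambda>i. of_nat (Suc i) powr (-s)) sums zeta s"
    using sums_Suc_iff[of "\<lambda>n. 1 * of_nat n powr (-s)" "zeta s"] by simp
  then have 1: "(\<lambda>N. (\<Sum>i<N. of_nat (Suc i) powr (-s))) \<longlonglongrightarrow> zeta s"
    by (simp add: sums_def)
  have 2: "(\<lambda>N. of_nat (Suc N) powr (1 - s)) \<longlonglongrightarrow> 0"
  proof (rule tendsto_norm_zero_cancel)
    have "(\<lambda>N. real (Suc N) powr (1 - Re s)) \<longlonglongrightarrow> 0"
      using s by (intro tendsto_neg_powr filterlim_compose[OF filterlim_real_sequentially filterlim_Suc]) auto
    then show "(\<lambda>N. norm (of_nat (Suc N) powr (1 - s))) \<longlonglongrightarrow> 0"
      unfolding norm_nat_powr by simp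
  qed
  have "(\<lambda>N. \<Sum>i<N. zeta_summand i s) \<longlonglongrightarrow> (s - 1) * zeta s + 0 - 1"
    unfolding part by (intro tendsto_diff tendsto_add tendsto_mult tendsto_const 1 2)
  then have "(\<lambda>n. zeta_summand n s) sums ((s - 1) * zeta s - 1)" by (simp add: sums_def)
  then show ?thesis by (simp add: zeta_without_pole_def sums_iff)
qed

text \<open>The difference quotient of \<open>zeta_without_pole\<close> at 1 with the removable
  singularity filled in. As \<open>zeta_without_pole 1 = 1\<close>, it is zeta(s) - 1/(s -
  1).\<close>

definition zeta_minus_pole :: "complex \<Rightarrow> complex" where
  "zeta_minus_pole s = (if s = 1 then deriv zeta_without_pole 1 else (zeta_without_pole s - zeta_without_pole 1) / (s - 1))"

lemma holomorphic_zeta_minus_pole: "zeta_minus_pole holomorphic_on {s. Re s > 1/2}"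
  unfolding zeta_minus_pole_def[abs_def] by (intro pole_lemma_open holomorphic_zeta_without_pole open_halfspace_Re_gt)

lemma zeta_eq_zeta_minus_pole:
  assumes "Re s > 1"
  shows "zeta s = 1 / (s - 1) + zeta_minus_pole s"
proof -
  have "s \<noteq> 1" using assms by auto
  then show ?thesis unfolding zeta_minus_pole_def zeta_without_pole_eq_zeta[OF assms] by (simp add: field_simps)
qed

section \<open>Bounds for the zeta function near the line Re s = 1\<close>

text \<open>The continuation of zeta across the line, pole included. At s = 1 division by zero
  yields a meaningless 0, so the estimates stay outside a disc around 1.\<close>

definition zeta_ext :: "complex \<Rightarrow> complex" where
  "zeta_ext s = zeta_without_pole s / (s - 1)"

text \<open>The offset 2 makes every height at least 1 and gives norm s \<le> 2
  \<open>height s\<close> for 0 \<le> Re s \<le> 4.\<close>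

definition height :: "complex \<Rightarrow> real" where
  "height s = 2 + \<bar>Im s\<bar>"

lemma height_ge_1: "height s \<ge> 1" and height_pos: "height s > 0" 
  by (auto simp: height_def)

lemma zeta_ext_eq_zeta: "Re s > 1 \<Longrightarrow> zeta_ext s = zeta s"
  by (auto simp: zeta_ext_def zeta_without_pole_eq_zeta)

lemma holomorphic_zeta_ext: "zeta_ext holomorphic_on ({s. Re s > 1/2} - {1})"
  unfolding zeta_ext_def[abs_def] by (intro holomorphic_intros holomorphic_on_subset[OF holomorphic_zeta_without_pole]) auto

lemma open_zeta_ext_domain: "open ({s. Re s > 1/2} - {1::complex})"
  by (intro open_Diff open_halfspace_Re_gt) auto

lemma height_powr_le:
  assumes "height w \<le> 2 * height s" "0 < \<epsilon>" "\<epsilon> \<le> 1"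
  shows "height w powr \<epsilon> \<le> 2 * height s powr \<epsilon>"
proof -
  have "height w powr \<epsilon> \<le> (2 * height s) powr \<epsilon>"
    using assms height_pos[of w] by (intro powr_mono2) auto
  also have "\<dots> = 2 powr \<epsilon> * height s powr \<epsilon>" using height_pos[of s] by (simp add: powr_mult)
  also have "\<dots> \<le> 2 powr 1 * height s powr \<epsilon>"
    using assms by (intro mult_right_mono powr_mono) auto
  finally show ?thesis by simp
qed

lemma height_cball:
  assumes "norm (w - s) \<le> 1"
  shows "height w \<le> 2 * height s"
proof -
  have "\<bar>Im w - Im s\<bar> \<le> 1" using abs_Im_le_cmod[of "w - s"] assms by simp
  then show ?thesis by (auto simp: height_def)
qed

lemma zeta_ext_bound:
  assumes "0 < \<epsilon>" "\<epsilon> \<le> 1" "r > 0"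
  obtains C where "C > 0"
    "\<And>s. 1 - \<epsilon> / 2 \<le> Re s \<Longrightarrow> Re s \<le> 4 \<Longrightarrow> norm (s - 1) \<ge> r \<Longrightarrow> norm (zeta_ext s) \<le> C * height s powr \<epsilon>"
proof -
  obtain C0 where C0: "C0 > 0" "\<And>s. Re s \<ge> 1 - \<epsilon> / 2 \<Longrightarrow> norm (zeta_without_pole s - 1) \<le> C0 * norm (s - 1) * norm s powr \<epsilon>"
    using zeta_without_pole_bound[OF assms(1,2)] by blast
  show ?thesis
  proof (rule that[of "1 / r + C0 * 2"])
    fix s assume s: "1 - \<epsilon> / 2 \<le> Re s" "Re s \<le> 4" "norm (s - 1) \<ge> r"
    have n0: "norm (s - 1) > 0" using s assms by linarith
    have "norm s \<le> \<bar>Re s\<bar> + \<bar>Im s\<bar>" by (rule cmod_le)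
    also have "\<dots> \<le> 2 * height s" using s assms by (auto simp: height_def)
    finally have ns: "norm s \<le> 2 * height s" .
    have "norm s powr \<epsilon> \<le> (2 * height s) powr \<epsilon>" using ns assms by (intro powr_mono2) auto
    also have "\<dots> = 2 powr \<epsilon> * height s powr \<epsilon>" using height_pos[of s] by (simp add: powr_mult)
    also have "\<dots> \<le> 2 powr 1 * height s powr \<epsilon>"
      using assms by (intro mult_right_mono powr_mono) auto
    finally have nsp: "norm s powr \<epsilon> \<le> 2 * height s powr \<epsilon>" by simp
    have t1: "1 \<le> height s powr \<epsilon>" using assms height_ge_1 by (intro ge_one_powr_ge_zero) auto
    have "norm (zeta_without_pole s) \<le> 1 + norm (zeta_without_pole s - 1)"
      using norm_triangle_sub[of "zeta_without_pole s" 1] by simp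
    then have "norm (zeta_ext s) \<le> (1 + C0 * norm (s - 1) * norm s powr \<epsilon>) / norm (s - 1)"
      using C0(2)[OF s(1)] by (auto simp: zeta_ext_def norm_divide intro!: divide_right_mono)
    also have "\<dots> = 1 / norm (s - 1) + C0 * norm s powr \<epsilon>" using n0 by (simp add: field_simps)
    also have "\<dots> \<le> 1 / r * height s powr \<epsilon> + C0 * (2 * height s powr \<epsilon>)"
    proof (intro add_mono mult_left_mono nsp)
      have "1 / norm (s - 1) \<le> 1 / r" using s assms n0 by (intro divide_left_mono mult_pos_pos) auto
      also have "\<dots> \<le> 1 / r * height s powr \<epsilon>" using t1 assms by (simp add: divide_simps)
      finally show "1 / norm (s - 1) \<le> 1 / r * height s powr \<epsilon>" .
    qed (use C0 in auto)
    finally show "norm (zeta_ext s) \<le> (1 / r + C0 * 2) * height s powr \<epsilon>" by (simp add: algebra_simps)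
  qed (use C0 assms in \<open>auto intro: add_pos_pos\<close>)
qed

lemma zeta_ext_deriv_bound:
  assumes "0 < \<epsilon>" "\<epsilon> \<le> 1" "0 < r" "r \<le> 1"
  obtains C where "C > 0"
    "\<And>s. 1 - \<epsilon> / 4 \<le> Re s \<Longrightarrow> Re s \<le> 3 \<Longrightarrow> norm (s - 1) \<ge> r \<Longrightarrow> norm (deriv zeta_ext s) \<le> C * height s powr \<epsilon>"
proof -
  obtain CA where CA: "CA > 0" 
    "\<And>s. 1 - \<epsilon> / 2 \<le> Re s \<Longrightarrow> Re s \<le> 4 \<Longrightarrow> norm (s - 1) \<ge> r / 2 \<Longrightarrow> norm (zeta_ext s) \<le> CA * height s powr \<epsilon>"
    using zeta_ext_bound[of \<epsilon> "r/2"] assms by auto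
  \<comment> \<open>One radius for two demands: the disc around s stays to the right of
    \<open>1 - \<epsilon> / 2\<close> and at distance at least \<open>r / 2\<close> from the
    pole.\<close>
  define \<rho> where "\<rho> = \<epsilon> * r / 8"
  have \<rho>: "\<rho> > 0" "\<rho> \<le> \<epsilon> / 8" "\<rho> \<le> r / 8"
    using assms by (auto simp: \<rho>_def mult_left_le mult_right_le_one_le)
  show ?thesis
  proof (rule that[of "2 * CA / \<rho>"])
    fix s assume s: "1 - \<epsilon> / 4 \<le> Re s" "Re s \<le> 3" "norm (s - 1) \<ge> r"
    have near: "1/2 < Re w \<and> 1 - \<epsilon> / 2 \<le> Re w \<and> Re w \<le> 4 \<and> norm (w - 1) \<ge> r / 2 \<and> height w \<le> 2 * height s" if "norm (w - s) \<le> \<rho>" for w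
    proof -
      have "\<bar>Re w - Re s\<bar> \<le> \<rho>" using that abs_Re_le_cmod[of "w - s"] by simp
      moreover have "norm (s - 1) \<le> norm (w - 1) + norm (w - s)"
        using norm_triangle_ineq4[of "w - 1" "w - s"] by simp
      ultimately show ?thesis using s \<rho> assms that height_cball[of w s] by auto
    qed
    have sub: "cball s \<rho> \<subseteq> {s. Re s > 1/2} - {1}"
    proof
      fix w assume "w \<in> cball s \<rho>"
      then have "norm (w - s) \<le> \<rho>" by (simp add: dist_norm norm_minus_commute)
      from near[OF this] assms show "w \<in> {s. Re s > 1/2} - {1}" by auto
    qed
    have hol: "zeta_ext holomorphic_on cball s \<rho>" by (rule holomorphic_on_subset[OF holomorphic_zeta_ext sub])
    have "norm ((deriv ^^ 1) zeta_ext s) \<le> fact 1 * (CA * (2 * height s powr \<epsilon>)) / \<rho> ^ 1"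
    proof (rule Cauchy_inequality)
      show "zeta_ext holomorphic_on ball s \<rho>" by (rule holomorphic_on_subset[OF hol]) auto
      show "continuous_on (cball s \<rho>) zeta_ext" by (rule holomorphic_on_imp_continuous_on[OF hol])
      fix w assume "norm (s - w) = \<rho>"
      then have w: "norm (w - s) \<le> \<rho>" by (simp add: norm_minus_commute)
      have "norm (zeta_ext w) \<le> CA * height w powr \<epsilon>" using CA(2) near[OF w] by blast
      also have "\<dots> \<le> CA * (2 * height s powr \<epsilon>)" using near[OF w] CA(1) assms
        by (intro mult_left_mono height_powr_le) auto
      finally show "norm (zeta_ext w) \<le> CA * (2 * height s powr \<epsilon>)" .
    qed (use \<rho> in auto)
    then show "norm (deriv zeta_ext s) \<le> 2 * CA / \<rho> * height s powr \<epsilon>" by (simp add: mult_ac)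
  qed (use CA \<rho> in auto)
qed

text \<open>Controls the cubed factor of the 3-4-1 inequality, the only one whose argument
  approaches the pole.\<close>

lemma norm_zeta_real_le:
  obtains M where "M > 0" "\<And>\<sigma>. 1 < \<sigma> \<Longrightarrow> \<sigma> \<le> 3 \<Longrightarrow> norm (zeta (of_real \<sigma>)) \<le> M / (\<sigma> - 1)"
proof -
  obtain C0 where C0: "C0 > 0" "\<And>s. Re s \<ge> 1 - 1/2 \<Longrightarrow> norm (zeta_without_pole s - 1) \<le> C0 * norm (s - 1) * norm s powr 1"
    using zeta_without_pole_bound[OF zero_less_one order_refl] by blast
  show ?thesis
  proof (rule that[of "1 + C0 * 2 * 3"])
    fix \<sigma> :: real assume \<sigma>: "1 < \<sigma>" "\<sigma> \<le> 3"
    let ?s = "of_real \<sigma> :: complex"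
    have "norm (?s - 1) = norm (of_real (\<sigma> - 1) :: complex)" by simp
    then have n1: "norm (?s - 1) = \<sigma> - 1" using \<sigma> unfolding norm_of_real by simp
    have "norm (zeta_without_pole ?s) \<le> 1 + norm (zeta_without_pole ?s - 1)"
      using norm_triangle_sub[of "zeta_without_pole ?s" 1] by simp
    also have "norm (zeta_without_pole ?s - 1) \<le> C0 * norm (?s - 1) * norm ?s powr 1"
      using \<sigma> by (intro C0(2)) auto
    also have "\<dots> \<le> C0 * 2 * 3"
      unfolding n1 using \<sigma> C0 by (intro mult_mono) auto
    finally have "norm (zeta_without_pole ?s) \<le> 1 + C0 * 2 * 3" by simp
    moreover have "norm (zeta_without_pole ?s) = (\<sigma> - 1) * norm (zeta ?s)"
      using zeta_without_pole_eq_zeta[of ?s] \<sigma> n1 by (simp add: norm_mult)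
    ultimately show "norm (zeta ?s) \<le> (1 + C0 * 2 * 3) / (\<sigma> - 1)"
      using \<sigma> by (simp add: field_simps)
  qed (use C0 in \<open>auto intro: add_pos_pos\<close>)
qed

text \<open>In the 3-4-1 inequality the real factor is at most M / (Re s - 1), and the factor with
  doubled imaginary part is at most a multiple of \<open>height s powr \<epsilon>\<close>. Dividing
  by both leaves a lower bound for the fourth power.\<close>

lemma zeta_lower_bound_4:
  assumes \<epsilon>: "0 < \<epsilon>" "\<epsilon> \<le> 1" and r: "0 < r"
  obtains c where "c > 0"
    "\<And>s. 1 < Re s \<Longrightarrow> Re s \<le> 3 \<Longrightarrow> norm (s - 1) \<ge> r \<Longrightarrow> norm (zeta s) ^ 4 \<ge> c * (Re s - 1) ^ 3 * height s powr (-\<epsilon>)"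
proof -
  obtain CA where CA: "CA > 0" 
    "\<And>s. 1 - \<epsilon> / 2 \<le> Re s \<Longrightarrow> Re s \<le> 4 \<Longrightarrow> norm (s - 1) \<ge> r \<Longrightarrow> norm (zeta_ext s) \<le> CA * height s powr \<epsilon>"
    using zeta_ext_bound[OF \<epsilon> r] by auto
  obtain M where M: "M > 0" "\<And>\<sigma>. 1 < \<sigma> \<Longrightarrow> \<sigma> \<le> 3 \<Longrightarrow> norm (zeta (of_real \<sigma>)) \<le> M / (\<sigma> - 1)"
    using norm_zeta_real_le by blast
  obtain \<delta> where \<delta>: "\<delta> > 0" 
    "\<And>\<sigma> t. \<sigma> > 1 \<Longrightarrow> norm (zeta (of_real \<sigma>)) ^ 3 * norm (zeta (Complex \<sigma> t)) ^ 4 * norm (zeta (Complex \<sigma> (2*t))) \<ge> \<delta>"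
    using zeta_341 by blast
  define c where "c = \<delta> / (M ^ 3 * (CA * 2))"
  show ?thesis
  proof (rule that[of c])
    show "c > 0" using CA \<delta> M by (simp add: c_def)
    fix s assume s: "1 < Re s" "Re s \<le> 3" "norm (s - 1) \<ge> r"
    define s2 where "s2 = Complex (Re s) (2 * Im s)"
    have [simp]: "Re s2 = Re s" "Im s2 = 2 * Im s" by (simp_all add: s2_def)
    have tp: "height s powr \<epsilon> > 0" using height_pos[of s] by simp
    \<comment> \<open>Doubling the imaginary part only moves the point away from 1.\<close>
    have "norm (s - 1) \<le> norm (s2 - 1)"
      unfolding cmod_def by (rule real_sqrt_le_mono) (simp add: power2_eq_square)
    then have "norm (zeta s2) \<le> CA * height s2 powr \<epsilon>"
      using s \<epsilon> CA(2)[of s2] zeta_ext_eq_zeta[of s2] by auto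
    also have "\<dots> \<le> CA * (2 * height s powr \<epsilon>)"
      using CA \<epsilon> by (intro mult_left_mono height_powr_le) (auto simp: height_def)
    finally have 2: "norm (zeta s2) \<le> CA * (2 * height s powr \<epsilon>)" .
    have "\<delta> \<le> norm (zeta (of_real (Re s))) ^ 3 * norm (zeta s) ^ 4 * norm (zeta s2)"
      using \<delta>(2)[OF s(1), of "Im s"] by (simp add: s2_def)
    also have "\<dots> \<le> (M / (Re s - 1)) ^ 3 * norm (zeta s) ^ 4 * (CA * (2 * height s powr \<epsilon>))"
      using s M(2)[OF s(1,2)] M(1) CA by (intro mult_mono 2 power_mono) auto
    also have "\<dots> = norm (zeta s) ^ 4 * (M ^ 3 * (CA * 2)) * height s powr \<epsilon> / (Re s - 1) ^ 3"
      by (simp add: power_divide mult_ac)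
    finally show "c * (Re s - 1) ^ 3 * height s powr (-\<epsilon>) \<le> norm (zeta s) ^ 4"
      using s M CA tp unfolding c_def by (simp add: field_simps powr_minus)
  qed
qed

text \<open>The bound on the derivative transports the lower bound from a point slightly to the right.\<close>

lemma zeta_lower_bound:
  assumes \<epsilon>: "0 < \<epsilon>" "\<epsilon> \<le> 1" and r: "0 < r" "r \<le> 1"
  obtains c where "c > 0"
    "\<And>s. 1 < Re s \<Longrightarrow> Re s \<le> 2 \<Longrightarrow> norm (s - 1) \<ge> r \<Longrightarrow> norm (zeta s) \<ge> c * height s powr (-7 * \<epsilon>)"
proof -
  obtain c1 where c1: "c1 > 0"
    "\<And>s. 1 < Re s \<Longrightarrow> Re s \<le> 3 \<Longrightarrow> norm (s - 1) \<ge> r \<Longrightarrow> norm (zeta s) ^ 4 \<ge> c1 * (Re s - 1) ^ 3 * height s powr (-\<epsilon>)"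
    using zeta_lower_bound_4[OF \<epsilon> r(1)] by blast
  obtain C2 where C2: "C2 > 0"
    "\<And>s. 1 - \<epsilon> / 4 \<le> Re s \<Longrightarrow> Re s \<le> 3 \<Longrightarrow> norm (s - 1) \<ge> r \<Longrightarrow> norm (deriv zeta_ext s) \<le> C2 * height s powr \<epsilon>"
    using zeta_ext_deriv_bound[OF \<epsilon> r] by blast
  \<comment> \<open>Stands in for the fourth root of \<open>c1\<close>: a number in (0, 1] whose
    fourth power is at most \<open>c1\<close>.\<close>
  define c4 where "c4 = min 1 c1"
  have c4: "c4 > 0" "c4 ^ 4 \<le> c1"
  proof -
    show "c4 > 0" using c1 by (simp add: c4_def)
    then have "c4 ^ 4 \<le> c4 ^ 1" by (intro power_decreasing) (auto simp: c4_def)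
    also have "\<dots> \<le> c1" by (simp add: c4_def)
    finally show "c4 ^ 4 \<le> c1" .
  qed
  \<comment> \<open>Chosen so that the loss in moving from \<open>s'\<close> back to
    \<open>s\<close> is at most half of the lower bound at \<open>s'\<close>.\<close>
  define l where "l = min 1 (c4 / (2 * C2))"
  have l: "l > 0" "l \<le> 1" "C2 * l \<le> c4 / 2"
  proof -
    show "l > 0" "l \<le> 1" using c4 C2 by (auto simp: l_def)
    have "C2 * l \<le> C2 * (c4 / (2 * C2))" using C2 by (intro mult_left_mono) (auto simp: l_def)
    then show "C2 * l \<le> c4 / 2" using C2 by simp
  qed
  show ?thesis
  proof (rule that[of "c4 * l ^ 3 / 2"])
    show "c4 * l ^ 3 / 2 > 0" using c4 l by simp
    fix s assume s: "1 < Re s" "Re s \<le> 2" "norm (s - 1) \<ge> r"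
    define T where "T = height s powr (-\<epsilon>)"
    have T: "0 < T" "T \<le> 1"
      using height_ge_1[of s] height_pos[of s] \<epsilon> by (auto simp: T_def powr_minus intro!: inverse_le_1_iff[THEN iffD2] ge_one_powr_ge_zero)
    have T7: "height s powr (-7 * \<epsilon>) = T ^ 7"
      using height_pos[of s] by (simp add: T_def powr_power mult.commute)
    have T1: "height s powr \<epsilon> * T = 1"
      using height_pos[of s] by (simp add: T_def powr_minus)
    \<comment> \<open>After T is weakened to T^4, the fourth root of the lower bound at
      \<open>s'\<close> is c4 (\<eta>^3 T^4)^(1/4) = c4 l^3 T^7. The loss on the way back is C2
      \<eta> / T = C2 l^4 T^7. The exponents 8 and 4 of \<eta> = l^4 T^8 make the powers of T agree
      and the root exact.\<close>
    define \<eta> where "\<eta> = l ^ 4 * T ^ 8"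
    have \<eta>: "0 < \<eta>" "\<eta> \<le> 1"
      using l T by (auto simp: \<eta>_def intro!: mult_le_one power_le_one)
    define s' where "s' = s + of_real \<eta>"
    have s': "Re s' = Re s + \<eta>" "Im s' = Im s" by (auto simp: s'_def)
    have seg: "1 < Re w \<and> Re w \<le> 3 \<and> norm (w - 1) \<ge> r \<and> height w = height s" if "w \<in> closed_segment s s'" for w
    proof -
      from that obtain u where u: "0 \<le> u" "u \<le> 1" "w = (1 - u) *\<^sub>R s + u *\<^sub>R s'"
        by (auto simp: in_segment)
      have w: "Re w = Re s + u * \<eta>" "Im w = Im s" unfolding u(3) by (simp_all add: s' algebra_simps)
      have u\<eta>: "0 \<le> u * \<eta>" "u * \<eta> \<le> 1" using u \<eta> by (auto intro: mult_le_one)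
      have "norm (s - 1) \<le> norm (w - 1)"
        unfolding cmod_def using s u\<eta> by (intro real_sqrt_le_mono add_mono) (simp_all add: w power_mono)
      then show ?thesis using s w u\<eta> by (auto simp: height_def)
    qed
    have "norm (zeta s') ^ 4 \<ge> c1 * (Re s' - 1) ^ 3 * height s' powr (-\<epsilon>)"
      using seg[of s'] by (intro c1(2)) auto
    also have "height s' = height s" using s' by (simp add: height_def)
    finally have "c1 * (Re s' - 1) ^ 3 * T \<le> norm (zeta s') ^ 4" by (simp add: T_def)
    moreover have "(c4 * l ^ 3 * T ^ 7) ^ 4 \<le> c1 * (Re s' - 1) ^ 3 * T"
    proof -
      have "(c4 * l ^ 3 * T ^ 7) ^ 4 = c4 ^ 4 * \<eta> ^ 3 * T ^ 4"
        by (simp add: \<eta>_def power_mult_distrib flip: power_mult power_add)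
      also have "\<dots> \<le> c1 * (Re s' - 1) ^ 3 * T ^ 1"
        using c4 c1 \<eta> T s s' by (intro mult_mono power_mono power_decreasing) auto
      finally show ?thesis by simp
    qed
    ultimately have "(c4 * l ^ 3 * T ^ 7) ^ 4 \<le> norm (zeta s') ^ 4" by linarith
    then have up: "c4 * l ^ 3 * T ^ 7 \<le> norm (zeta s')"
      by (rule power_le_imp_le_base[of _ 3, simplified]) auto
    have "norm (zeta_ext s' - zeta_ext s) \<le> C2 * height s powr \<epsilon> * norm (s' - s)"
    proof (rule field_differentiable_bound[of "closed_segment s s'"])
      fix w assume w: "w \<in> closed_segment s s'"
      have "w \<in> {s. Re s > 1/2} - {1}" using seg[OF w] by auto
      then show "(zeta_ext has_field_derivative deriv zeta_ext w) (at w within closed_segment s s')"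
        by (intro has_field_derivative_at_within[OF holomorphic_derivI[OF holomorphic_zeta_ext open_zeta_ext_domain]])
      show "norm (deriv zeta_ext w) \<le> C2 * height s powr \<epsilon>"
        using C2(2)[of w] seg[OF w] \<epsilon> by auto
    qed auto
    also have "norm (s' - s) = \<eta>" using \<eta> by (simp add: s'_def)
    also have "C2 * height s powr \<epsilon> * \<eta> = C2 * l * l ^ 3 * T ^ 7 * (height s powr \<epsilon> * T)"
      by (simp add: \<eta>_def eval_nat_numeral)
    also have "\<dots> \<le> c4 / 2 * l ^ 3 * T ^ 7 * (height s powr \<epsilon> * T)"
      using l T height_pos[of s] by (intro mult_right_mono) auto
    finally have "norm (zeta_ext s' - zeta_ext s) \<le> c4 * l ^ 3 * T ^ 7 / 2" by (simp add: T1)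
    moreover have "norm (zeta_ext s') \<le> norm (zeta_ext s' - zeta_ext s) + norm (zeta_ext s)"
      using norm_triangle_ineq[of "zeta_ext s' - zeta_ext s" "zeta_ext s"] by simp
    ultimately show "c4 * l ^ 3 / 2 * height s powr (-7 * \<epsilon>) \<le> norm (zeta s)"
      unfolding T7 using up zeta_ext_eq_zeta[of s] zeta_ext_eq_zeta[of s'] s s' \<eta> by (simp add: field_simps)
  qed
qed

section \<open>Derivatives of the Dirichlet series of the von Mangoldt function minus 1\<close>

text \<open>Both -zeta'/zeta and zeta have a simple pole with residue 1 at s = 1; subtracting 1 from
  the coefficients makes these poles cancel.\<close>

definition mangoldt_minus_1 :: "nat \<Rightarrow> complex" where
  "mangoldt_minus_1 n = mangoldt n + (- 1)"

lemma summable_right_of_1_mangoldt_minus_1: "summable_right_of_1 mangoldt_minus_1"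
proof -
  have "summable_right_of_1 (\<lambda>n. mangoldt n + (- (1 :: complex)))"
    by (intro summable_right_of_1_add summable_right_of_1_mangoldt) (subst summable_right_of_1_uminus, rule summable_right_of_1_1)
  then show ?thesis by (simp add: mangoldt_minus_1_def[abs_def])
qed

lemma dirichlet_series_mangoldt_minus_1:
  assumes "Re s > 1"
  shows "dirichlet_series mangoldt_minus_1 s = - deriv zeta s / zeta s - zeta s"
proof -
  have "dirichlet_series mangoldt_minus_1 s = dirichlet_series mangoldt s + dirichlet_series (\<lambda>_. -1) s"
    unfolding mangoldt_minus_1_def[abs_def] using assms summable_right_of_1_1
    by (intro dirichlet_series_add summable_right_of_1_mangoldt) (simp_all add: summable_right_of_1_def)
  also have "dirichlet_series (\<lambda>_. -1) s = - zeta s"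
    using assms by (intro dirichlet_series_uminus summable_right_of_1_1)
  also have "dirichlet_series mangoldt s = - deriv zeta s / zeta s"
    using zeta_mult_mangoldt[OF assms] zeta_nonzero[OF assms] by (simp add: field_simps)
  finally show ?thesis by simp
qed

lemma deriv_zeta_ext_eq_zeta: 
  assumes "Re s > 1"
  shows "deriv zeta_ext s = deriv zeta s"
  by (rule complex_derivative_transform_within_open[OF _ _ open_Re_gt_1])
     (use assms in \<open>auto intro: holomorphic_on_subset[OF holomorphic_zeta_ext] holomorphic_dirichlet_series summable_right_of_1_1 zeta_ext_eq_zeta\<close>)

text \<open>Let T be \<open>height s\<close> to the power -\<epsilon>. Zeta is at least c T^7 at s
  and its derivative nearby is at most 2 C2 / T, so on a disc of radius l T^8 zeta keeps half of
  this bound. There zeta'/zeta and zeta are O(T^(-8)), and Cauchy's inequality loses another factor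
  T^(-8) for each derivative, which gives the exponent 8 (k + 1).\<close>

lemma higher_deriv_mangoldt_minus_1_far:
  assumes \<epsilon>: "0 < \<epsilon>" "\<epsilon> \<le> 1" and r: "0 < r" "r \<le> 1"
  obtains C where "C > 0"
    "\<And>s. 1 < Re s \<Longrightarrow> Re s \<le> 2 \<Longrightarrow> norm (s - 1) \<ge> r \<Longrightarrow>
       norm ((deriv ^^ k) (dirichlet_series mangoldt_minus_1) s) \<le> C * height s powr (8 * \<epsilon> * (real k + 1))"
proof -
  obtain CA where CA: "CA > 0" 
    "\<And>s. 1 - \<epsilon> / 2 \<le> Re s \<Longrightarrow> Re s \<le> 4 \<Longrightarrow> norm (s - 1) \<ge> r / 2 \<Longrightarrow> norm (zeta_ext s) \<le> CA * height s powr \<epsilon>"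
    using zeta_ext_bound[OF \<epsilon>, of "r/2"] r by auto
  obtain C2 where C2: "C2 > 0"
    "\<And>s. 1 - \<epsilon> / 4 \<le> Re s \<Longrightarrow> Re s \<le> 3 \<Longrightarrow> norm (s - 1) \<ge> r / 2 \<Longrightarrow> norm (deriv zeta_ext s) \<le> C2 * height s powr \<epsilon>"
    using zeta_ext_deriv_bound[OF \<epsilon>, of "r/2"] r by auto
  obtain c where c: "c > 0"
    "\<And>s. 1 < Re s \<Longrightarrow> Re s \<le> 2 \<Longrightarrow> norm (s - 1) \<ge> r \<Longrightarrow> norm (zeta s) \<ge> c * height s powr (-7 * \<epsilon>)"
    using zeta_lower_bound[OF \<epsilon> r] by blast
  \<comment> \<open>The first two terms keep the discs in the region of the bounds for
    \<open>zeta_ext\<close> and off the pole; the third makes zeta lose at most half of its lower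
    bound.\<close>
  define l where "l = min (min (\<epsilon> / 4) (r / 2)) (c / (4 * C2))"
  have l: "l > 0" "l \<le> \<epsilon> / 4" "l \<le> r / 2" "l * (2 * C2) \<le> c / 2"
  proof -
    show "l > 0" "l \<le> \<epsilon> / 4" "l \<le> r / 2" using \<epsilon> r c C2 by (auto simp: l_def)
    have "l * (2 * C2) \<le> c / (4 * C2) * (2 * C2)" using C2 by (intro mult_right_mono) (auto simp: l_def)
    then show "l * (2 * C2) \<le> c / 2" using C2 by simp
  qed
  define B where "B = 4 * C2 / c + 2 * CA"
  have B: "B > 0" using C2 CA c by (simp add: B_def add_pos_pos)
  \<comment> \<open>The discs may cross the line Re s = 1, so the series is replaced by an
    expression in the continuation.\<close>
  define D where "D = (\<lambda>w. - deriv zeta_ext w / zeta_ext w - zeta_ext w)"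
  show ?thesis
  proof (rule that[of "fact k * B / l ^ k"])
    show "fact k * B / l ^ k > 0" using B l by simp
    fix s assume s: "1 < Re s" "Re s \<le> 2" "norm (s - 1) \<ge> r"
    define T where "T = height s powr (-\<epsilon>)"
    have T: "0 < T" "T \<le> 1"
      using height_ge_1[of s] height_pos[of s] \<epsilon> by (auto simp: T_def powr_minus intro!: inverse_le_1_iff[THEN iffD2] ge_one_powr_ge_zero)
    have T7: "height s powr (-7 * \<epsilon>) = T ^ 7"
      using height_pos[of s] by (simp add: T_def powr_power mult.commute)
    have T1: "height s powr \<epsilon> = 1 / T"
      using height_pos[of s] by (simp add: T_def powr_minus field_simps)
    define \<rho> where "\<rho> = l * T ^ 8"
    have "T ^ 8 \<le> 1" using T by (intro power_le_one) auto
    then have \<rho>: "0 < \<rho>" "\<rho> \<le> l"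
      using l T by (auto simp: \<rho>_def mult_left_le)
    have near: "1 / 2 < Re w \<and> 1 - \<epsilon> / 4 \<le> Re w \<and> Re w \<le> 3 \<and> norm (w - 1) \<ge> r / 2 \<and> height w \<le> 2 * height s" if "norm (w - s) \<le> \<rho>" for w
    proof -
      have "\<bar>Re w - Re s\<bar> \<le> \<rho>" using that abs_Re_le_cmod[of "w - s"] by simp
      moreover have "norm (s - 1) \<le> norm (w - 1) + norm (w - s)"
        using norm_triangle_ineq4[of "w - 1" "w - s"] by simp
      ultimately show ?thesis using s l \<rho> \<epsilon> r that height_cball[of w s] by auto
    qed
    have in_cball: "norm (w - s) \<le> \<rho>" if "w \<in> cball s \<rho>" for w
      using that by (simp add: dist_norm norm_minus_commute)
    have sub: "cball s \<rho> \<subseteq> {s. Re s > 1/2} - {1}"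
    proof
      fix w assume "w \<in> cball s \<rho>"
      from near[OF in_cball[OF this]] r show "w \<in> {s. Re s > 1/2} - {1}" by auto
    qed
    have d: "norm (deriv zeta_ext w) \<le> C2 * (2 * (1 / T))" if "norm (w - s) \<le> \<rho>" for w
    proof -
      have "norm (deriv zeta_ext w) \<le> C2 * height w powr \<epsilon>" using near[OF that] by (intro C2(2)) auto
      also have "\<dots> \<le> C2 * (2 * height s powr \<epsilon>)" using near[OF that] C2(1) \<epsilon>
        by (intro mult_left_mono height_powr_le) auto
      finally show ?thesis by (simp add: T1)
    qed
    have lower: "norm (zeta_ext w) \<ge> c / 2 * T ^ 7" if w: "norm (w - s) \<le> \<rho>" for w
    proof -
      have "norm (zeta_ext w - zeta_ext s) \<le> C2 * (2 * (1 / T)) * norm (w - s)"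
      proof (rule field_differentiable_bound[of "cball s \<rho>"])
        fix v assume v: "v \<in> cball s \<rho>"
        show "(zeta_ext has_field_derivative deriv zeta_ext v) (at v within cball s \<rho>)"
          by (intro has_field_derivative_at_within[OF holomorphic_derivI[OF holomorphic_zeta_ext open_zeta_ext_domain]])
             (use v sub in blast)
        show "norm (deriv zeta_ext v) \<le> C2 * (2 * (1 / T))" by (rule d[OF in_cball[OF v]])
      qed (use w \<rho> in \<open>auto simp: dist_norm norm_minus_commute\<close>)
      also have "\<dots> \<le> C2 * (2 * (1 / T)) * (l * T ^ 8)"
        using C2 T w by (intro mult_left_mono) (auto simp: \<rho>_def)
      also have "\<dots> = l * (2 * C2) * T ^ 7" using T by (simp add: eval_nat_numeral)
      also have "\<dots> \<le> c / 2 * T ^ 7" using l T by (intro mult_right_mono) auto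
      finally have "norm (zeta_ext w - zeta_ext s) \<le> c / 2 * T ^ 7" .
      moreover have "norm (zeta_ext s) \<ge> c * T ^ 7"
        using c(2)[OF s] zeta_ext_eq_zeta[OF s(1)] T7 by simp
      moreover have "norm (zeta_ext s) \<le> norm (zeta_ext w - zeta_ext s) + norm (zeta_ext w)"
        using norm_triangle_ineq4[of "zeta_ext w" "zeta_ext w - zeta_ext s"] by simp
      ultimately show ?thesis by (simp add: field_simps)
    qed
    have nz: "zeta_ext w \<noteq> 0" if "norm (w - s) \<le> \<rho>" for w
    proof -
      have "0 < c / 2 * T ^ 7" using c T by simp
      then show ?thesis using lower[OF that] by auto
    qed
    have hol: "D holomorphic_on cball s \<rho>"
    proof -
      have "zeta_ext holomorphic_on cball s \<rho>" "deriv zeta_ext holomorphic_on cball s \<rho>"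
        using holomorphic_on_subset[OF holomorphic_zeta_ext sub]
          holomorphic_on_subset[OF holomorphic_deriv[OF holomorphic_zeta_ext open_zeta_ext_domain] sub] by auto
      then show ?thesis unfolding D_def
        by (intro holomorphic_on_diff holomorphic_on_divide holomorphic_on_minus) (use nz in_cball in auto)
    qed
    have "norm ((deriv ^^ k) D s) \<le> fact k * (B / T ^ 8) / \<rho> ^ k"
    proof (rule Cauchy_inequality)
      show "D holomorphic_on ball s \<rho>" by (rule holomorphic_on_subset[OF hol]) auto
      show "continuous_on (cball s \<rho>) D" by (rule holomorphic_on_imp_continuous_on[OF hol])
      fix w assume "norm (s - w) = \<rho>"
      then have w: "norm (w - s) \<le> \<rho>" by (simp add: norm_minus_commute)
      have "norm (zeta_ext w) \<le> CA * height w powr \<epsilon>" using near[OF w] \<epsilon> by (intro CA(2)) auto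
      also have "\<dots> \<le> CA * (2 * height s powr \<epsilon>)" using near[OF w] CA(1) \<epsilon>
        by (intro mult_left_mono height_powr_le) auto
      finally have z: "norm (zeta_ext w) \<le> CA * (2 * (1 / T))" by (simp add: T1)
      have "norm (D w) \<le> norm (deriv zeta_ext w) / norm (zeta_ext w) + norm (zeta_ext w)"
        unfolding D_def using norm_triangle_ineq4[of "- deriv zeta_ext w / zeta_ext w" "zeta_ext w"] by (simp add: norm_divide)
      also have "\<dots> \<le> C2 * (2 * (1 / T)) / (c / 2 * T ^ 7) + CA * (2 * (1 / T))"
        using c T C2 by (intro add_mono z frac_le d[OF w] lower[OF w]) auto
      also have "C2 * (2 * (1 / T)) / (c / 2 * T ^ 7) = 4 * C2 / c * (1 / T ^ 8)"
        using c T by (simp add: field_simps eval_nat_numeral)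
      also have "CA * (2 * (1 / T)) \<le> 2 * CA * (1 / T ^ 8)"
      proof -
        have "T ^ 8 \<le> T ^ 1" using T by (intro power_decreasing) auto
        then have "1 / T \<le> 1 / T ^ 8" using T by (intro divide_left_mono) auto
        then have "2 * CA * (1 / T) \<le> 2 * CA * (1 / T ^ 8)" using CA by (intro mult_left_mono) auto
        then show ?thesis by (simp add: mult_ac)
      qed
      also have "4 * C2 / c * (1 / T ^ 8) + 2 * CA * (1 / T ^ 8) = B / T ^ 8"
        by (simp add: B_def add_divide_distrib)
      finally show "norm (D w) \<le> B / T ^ 8" by simp
    qed (use \<rho> in auto)
    also have "\<dots> = fact k * B / l ^ k * (1 / T) ^ (8 * (k + 1))"
    proof -
      have "(1 / T) ^ (8 * (k + 1)) = 1 / T ^ 8 * (1 / (T ^ 8) ^ k)"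
        by (simp add: power_one_over flip: power_mult power_add)
      then show ?thesis by (simp add: \<rho>_def power_mult_distrib)
    qed
    also have "(1 / T) ^ (8 * (k + 1)) = height s powr (8 * \<epsilon> * (real k + 1))"
      unfolding T1[symmetric] using height_pos[of s] by (simp add: powr_power algebra_simps)
    also have "(deriv ^^ k) D s = (deriv ^^ k) (dirichlet_series mangoldt_minus_1) s"
    proof -
      have ev: "eventually (\<lambda>w. w \<in> {w. Re w > 1}) (nhds s)"
        using s by (intro eventually_nhds_in_open open_Re_gt_1) auto
      have "eventually (\<lambda>w. D w = dirichlet_series mangoldt_minus_1 w) (nhds s)"
        using ev by eventually_elim (simp add: D_def dirichlet_series_mangoldt_minus_1 zeta_ext_eq_zeta deriv_zeta_ext_eq_zeta)
      then show ?thesis by (intro higher_deriv_cong_ev refl)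
    qed
    finally show "norm ((deriv ^^ k) (dirichlet_series mangoldt_minus_1) s) \<le> fact k * B / l ^ k * height s powr (8 * \<epsilon> * (real k + 1))" .
  qed
qed

text \<open>The two terms 1/(s - 1) have cancelled: every function on the right is holomorphic at 1,
  and the denominator is 1 there.\<close>

lemma dirichlet_series_mangoldt_minus_1_near:
  assumes "Re s > 1"
  shows "dirichlet_series mangoldt_minus_1 s = - deriv zeta_without_pole s / zeta_without_pole s - zeta_minus_pole s"
proof -
  have n1: "s \<noteq> 1" using assms by auto
  have hol: "zeta_without_pole holomorphic_on {s. Re s > 1}" by (rule holomorphic_on_subset[OF holomorphic_zeta_without_pole]) auto
  have eq: "deriv zeta_without_pole s = zeta s + (s - 1) * deriv zeta s"
  proof -
    have "deriv zeta_without_pole s = deriv (\<lambda>s. (s - 1) * zeta s) s"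
      by (rule complex_derivative_transform_within_open[OF hol _ open_Re_gt_1])
         (use assms zeta_without_pole_eq_zeta in \<open>auto intro!: holomorphic_intros holomorphic_dirichlet_series summable_right_of_1_1\<close>)
    also have "\<dots> = zeta s + (s - 1) * deriv zeta s"
    proof (rule DERIV_imp_deriv)
      have 1: "(zeta has_field_derivative deriv zeta s) (at s)"
        using has_field_derivative_dirichlet_series[OF summable_right_of_1_1 assms] DERIV_imp_deriv by metis
      show "((\<lambda>s. (s - 1) * zeta s) has_field_derivative zeta s + (s - 1) * deriv zeta s) (at s)"
        by (auto intro!: derivative_eq_intros 1)
    qed
    finally show ?thesis .
  qed
  have zeta_minus_pole: "zeta_minus_pole s = zeta s - 1 / (s - 1)" using zeta_eq_zeta_minus_pole[OF assms] by simp
  have "deriv zeta_without_pole s / zeta_without_pole s = 1 / (s - 1) + deriv zeta s / zeta s"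
    unfolding eq zeta_without_pole_eq_zeta[OF assms] using n1 zeta_nonzero[OF assms] by (simp add: field_simps)
  then show ?thesis
    unfolding dirichlet_series_mangoldt_minus_1[OF assms] zeta_minus_pole by simp
qed

text \<open>Since \<open>zeta_without_pole\<close> is 1 at 1, it has no zero on a small disc, to
  which the series therefore continues holomorphically. Compactness of the closed disc of half the
  radius bounds each derivative, with a radius that is the same for all k.\<close>

lemma higher_deriv_mangoldt_minus_1_near:
  obtains r where "0 < r" "r \<le> 1" 
    "\<And>k. \<exists>C. \<forall>s. 1 < Re s \<longrightarrow> norm (s - 1) \<le> r \<longrightarrow> norm ((deriv ^^ k) (dirichlet_series mangoldt_minus_1) s) \<le> C"
proof -
  have "continuous_on {s. Re s > 1/2} zeta_without_pole"
    by (rule holomorphic_on_imp_continuous_on[OF holomorphic_zeta_without_pole])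
  then have "isCont zeta_without_pole 1"
    by (subst (asm) continuous_on_eq_continuous_at[OF open_halfspace_Re_gt]) auto
  then have "eventually (\<lambda>s. zeta_without_pole s \<noteq> 0) (at 1)"
    by (intro tendsto_imp_eventually_ne[of zeta_without_pole 1]) (auto simp: isCont_def)
  then have "eventually (\<lambda>s. zeta_without_pole s \<noteq> 0) (nhds 1)"
    by (auto simp: eventually_nhds_conv_at)
  then obtain R0 where R0: "R0 > 0" "\<And>s. dist s 1 < R0 \<Longrightarrow> zeta_without_pole s \<noteq> 0"
    by (auto simp: eventually_nhds_metric)
  define R where "R = min R0 (1/2)"
  define D where "D = (\<lambda>w. - deriv zeta_without_pole w / zeta_without_pole w - zeta_minus_pole w)"
  have sub: "ball 1 R \<subseteq> {s. Re s > 1/2}"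
  proof
    fix w :: complex assume "w \<in> ball 1 R"
    then have "norm (1 - w) < 1/2" by (simp add: dist_norm R_def)
    then show "w \<in> {s. Re s > 1/2}" using abs_Re_le_cmod[of "1 - w"] by auto
  qed
  have hol: "D holomorphic_on ball 1 R"
    unfolding D_def using holomorphic_on_subset[OF holomorphic_zeta_without_pole sub] holomorphic_on_subset[OF holomorphic_zeta_minus_pole sub]
      holomorphic_on_subset[OF holomorphic_deriv[OF holomorphic_zeta_without_pole open_halfspace_Re_gt] sub]
    by (intro holomorphic_intros) (use R0 in \<open>auto simp: R_def dist_commute\<close>)
  show ?thesis
  proof (rule that[of "R / 2"])
    show "0 < R / 2" "R / 2 \<le> 1" using R0 by (auto simp: R_def)
    fix k
    have "continuous_on (cball 1 (R/2)) ((deriv ^^ k) D)"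
      by (rule holomorphic_on_imp_continuous_on[OF holomorphic_on_subset[OF holomorphic_higher_deriv[OF hol]]])
         (use R0 in \<open>auto simp: R_def\<close>)
    then have "bounded ((deriv ^^ k) D ` cball 1 (R/2))"
      by (intro compact_imp_bounded compact_continuous_image) auto
    then obtain C where C: "\<And>s. s \<in> cball 1 (R/2) \<Longrightarrow> norm ((deriv ^^ k) D s) \<le> C"
      unfolding bounded_iff by blast
    have "norm ((deriv ^^ k) (dirichlet_series mangoldt_minus_1) s) \<le> C" if s: "1 < Re s" "norm (s - 1) \<le> R / 2" for s
    proof -
      have ev: "eventually (\<lambda>w. w \<in> {w. Re w > 1}) (nhds s)"
        using s by (intro eventually_nhds_in_open open_Re_gt_1) auto
      have "eventually (\<lambda>w. D w = dirichlet_series mangoldt_minus_1 w) (nhds s)"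
        using ev by eventually_elim (simp add: D_def dirichlet_series_mangoldt_minus_1_near)
      then have "(deriv ^^ k) D s = (deriv ^^ k) (dirichlet_series mangoldt_minus_1) s" by (intro higher_deriv_cong_ev refl)
      then show ?thesis using C[of s] s by (simp add: dist_norm norm_minus_commute)
    qed
    then show "\<exists>C. \<forall>s. 1 < Re s \<longrightarrow> norm (s - 1) \<le> R / 2 \<longrightarrow> norm ((deriv ^^ k) (dirichlet_series mangoldt_minus_1) s) \<le> C"
      by blast
  qed
qed

lemma dirichlet_series_ln_power_mangoldt_minus_1_bound:
  obtains C where "C > 0"
    "\<And>s. 1 < Re s \<Longrightarrow> Re s \<le> 2 \<Longrightarrow> 
      norm (dirichlet_series (\<lambda>n. of_real (ln (real n)) ^ k * mangoldt_minus_1 n) s) \<le> C * height s powr (1/2)"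
proof -
  obtain r where r: "0 < r" "r \<le> 1"
    "\<And>k. \<exists>C. \<forall>s. 1 < Re s \<longrightarrow> norm (s - 1) \<le> r \<longrightarrow> norm ((deriv ^^ k) (dirichlet_series mangoldt_minus_1) s) \<le> C"
    using higher_deriv_mangoldt_minus_1_near by blast
  obtain C1 where C1: "\<And>s. 1 < Re s \<Longrightarrow> norm (s - 1) \<le> r \<Longrightarrow> norm ((deriv ^^ k) (dirichlet_series mangoldt_minus_1) s) \<le> C1"
    using r(3) by blast
  \<comment> \<open>Makes the total exponent \<open>8 * \<epsilon> * (real k + 1)\<close> equal to
    1/2.\<close>
  define \<epsilon> where "\<epsilon> = 1 / (16 * (real k + 1))"
  have \<epsilon>: "0 < \<epsilon>" "\<epsilon> \<le> 1" by (auto simp: \<epsilon>_def field_simps)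
  have e2: "8 * \<epsilon> * (real k + 1) = 1 / 2" by (simp add: \<epsilon>_def field_simps)
  obtain C2 where C2: "C2 > 0"
    "\<And>s. 1 < Re s \<Longrightarrow> Re s \<le> 2 \<Longrightarrow> norm (s - 1) \<ge> r \<Longrightarrow>
       norm ((deriv ^^ k) (dirichlet_series mangoldt_minus_1) s) \<le> C2 * height s powr (8 * \<epsilon> * (real k + 1))"
    using higher_deriv_mangoldt_minus_1_far[OF \<epsilon> r(1,2)] by blast
  show ?thesis
  proof (rule that[of "max C1 C2"])
    show "max C1 C2 > 0" using C2 by simp
    fix s assume s: "1 < Re s" "Re s \<le> 2"
    have t: "1 \<le> height s powr (1/2)" using height_ge_1 by (intro ge_one_powr_ge_zero) auto
    have ds: "summable_right_of_1 (\<lambda>n. of_real (ln (real n)) ^ k * mangoldt_minus_1 n)"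
      by (rule summable_right_of_1_ln_power[OF summable_right_of_1_mangoldt_minus_1])
    have "norm (dirichlet_series (\<lambda>n. of_real (ln (real n)) ^ k * mangoldt_minus_1 n) s) = norm ((deriv ^^ k) (dirichlet_series mangoldt_minus_1) s)"
    proof -
      have "(deriv ^^ k) (dirichlet_series mangoldt_minus_1) s = dirichlet_series (\<lambda>n. (- of_real (ln (real n))) ^ k * mangoldt_minus_1 n) s"
        by (rule higher_deriv_dirichlet_series[OF summable_right_of_1_mangoldt_minus_1 s(1)])
      also have "\<dots> = (\<Sum>n. (-1) ^ k * (of_real (ln (real n)) ^ k * mangoldt_minus_1 n * of_nat n powr (-s)))"
        unfolding dirichlet_series_def by (intro suminf_cong) (simp add: power_minus[of "complex_of_real _"] mult.assoc)
      also have "\<dots> = (-1) ^ k * dirichlet_series (\<lambda>n. of_real (ln (real n)) ^ k * mangoldt_minus_1 n) s"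
        unfolding dirichlet_series_def by (rule suminf_mult[OF summable_right_of_1_summable[OF ds s(1)]])
      finally show ?thesis by (simp add: norm_mult norm_power)
    qed
    also have "\<dots> \<le> max C1 C2 * height s powr (1/2)"
    proof (cases "norm (s - 1) \<le> r")
      case True
      have "norm ((deriv ^^ k) (dirichlet_series mangoldt_minus_1) s) \<le> max C1 C2 * 1" using C1[OF s(1) True] by simp
      also have "\<dots> \<le> max C1 C2 * height s powr (1/2)" using t C2 by (intro mult_left_mono) auto
      finally show ?thesis .
    next
      case False
      then have "norm ((deriv ^^ k) (dirichlet_series mangoldt_minus_1) s) \<le> C2 * height s powr (1/2)"
        using C2(2)[OF s] e2 by simp
      also have "\<dots> \<le> max C1 C2 * height s powr (1/2)" by (intro mult_right_mono) auto
      finally show ?thesis .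
    qed
    finally show "norm (dirichlet_series (\<lambda>n. of_real (ln (real n)) ^ k * mangoldt_minus_1 n) s) \<le> max C1 C2 * height s powr (1/2)" .
  qed
qed

section \<open>From Dirichlet series to partial sums\<close>

text \<open>
  The tail probabilities of the exponential distribution with rate \<open>\<sigma>\<close>, taken at \<open>ln x - ln n\<close> and
  \<open>ln y - ln n\<close> and multiplied by \<open>n\<^sup>-\<^sup>\<sigma>\<close>, differ by a weight that is constant for \<open>n \<le> x\<close> and vanishes
  for \<open>n \<ge> y\<close>. Levy's inversion theorem for this distribution is therefore a Perron formula with an
  absolutely integrable kernel.
\<close>

abbreviation exponential_measure :: "real \<Rightarrow> real measure" where
  "exponential_measure l \<equiv> density lborel (exponential_density l)"

lemma real_distribution_exponential_measure: "0 < l \<Longrightarrow> real_distribution (exponential_measure l)"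
  unfolding real_distribution_def real_distribution_axioms_def
  by (simp add: prob_space_exponential_density)

text \<open>Levy's inversion theorem asks that the endpoints of the interval carry no mass.\<close>

lemma measure_exponential_measure_singleton: "measure (exponential_measure l) {a} = 0"
proof -
  have "{a} \<in> null_sets lborel" by (intro null_setsI) auto
  moreover have "absolutely_continuous lborel (exponential_measure l)"
    by (rule absolutely_continuousI_density) auto
  ultimately have "{a} \<in> null_sets (exponential_measure l)"
    unfolding absolutely_continuous_def by blast
  then show ?thesis by (simp add: measure_eq_0_null_sets)
qed

lemma measure_exponential_measure:
  assumes l: "0 < l" and ab: "a \<le> b"
  shows "measure (exponential_measure l) {a<..b} = exp (- l * max 0 a) - exp (- l * max 0 b)"
proof (cases "a = b")
  case False
  interpret real_distribution "exponential_measure l" by (rule real_distribution_exponential_measure[OF l])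
  have cdf: "cdf (exponential_measure l) x = 1 - exp (- l * max 0 x)" for x
  proof -
    have "emeasure (exponential_measure l) {..x} = erlang_CDF 0 l x" by (rule emeasure_erlang_density[OF l])
    then have "measure (exponential_measure l) {..x} = erlang_CDF 0 l x"
      by (simp add: measure_def erlang_CDF_0 l less_imp_le)
    then show ?thesis by (auto simp: cdf_def erlang_CDF_0 max_def)
  qed
  have "measure (exponential_measure l) {a<..b} = cdf (exponential_measure l) b - cdf (exponential_measure l) a"
    using False ab by (intro cdf_diff_eq[symmetric]) auto
  then show ?thesis by (simp add: cdf)
qed auto

lemma char_exponential_measure:
  assumes l: "0 < l"
  shows "char (exponential_measure l) t = l / (l - \<i> * t)"
proof -
  define z where "z = - (complex_of_real l - \<i> * of_real t)"
  have z: "Re z = - l" "z \<noteq> 0" using l by (auto simp: z_def complex_eq_iff)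
  have ez: "exp (z * of_real x) = of_real (exp (-x * l)) * iexp (t * x)" for x :: real
    by (simp add: z_def exp_of_real[symmetric] exp_add[symmetric] algebra_simps)
  have eq: "exponential_density l x *\<^sub>R iexp (t * x) = (if x < 0 then 0 else of_real l * exp (z * of_real x))" for x
    by (auto simp: exponential_density_def ez scaleR_conv_of_real)
  have "set_integrable lborel {0<..} (\<lambda>x. of_real l * exp (z * of_real x))"
    unfolding set_integrable_def
  proof (rule Bochner_Integration.integrable_bound)
    interpret prob_space "exponential_measure l" by (rule prob_space_exponential_density[OF l])
    have "integrable (exponential_measure l) (\<lambda>_. 1 :: real)" by simp
    then show "integrable lborel (\<lambda>x. exponential_density l x *\<^sub>R (1 :: real))"
      by (subst (asm) integrable_density) (use l in \<open>auto simp: exponential_density_def\<close>)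
    show "AE x in lborel. norm (indicator {0<..} x *\<^sub>R (of_real l * exp (z * of_real x))) \<le> norm (exponential_density l x *\<^sub>R (1 :: real))"
      using l z by (intro AE_I2) (auto simp: exponential_density_def norm_mult indicator_def mult.commute)
  qed auto
  then have int: "set_integrable lborel (einterval 0 \<infinity>) (\<lambda>x. of_real l * exp (z * of_real x))"
    by (simp add: einterval_eq zero_ereal_def)
  have "char (exponential_measure l) t = (CLINT x|lborel. exponential_density l x *\<^sub>R iexp (t * x))"
    unfolding char_def by (rule integral_density) (use l in \<open>auto simp: exponential_density_def\<close>)
  also have "\<dots> = (CLINT x|lborel. indicator {0<..} x *\<^sub>R (of_real l * exp (z * of_real x)))"
    unfolding eq
  proof (rule integral_cong_AE)
    \<comment> \<open>The two integrands differ at 0 only, where the density equals l.\<close>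
    have "AE x in lborel. x \<noteq> (0::real)" by (rule AE_lborel_singleton)
    then show "AE x in lborel. (if x < 0 then 0 else of_real l * exp (z * of_real x)) = indicator {0<..} x *\<^sub>R (of_real l * exp (z * of_real x))"
      by eventually_elim auto
  qed auto
  also have "\<dots> = (CLBINT x=0..\<infinity>. of_real l * exp (z * of_real x))"
    unfolding interval_lebesgue_integral_0_infty set_lebesgue_integral_def ..
  also have "\<dots> = 0 - of_real l / z"
  proof (rule interval_integral_FTC_integrable[OF _ _ _ int])
    fix x :: real
    have "((\<lambda>w. of_real l / z * exp (z * w)) has_field_derivative of_real l * exp (z * of_real x)) (at (of_real x))"
      using z by (auto intro!: derivative_eq_intros)
    from has_vector_derivative_real_field[OF this]
    show "((\<lambda>x. of_real l / z * exp (z * of_real x)) has_vector_derivative of_real l * exp (z * of_real x)) (at x)" .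
    show "isCont (\<lambda>x. of_real l * exp (z * of_real x)) x" by (intro continuous_intros)
  next
    have "((\<lambda>x. of_real l / z * exp (z * of_real x)) \<longlongrightarrow> of_real l / z * exp (z * of_real 0)) (at_right 0)"
      by (intro tendsto_intros)
    then show "(((\<lambda>x. of_real l / z * exp (z * of_real x)) \<circ> real_of_ereal) \<longlongrightarrow> of_real l / z) (at_right 0)"
      by (simp add: ereal_tendsto_simps1 zero_ereal_def)
    have "((\<lambda>x. of_real l / z * exp (z * of_real x)) \<longlongrightarrow> 0) at_top"
    proof (rule tendsto_norm_zero_cancel)
      have "((\<lambda>x. l / norm z * exp (- l * x)) \<longlongrightarrow> 0) at_top" using l by real_asymp
      then show "((\<lambda>x. norm (of_real l / z * exp (z * of_real x))) \<longlongrightarrow> 0) at_top"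
        using l z by (simp add: norm_mult norm_divide)
    qed
    then show "(((\<lambda>x. of_real l / z * exp (z * of_real x)) \<circ> real_of_ereal) \<longlongrightarrow> 0) (at_left \<infinity>)"
      by (simp add: ereal_tendsto_simps1)
  qed (auto simp: zero_ereal_def)
  also have "\<dots> = l / (l - \<i> * t)"
    unfolding z_def minus_divide_right[symmetric] by simp
  finally show ?thesis .
qed

text \<open>The integrand of Levy's inversion formula for the interval from a to b, with the
  characteristic function of the exponential distribution of rate l inserted. At t = 0 division by
  zero gives the value 0.\<close>

definition levy_kernel :: "real \<Rightarrow> real \<Rightarrow> real \<Rightarrow> real \<Rightarrow> complex" where
  "levy_kernel l a b t = (iexp (-(t * a)) - iexp (-(t * b))) / (\<i> * t) * (l / (l - \<i> * t))"

lemma levy_kernel_measurable [measurable]: "levy_kernel l a b \<in> borel_measurable borel"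
  unfolding levy_kernel_def by measurable

text \<open>For u = ln n the extra factor is n^(i t), so a single kernel serves all terms of a
  Dirichlet series.\<close>

lemma levy_kernel_shift: "levy_kernel l (a - u) (b - u) t = levy_kernel l a b t * iexp (t * u)"
proof -
  have "iexp (-(t * (c - u))) = iexp (-(t * c)) * iexp (t * u)" for c
    by (simp add: exp_add[symmetric] algebra_simps)
  then show ?thesis by (simp add: levy_kernel_def flip: left_diff_distrib)
qed

lemma norm_iexp_diff: "norm (iexp x - iexp y) \<le> \<bar>x - y\<bar>"
proof -
  have "iexp x - iexp y = iexp y * (iexp (x - y) - 1)"
    by (simp add: exp_diff algebra_simps)
  then have "norm (iexp x - iexp y) = norm (iexp (x - y) - 1)" by (simp add: norm_mult)
  also have "\<dots> \<le> \<bar>x - y\<bar>" using iexp_approx1[of "x - y" 0] by simp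
  finally show ?thesis .
qed

text \<open>For large t the difference quotient and the characteristic function each contribute a
  factor 2 / \<bar>t\<bar>. For \<bar>t\<bar> \<le> 1 the quotient is at most b - a \<le> 1. The
  constant 16 allows for replacing \<bar>t\<bar> by 1 + \<bar>t\<bar>.\<close>

lemma norm_levy_kernel_le:
  assumes l: "1 \<le> l" "l \<le> 2" and ab: "a \<le> b" "b \<le> a + 1"
  shows "norm (levy_kernel l a b t) \<le> 16 / (1 + \<bar>t\<bar>)\<^sup>2"
proof -
  have n: "norm (levy_kernel l a b t) = norm (iexp (-(t * a)) - iexp (-(t * b))) / \<bar>t\<bar> * (l / norm (l - \<i> * t))"
    using l by (simp add: levy_kernel_def norm_mult norm_divide)
  have d: "norm (l - \<i> * t) \<ge> l" "norm (l - \<i> * t) \<ge> \<bar>t\<bar>"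
    using abs_Re_le_cmod[of "l - \<i> * t"] abs_Im_le_cmod[of "l - \<i> * t"] l by auto
  show ?thesis
  proof (cases "\<bar>t\<bar> \<le> 1")
    case True
    have "norm (iexp (-(t * a)) - iexp (-(t * b))) \<le> \<bar>(-(t * a)) - (-(t * b))\<bar>"
      by (rule norm_iexp_diff)
    also have "\<dots> = \<bar>t\<bar> * (b - a)" using ab by (simp add: abs_mult flip: right_diff_distrib)
    also have "\<dots> \<le> \<bar>t\<bar> * 1" using ab by (intro mult_left_mono) auto
    finally have "norm (iexp (-(t * a)) - iexp (-(t * b))) / \<bar>t\<bar> \<le> 1" by (simp add: divide_le_eq_1)
    moreover have "l / norm (l - \<i> * t) \<le> 1" using d l by (simp add: divide_le_eq_1)
    ultimately have "norm (levy_kernel l a b t) \<le> 1 * 1"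
      unfolding n using l by (intro mult_mono) auto
    also have "1 * 1 \<le> 16 / (1 + \<bar>t\<bar>)\<^sup>2"
    proof -
      have "(1 + \<bar>t\<bar>)\<^sup>2 \<le> 2\<^sup>2" using True by (intro power_mono) auto
      moreover have "(1 + \<bar>t\<bar>)\<^sup>2 > 0" by (intro zero_less_power) auto
      ultimately show ?thesis by (simp add: field_simps)
    qed
    finally show ?thesis .
  next
    case False
    have "norm (iexp (-(t * a)) - iexp (-(t * b))) \<le> 2"
      using norm_triangle_ineq4[of "iexp (-(t * a))" "iexp (-(t * b))"] by simp
    then have "norm (levy_kernel l a b t) \<le> 2 / \<bar>t\<bar> * (2 / \<bar>t\<bar>)"
      unfolding n using d l False by (intro mult_mono frac_le divide_right_mono) auto
    also have "\<dots> = 16 / (2 * \<bar>t\<bar>)\<^sup>2" by (simp add: power2_eq_square field_simps)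
    also have "\<dots> \<le> 16 / (1 + \<bar>t\<bar>)\<^sup>2"
      using False by (intro divide_left_mono power_mono) (auto intro!: mult_pos_pos zero_less_power)
    finally show ?thesis .
  qed
qed

text \<open>The exponent is -2 + 1/2: the decay of the kernel against the growth allowed for the
  Dirichlet series.\<close>

lemma integrable_abs_powr: "integrable lborel (\<lambda>t. (1 + \<bar>t\<bar>) powr (-3/2) :: real)"
proof -
  have "(\<integral>\<^sup>+ t. ennreal ((1 + \<bar>t\<bar>) powr (-3/2)) * indicator {0..} t \<partial>lborel)
     = ennreal (0 - (- 2 * (1 + 0) powr (-1/2)))"
  proof -
    have "(\<integral>\<^sup>+ t. ennreal ((1 + \<bar>t\<bar>) powr (-3/2)) * indicator {0..} t \<partial>lborel) = (\<integral>\<^sup>+ t. ennreal ((1 + t) powr (-3/2)) * indicator {0..} t \<partial>lborel)"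
      by (intro nn_integral_cong) (auto simp: indicator_def)
    also have "\<dots> = ennreal (0 - (- 2 * (1 + 0) powr (-1/2)))"
    proof (rule nn_integral_FTC_atLeast[where F = "\<lambda>x. - 2 * (1 + x) powr (-1/2)"])
      fix x :: real assume "0 \<le> x"
      then have "((\<lambda>x. (1 + x) powr (-1/2)) has_real_derivative (-1/2) * (1 + x) powr (-1/2 - 1) * 1) (at x)"
        by (intro DERIV_chain2[OF has_real_derivative_powr]) (auto intro!: derivative_eq_intros)
      from DERIV_cmult[OF this, of "-2"]
      show "DERIV (\<lambda>x. - 2 * (1 + x) powr (-1/2)) x :> (1 + x) powr (-3/2)" by simp
    next
      show "((\<lambda>x::real. - 2 * (1 + x) powr (-1/2)) \<longlongrightarrow> 0) at_top" by real_asymp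
    qed auto
    finally show ?thesis .
  qed
  then have nn: "(\<integral>\<^sup>+ t. ennreal (indicator {0..} t *\<^sub>R (1 + \<bar>t\<bar>) powr (-3/2)) \<partial>lborel) = ennreal 2"
    by (subst (asm) nn_integral_cong[where v = "\<lambda>t. ennreal (indicator {0..} t *\<^sub>R (1 + \<bar>t\<bar>) powr (-3/2))"])
       (auto simp: indicator_def)
  have "has_bochner_integral lborel (\<lambda>t. indicator {0..} t *\<^sub>R ((1 + \<bar>t\<bar>) powr (-3/2) :: real)) 2"
    by (rule has_bochner_integral_nn_integral[OF _ _ _ nn]) auto
  then have "has_bochner_integral lborel (\<lambda>t. (1 + \<bar>t\<bar>) powr (-3/2) :: real) (2 *\<^sub>R 2)"
    by (rule has_bochner_integral_even_function) simp
  then show ?thesis by (simp add: has_bochner_integral_iff)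
qed

lemma integrable_levy_kernel:
  assumes l: "1 \<le> l" "l \<le> 2" and ab: "a \<le> b" "b \<le> a + 1"
  shows "integrable lborel (levy_kernel l a b)"
proof (rule Bochner_Integration.integrable_bound)
  show "integrable lborel (\<lambda>t. 16 * (1 + \<bar>t\<bar>) powr (-3/2) :: real)" by (intro integrable_mult_right integrable_abs_powr)
  show "AE t in lborel. norm (levy_kernel l a b t) \<le> norm (16 * (1 + \<bar>t\<bar>) powr (-3/2))"
  proof (rule AE_I2)
    fix t :: real
    have "norm (levy_kernel l a b t) \<le> 16 * (1 + \<bar>t\<bar>) powr (-2)"
      using norm_levy_kernel_le[OF assms, of t] by (simp add: powr_minus divide_inverse powr_numeral add_pos_nonneg)
    also have "\<dots> \<le> 16 * (1 + \<bar>t\<bar>) powr (-3/2)"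
      by (intro mult_left_mono powr_mono) auto
    finally show "norm (levy_kernel l a b t) \<le> norm (16 * (1 + \<bar>t\<bar>) powr (-3/2))" by simp
  qed
qed (auto simp: levy_kernel_measurable)

text \<open>Levy's theorem yields a limit of symmetric truncated integrals; absolute integrability
  and dominated convergence identify it with the integral over the whole line.\<close>

lemma integral_levy_kernel:
  assumes l: "1 \<le> l" "l \<le> 2" and ab: "a \<le> b" "b \<le> a + 1"
  shows "(CLINT t|lborel. levy_kernel l a b t) = 2 * pi * measure (exponential_measure l) {a<..b}"
proof -
  interpret real_distribution "exponential_measure l" by (rule real_distribution_exponential_measure) (use l in simp)
  have "(\<lambda>T. 1 / (2 * pi) * (CLBINT t=-T..T. (iexp (-(t * a)) - iexp (-(t * b))) / (\<i> * t) * char (exponential_measure l) t))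
    \<longlonglongrightarrow> measure (exponential_measure l) {a<..b}"
    by (rule Levy_Inversion) (use ab in \<open>auto simp: measure_exponential_measure_singleton\<close>)
  then have 1: "(\<lambda>T. 1 / (2 * pi) * (CLBINT t=-real T..real T. levy_kernel l a b t)) \<longlonglongrightarrow> measure (exponential_measure l) {a<..b}"
    using l by (simp add: char_exponential_measure levy_kernel_def[abs_def])
  have "(\<lambda>T. CLINT t|lborel. indicator {-real T..real T} t *\<^sub>R levy_kernel l a b t) \<longlonglongrightarrow> (CLINT t|lborel. levy_kernel l a b t)"
  proof (rule integral_dominated_convergence)
    show "integrable lborel (\<lambda>t. norm (levy_kernel l a b t))" by (intro integrable_norm integrable_levy_kernel assms)
    show "AE t in lborel. (\<lambda>T. indicator {-real T..real T} t *\<^sub>R levy_kernel l a b t) \<longlonglongrightarrow> levy_kernel l a b t"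
    proof (rule AE_I2)
      fix t :: real
      have "eventually (\<lambda>T. real T \<ge> \<bar>t\<bar>) sequentially"
        using filterlim_real_sequentially by (auto simp: filterlim_at_top)
      then have "eventually (\<lambda>T. indicator {-real T..real T} t *\<^sub>R levy_kernel l a b t = levy_kernel l a b t) sequentially"
        by eventually_elim (auto simp: indicator_def)
      then show "(\<lambda>T. indicator {-real T..real T} t *\<^sub>R levy_kernel l a b t) \<longlonglongrightarrow> levy_kernel l a b t"
        by (rule tendsto_eventually)
    qed
  qed (auto simp: indicator_def)
  moreover have "(CLBINT t=-real T..real T. levy_kernel l a b t) = (CLINT t|lborel. indicator {-real T..real T} t *\<^sub>R levy_kernel l a b t)" for T
    using interval_integral_Icc[of "- real T" "real T" "levy_kernel l a b"] by (simp add: set_lebesgue_integral_def)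
  ultimately have "(\<lambda>T. 1 / (2 * pi) * (CLBINT t=-real T..real T. levy_kernel l a b t)) \<longlonglongrightarrow> 1 / (2 * pi) * (CLINT t|lborel. levy_kernel l a b t)"
    by (intro tendsto_mult tendsto_const) simp
  from LIMSEQ_unique[OF this 1] show ?thesis by (simp add: field_simps)
qed


section \<open>Smoothed and sharp partial sums\<close>

lemma exp_max_ln:
  fixes x y \<sigma> :: real
  assumes "x > 0" "y > 0"
  shows "y powr (-\<sigma>) * exp (- \<sigma> * max 0 (ln x - ln y)) = (max y x) powr (-\<sigma>)"
proof (cases "y \<le> x")
  case True
  then have "ln y \<le> ln x" using assms by simp
  then have "max 0 (ln x - ln y) = ln x - ln y" by simp
  then show ?thesis using assms True by (simp add: max_def powr_def exp_add[symmetric] algebra_simps)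
next
  case False
  then have "ln x \<le> ln y" using assms by simp
  then have "max 0 (ln x - ln y) = 0" by simp
  then show ?thesis using False by (simp add: max_def)
qed

text \<open>Absolute convergence for \<open>\<sigma> > 1\<close> permits exchanging sum and
  integral, so 2 pi times the weighted sum is the integral of the kernel against the series on the
  line of real part \<open>\<sigma>\<close>. Both factors have bounds free of
  \<open>\<sigma>\<close>, \<open>N\<close> and \<open>M\<close>, hence so does the sum;
  \<open>M \<le> 2 * N\<close> supplies b - a \<le> 1 for the kernel bound.\<close>

lemma dirichlet_series_smoothed_bound:
  assumes c: "summable_right_of_1 c" "c 0 = 0"
    and C: "\<And>s. 1 < Re s \<Longrightarrow> Re s \<le> 2 \<Longrightarrow> norm (dirichlet_series c s) \<le> C * height s powr (1/2)"
  obtains K where "\<And>\<sigma> N M. 1 < \<sigma> \<Longrightarrow> \<sigma> \<le> 2 \<Longrightarrow> 1 \<le> N \<Longrightarrow> N \<le> M \<Longrightarrow> M \<le> 2 * N \<Longrightarrow>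
     norm (\<Sum>n\<le>M. c n * of_real (max (real n) (real N) powr (-\<sigma>) - max (real n) (real M) powr (-\<sigma>))) \<le> K"
proof
  fix \<sigma> :: real and N M :: nat
  assume \<sigma>: "1 < \<sigma>" "\<sigma> \<le> 2" and NM: "1 \<le> N" "N \<le> M" "M \<le> 2 * N"
  define a b where "a = ln (real N)" and "b = ln (real M)"
  have ab: "a \<le> b" "b \<le> a + 1"
  proof -
    show "a \<le> b" using NM by (simp add: a_def b_def)
    have "b - a = ln (real M / real N)" using NM by (simp add: a_def b_def ln_div)
    also have "\<dots> \<le> real M / real N - 1" using NM by (intro ln_le_minus_one) simp
    also have "\<dots> \<le> 1" using NM by (simp add: field_simps)
    finally show "b \<le> a + 1" by simp
  qed
  have \<sigma>': "1 \<le> \<sigma>" using \<sigma> by simp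
  define k where "k = levy_kernel \<sigma> a b"
  have int_k: "integrable lborel k" unfolding k_def by (rule integrable_levy_kernel[OF \<sigma>'(1) \<sigma>(2) ab])
  have [measurable]: "k \<in> borel_measurable borel" unfolding k_def by simp
  define f where "f = (\<lambda>n t. c n * of_nat n powr (- of_real \<sigma>) * (k t * iexp (t * ln (real n))))"
  have int_f: "integrable lborel (f n)" for n
    unfolding f_def
    by (intro integrable_mult_right Bochner_Integration.integrable_bound[OF int_k]) (auto simp: norm_mult)
  have norm_f: "norm (f n t) = norm (c n) * real n powr (-\<sigma>) * norm (k t)" for n t
    by (simp add: f_def norm_mult norm_nat_powr)
  have sm: "summable (\<lambda>n. norm (c n) * real n powr (-\<sigma>))" using c \<sigma> by (simp add: summable_right_of_1_def)
  have AE: "AE t in lborel. summable (\<lambda>n. norm (f n t))"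
    unfolding norm_f by (intro AE_I2 summable_mult2 sm)
  have sm_int: "summable (\<lambda>n. LINT t|lborel. norm (f n t))"
    unfolding norm_f by (simp add: summable_mult2 sm)
  have tm: "(CLINT t|lborel. f n t) = of_real (2 * pi) * (c n * of_real (max (real n) (real N) powr (-\<sigma>) - max (real n) (real M) powr (-\<sigma>)))" for n
  proof (cases "n = 0")
    case True
    then show ?thesis by (simp add: f_def c)
  next
    case False
    have "(CLINT t|lborel. f n t) = c n * of_nat n powr (- of_real \<sigma>) * (CLINT t|lborel. levy_kernel \<sigma> (a - ln (real n)) (b - ln (real n)) t)"
      unfolding f_def k_def levy_kernel_shift by simp
    also have "(CLINT t|lborel. levy_kernel \<sigma> (a - ln (real n)) (b - ln (real n)) t) =
       2 * pi * measure (exponential_measure \<sigma>) {a - ln (real n)<..b - ln (real n)}"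
      by (rule integral_levy_kernel) (use \<sigma> ab in auto)
    also have "measure (exponential_measure \<sigma>) {a - ln (real n)<..b - ln (real n)} =
       exp (- \<sigma> * max 0 (a - ln (real n))) - exp (- \<sigma> * max 0 (b - ln (real n)))"
      by (rule measure_exponential_measure) (use \<sigma> ab in auto)
    also have "of_nat n powr (- of_real \<sigma>) = complex_of_real (real n powr (-\<sigma>))"
      using powr_of_real[of "real n" "-\<sigma>"] by simp
    finally have "(CLINT t|lborel. f n t) = of_real (2 * pi) * (c n * of_real (real n powr (-\<sigma>) * exp (- \<sigma> * max 0 (a - ln (real n))) - real n powr (-\<sigma>) * exp (- \<sigma> * max 0 (b - ln (real n)))))"
      by (simp add: algebra_simps)
    moreover have "real n powr (-\<sigma>) * exp (- \<sigma> * max 0 (a - ln (real n))) = max (real n) (real N) powr (-\<sigma>)"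
      "real n powr (-\<sigma>) * exp (- \<sigma> * max 0 (b - ln (real n))) = max (real n) (real M) powr (-\<sigma>)"
      unfolding a_def b_def using False NM by (intro exp_max_ln; simp)+
    ultimately show ?thesis by (simp only:)
  qed
  have total: "(\<Sum>n. f n t) = k t * dirichlet_series c (Complex \<sigma> (-t))" for t
  proof -
    have "f n t = k t * (c n * of_nat n powr (- Complex \<sigma> (-t)))" for n
    proof (cases "n = 0")
      case False
      have "of_nat n powr (- Complex \<sigma> (-t)) = of_nat n powr (- of_real \<sigma>) * of_nat n powr (\<i> * of_real t)"
        by (simp add: powr_add[symmetric] Complex_eq)
      also have "of_nat n powr (\<i> * of_real t) = iexp (t * ln (real n))"
      proof -
        have "Ln (of_nat n) = of_real (ln (real n))" using False by (simp add: Ln_of_nat)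
        then show ?thesis using False by (simp add: powr_def mult_ac)
      qed
      finally show ?thesis by (simp add: f_def mult_ac)
    qed (simp add: f_def)
    then show ?thesis
      unfolding dirichlet_series_def using suminf_mult[OF summable_right_of_1_summable[OF c(1), of "Complex \<sigma> (-t)"], of "k t"] \<sigma> by simp
  qed
  have "of_real (2 * pi) * (\<Sum>n\<le>M. c n * of_real (max (real n) (real N) powr (-\<sigma>) - max (real n) (real M) powr (-\<sigma>)))
    = (\<Sum>n\<le>M. CLINT t|lborel. f n t)"
    unfolding tm by (simp add: sum_distrib_left)
  \<comment> \<open>For n \<ge> M the two maxima coincide, so the infinite sum stops at M.\<close>
  also have "\<dots> = (\<Sum>n. CLINT t|lborel. f n t)"
    by (rule suminf_finite[symmetric]) (use NM in \<open>auto simp: tm max_def\<close>)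
  also have "\<dots> = (CLINT t|lborel. (\<Sum>n. f n t))"
    by (rule integral_suminf[OF int_f AE sm_int, symmetric])
  also have "norm \<dots> \<le> (LINT t|lborel. 32 * C * (1 + \<bar>t\<bar>) powr (-3/2))"
  proof (rule Bochner_Integration.integral_norm_bound_integral)
    show "integrable lborel (\<lambda>t. \<Sum>n. f n t)" by (rule integrable_suminf[OF int_f AE sm_int])
    show "integrable lborel (\<lambda>t. 32 * C * (1 + \<bar>t\<bar>) powr (-3/2))"
      by (intro integrable_mult_right integrable_abs_powr)
    fix t :: real
    have p: "1 + \<bar>t\<bar> > 0" by simp
    have "norm (\<Sum>n. f n t) = norm (k t) * norm (dirichlet_series c (Complex \<sigma> (-t)))" by (simp add: total norm_mult)
    also have "\<dots> \<le> 16 / (1 + \<bar>t\<bar>)\<^sup>2 * (C * height (Complex \<sigma> (-t)) powr (1/2))"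
      unfolding k_def using \<sigma> by (intro mult_mono norm_levy_kernel_le ab C) auto
    also have "\<dots> \<le> 16 / (1 + \<bar>t\<bar>)\<^sup>2 * (C * (2 * (1 + \<bar>t\<bar>) powr (1/2)))"
    proof (intro mult_left_mono)
      have "height (Complex \<sigma> (-t)) powr (1/2) \<le> (4 * (1 + \<bar>t\<bar>)) powr (1/2)"
        by (intro powr_mono2) (auto simp: height_def)
      also have "\<dots> = 2 * (1 + \<bar>t\<bar>) powr (1/2)" by (subst powr_mult) (simp_all add: powr_half_sqrt)
      finally show "height (Complex \<sigma> (-t)) powr (1/2) \<le> 2 * (1 + \<bar>t\<bar>) powr (1/2)" .
      have "0 \<le> norm (dirichlet_series c 2)" by simp
      also have "\<dots> \<le> C * height 2 powr (1/2)" by (rule C) auto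
      finally show "C \<ge> 0" using height_pos[of 2] by (simp add: zero_le_mult_iff)
    qed auto
    also have "\<dots> = 32 * C * ((1 + \<bar>t\<bar>) powr (1/2) / (1 + \<bar>t\<bar>) powr 2)"
      using p by (simp add: powr_numeral)
    also have "(1 + \<bar>t\<bar>) powr (1/2) / (1 + \<bar>t\<bar>) powr 2 = (1 + \<bar>t\<bar>) powr (-3/2)"
      using powr_diff[of "1 + \<bar>t\<bar>" "1/2" 2] by simp
    finally show "norm (\<Sum>n. f n t) \<le> 32 * C * (1 + \<bar>t\<bar>) powr (-3/2)" .
  qed
  finally have "2 * pi * norm (\<Sum>n\<le>M. c n * of_real (max (real n) (real N) powr (-\<sigma>) - max (real n) (real M) powr (-\<sigma>)))
     \<le> (LINT t|lborel. 32 * C * (1 + \<bar>t\<bar>) powr (-3/2))" (is "_ * ?S \<le> ?I")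
    by (simp only: norm_mult norm_of_real) simp
  then show "?S \<le> ?I / (2 * pi)" by (simp add: field_simps)
qed

text \<open>As \<open>\<sigma>\<close> tends to 1, the weights become \<open>\<delta>\<close> = 1/N
  - 1/M for n \<le> N and lie between 0 and \<open>\<delta>\<close> for N < n \<le> M. Dividing by
  \<open>\<delta>\<close> gives the claim, as 1 / \<open>\<delta>\<close> = N M / (M - N).\<close>

lemma partial_sum_bound:
  assumes c: "summable_right_of_1 c" "c 0 = 0"
    and C: "\<And>s. 1 < Re s \<Longrightarrow> Re s \<le> 2 \<Longrightarrow> norm (dirichlet_series c s) \<le> C * height s powr (1/2)"
  obtains K where "\<And>N M. 1 \<le> N \<Longrightarrow> N < M \<Longrightarrow> M \<le> 2 * N \<Longrightarrow>
     norm (\<Sum>n\<le>N. c n) \<le> K * (real N * real M / (real M - real N)) + (\<Sum>n\<in>{N<..M}. norm (c n))"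
proof -
  obtain K where K: "\<And>\<sigma> N M. 1 < \<sigma> \<Longrightarrow> \<sigma> \<le> 2 \<Longrightarrow> 1 \<le> N \<Longrightarrow> N \<le> M \<Longrightarrow> M \<le> 2 * N \<Longrightarrow>
     norm (\<Sum>n\<le>M. c n * of_real (max (real n) (real N) powr (-\<sigma>) - max (real n) (real M) powr (-\<sigma>))) \<le> K"
    using dirichlet_series_smoothed_bound[OF c C] by blast
  show ?thesis
  proof (rule that)
    fix N M :: nat assume NM: "1 \<le> N" "N < M" "M \<le> 2 * N"
    define w where "w = (\<lambda>\<sigma> n. max (real n) (real N) powr (-\<sigma>) - max (real n) (real M) powr (-\<sigma>))"
    have "((\<lambda>\<sigma>. norm (\<Sum>n\<le>M. c n * of_real (w \<sigma> n))) \<longlongrightarrow> norm (\<Sum>n\<le>M. c n * of_real (w 1 n))) (at_right 1)"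
      unfolding w_def using NM by (intro tendsto_intros) auto
    moreover have "eventually (\<lambda>\<sigma>. norm (\<Sum>n\<le>M. c n * of_real (w \<sigma> n)) \<le> K) (at_right 1)"
    proof -
      have "eventually (\<lambda>\<sigma>. \<sigma> \<in> {1<..<2::real}) (at_right 1)" by (rule eventually_at_right_real) auto
      then show ?thesis by eventually_elim (use K NM in \<open>auto simp: w_def\<close>)
    qed
    ultimately have lim: "norm (\<Sum>n\<le>M. c n * of_real (w 1 n)) \<le> K"
      by (intro tendsto_upperbound) auto
    define \<delta> where "\<delta> = 1 / real N - 1 / real M"
    have \<delta>: "\<delta> > 0" using NM by (simp add: \<delta>_def field_simps)
    have w1: "w 1 n = \<delta>" if "n \<le> N" for n
      using that NM by (simp add: w_def \<delta>_def max_def powr_minus divide_inverse)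
    have w2: "\<bar>w 1 n\<bar> \<le> \<delta>" if "n \<in> {N<..M}" for n
    proof -
      have "w 1 n = 1 / real n - 1 / real M" using that NM by (simp add: w_def max_def powr_minus divide_inverse)
      moreover have "1 / real M \<le> 1 / real n" "1 / real n \<le> 1 / real N"
        using that NM by (auto intro!: divide_left_mono)
      ultimately show ?thesis by (simp add: \<delta>_def)
    qed
    have "(\<Sum>n\<le>M. c n * of_real (w 1 n)) = (\<Sum>n\<in>{..N} \<union> {N<..M}. c n * of_real (w 1 n))"
      using NM by (intro sum.cong) auto
    also have "\<dots> = (\<Sum>n\<le>N. c n * of_real (w 1 n)) + (\<Sum>n\<in>{N<..M}. c n * of_real (w 1 n))"
      by (intro sum.union_disjoint) auto
    also have "(\<Sum>n\<le>N. c n * of_real (w 1 n)) = of_real \<delta> * (\<Sum>n\<le>N. c n)"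
      by (simp add: w1 sum_distrib_left mult.commute)
    finally have "of_real \<delta> * (\<Sum>n\<le>N. c n) = (\<Sum>n\<le>M. c n * of_real (w 1 n)) - (\<Sum>n\<in>{N<..M}. c n * of_real (w 1 n))"
      by simp
    then have "norm (of_real \<delta> * (\<Sum>n\<le>N. c n)) \<le> norm (\<Sum>n\<le>M. c n * of_real (w 1 n)) + norm (\<Sum>n\<in>{N<..M}. c n * of_real (w 1 n))"
      by (metis norm_triangle_ineq4)
    also have "\<dots> \<le> K + (\<Sum>n\<in>{N<..M}. norm (c n) * \<delta>)"
    proof (intro add_mono lim sum_norm_le)
      fix n assume "n \<in> {N<..M}"
      then show "norm (c n * of_real (w 1 n)) \<le> norm (c n) * \<delta>"
        using w2 by (simp add: norm_mult mult_left_mono)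
    qed
    also have "norm (of_real \<delta> * (\<Sum>n\<le>N. c n)) = norm (\<Sum>n\<le>N. c n) * \<delta>"
      using \<delta> by (simp add: norm_mult)
    finally have "norm (\<Sum>n\<le>N. c n) \<le> (K + (\<Sum>n\<in>{N<..M}. norm (c n)) * \<delta>) / \<delta>"
      using \<delta> by (simp add: field_simps sum_distrib_left)
    also have "\<dots> = K * (1 / \<delta>) + (\<Sum>n\<in>{N<..M}. norm (c n))" using \<delta> by (simp add: field_simps)
    also have "1 / \<delta> = real N * real M / (real M - real N)" using NM by (simp add: \<delta>_def divide_simps) 
    finally show "norm (\<Sum>n\<le>N. c n) \<le> K * (real N * real M / (real M - real N)) + (\<Sum>n\<in>{N<..M}. norm (c n))" .
  qed
qed

section \<open>The prime number theorem with error term\<close>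

definition weighted_mangoldt :: "nat \<Rightarrow> real" where
  "weighted_mangoldt n = ln (real n) ^ 5 * (mangoldt n - 1)"

lemma weighted_mangoldt_partial_sum_bound:
  obtains K where "\<And>N M. 1 \<le> N \<Longrightarrow> N < M \<Longrightarrow> M \<le> 2 * N \<Longrightarrow>
     \<bar>\<Sum>n\<le>N. weighted_mangoldt n\<bar> \<le> K * (real N * real M / (real M - real N)) + (\<Sum>n\<in>{N<..M}. \<bar>weighted_mangoldt n\<bar>)"
proof -
  define c where "c = (\<lambda>n. of_real (ln (real n)) ^ 5 * mangoldt_minus_1 n)"
  have c: "c = (\<lambda>n. complex_of_real (weighted_mangoldt n))"
    by (auto simp: c_def mangoldt_minus_1_def weighted_mangoldt_def fun_eq_iff)
  obtain C where C: "\<And>s. 1 < Re s \<Longrightarrow> Re s \<le> 2 \<Longrightarrow> norm (dirichlet_series c s) \<le> C * height s powr (1/2)"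
    unfolding c_def using dirichlet_series_ln_power_mangoldt_minus_1_bound[of 5] by blast
  have "summable_right_of_1 c" unfolding c_def by (rule summable_right_of_1_ln_power[OF summable_right_of_1_mangoldt_minus_1])
  moreover have "c 0 = 0" by (simp add: c_def)
  ultimately obtain K where "\<And>N M. 1 \<le> N \<Longrightarrow> N < M \<Longrightarrow> M \<le> 2 * N \<Longrightarrow>
     norm (\<Sum>n\<le>N. c n) \<le> K * (real N * real M / (real M - real N)) + (\<Sum>n\<in>{N<..M}. norm (c n))"
    using partial_sum_bound[OF _ _ C] by blast
  then show ?thesis
    by (intro that[of K]) (simp add: c flip: of_real_sum)
qed

lemma abs_weighted_mangoldt_le:
  assumes "n \<ge> 1"
  shows "\<bar>weighted_mangoldt n\<bar> \<le> ln (real n) ^ 5 * (1 + ln (real n))"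
proof -
  have "\<bar>mangoldt n - (1::real)\<bar> \<le> 1 + ln (real n)"
    using mangoldt_le[of n] mangoldt_nonneg[of n] assms by auto
  then show ?thesis using assms by (simp add: weighted_mangoldt_def abs_mult mult_left_mono)
qed

lemma weighted_mangoldt_sum_bigo: "(\<lambda>N. \<Sum>n\<le>N. weighted_mangoldt n) \<in> O(\<lambda>N. real N * ln (real N) ^ 3)"
proof -
  obtain K where K: "\<And>N M. 1 \<le> N \<Longrightarrow> N < M \<Longrightarrow> M \<le> 2 * N \<Longrightarrow>
     \<bar>\<Sum>n\<le>N. weighted_mangoldt n\<bar> \<le> K * (real N * real M / (real M - real N)) + (\<Sum>n\<in>{N<..M}. \<bar>weighted_mangoldt n\<bar>)"
    using weighted_mangoldt_partial_sum_bound by blast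
  have ev: "eventually (\<lambda>N. N \<ge> 3 \<and> ln (real N) \<ge> 1 \<and> ln (real N) ^ 3 \<le> real N) sequentially"
    by (intro eventually_conj eventually_ge_at_top) real_asymp+
  have "eventually (\<lambda>N. norm (\<Sum>n\<le>N. weighted_mangoldt n) \<le> (2 * \<bar>K\<bar> + 192) * norm (real N * ln (real N) ^ 3)) sequentially"
    using ev
  proof eventually_elim
    case (elim N)
    define L where "L = ln (real N)"
    have L: "L \<ge> 1" "L ^ 3 \<le> real N" and N: "N \<ge> 3" using elim by (auto simp: L_def)
    \<comment> \<open>The window of length about N / L^3 balances the two terms: N^2 / m and m L^6
      are both of order N L^3. The assumption L^3 \<le> N gives m \<le> N, as the bound with M = N +
      m demands.\<close>
    define m where "m = nat \<lceil>real N / L ^ 3\<rceil>"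
    have L3: "L ^ 3 \<ge> 1" using L by simp
    have q: "1 \<le> real N / L ^ 3" "real N / L ^ 3 \<le> real N"
      using L L3 N by (auto simp: field_simps)
    have m1: "real N / L ^ 3 \<le> real m" "real m \<le> real N / L ^ 3 + 1"
      using q unfolding m_def by linarith+
    have m2: "m \<le> N" 
    proof -
      have "\<lceil>real N / L ^ 3\<rceil> \<le> int N" using q by (intro ceiling_le) (simp only: of_int_of_nat_eq)
      then show ?thesis unfolding m_def by linarith
    qed
    have m3: "m \<ge> 1" using m1 q by linarith
    have m4: "real m \<le> 2 * (real N / L ^ 3)" using m1 q by linarith
    have "\<bar>\<Sum>n\<le>N. weighted_mangoldt n\<bar> \<le> K * (real N * real (N + m) / (real (N + m) - real N)) + (\<Sum>n\<in>{N<..N+m}. \<bar>weighted_mangoldt n\<bar>)"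
      using m2 m3 N by (intro K) auto
    also have "\<dots> \<le> \<bar>K\<bar> * (2 * (real N * L ^ 3)) + 192 * (real N * L ^ 3)"
    proof (intro add_mono)
      have "real N * real (N + m) / (real (N + m) - real N) \<le> real N * (2 * real N) / (real N / L ^ 3)"
        using m1 m2 m3 N L q by (intro frac_le mult_mono) auto
      also have "\<dots> = 2 * (real N * L ^ 3)" using N L by simp
      finally have "real N * real (N + m) / (real (N + m) - real N) \<le> 2 * (real N * L ^ 3)" .
      moreover have "0 \<le> real N * real (N + m) / (real (N + m) - real N)" by simp
      ultimately show "K * (real N * real (N + m) / (real (N + m) - real N)) \<le> \<bar>K\<bar> * (2 * (real N * L ^ 3))"
        by (intro mult_mono) auto
      have "(\<Sum>n\<in>{N<..N+m}. \<bar>weighted_mangoldt n\<bar>) \<le> (\<Sum>n\<in>{N<..N+m}. (2 * L) ^ 5 * (3 * L))"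
      proof (rule sum_mono)
        fix n assume n: "n \<in> {N<..N+m}"
        have "ln (real n) \<le> ln (2 * real N)" using n m2 N by simp
        also have "\<dots> = ln 2 + L" using N by (simp add: L_def ln_mult)
        also have "ln 2 \<le> (1::real)" using ln_2_less_1 by simp
        finally have ln: "ln (real n) \<le> 1 + L" by simp
        have "\<bar>weighted_mangoldt n\<bar> \<le> ln (real n) ^ 5 * (1 + ln (real n))"
          using n by (intro abs_weighted_mangoldt_le) auto
        also have "\<dots> \<le> (2 * L) ^ 5 * (3 * L)"
          using ln L n by (intro mult_mono power_mono) auto
        finally show "\<bar>weighted_mangoldt n\<bar> \<le> (2 * L) ^ 5 * (3 * L)" .
      qed
      also have "\<dots> = real m * (96 * L ^ 6)" by (simp add: power_mult_distrib eval_nat_numeral)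
      also have "\<dots> \<le> (2 * (real N / L ^ 3)) * (96 * L ^ 6)"
        by (intro mult_right_mono m4) auto
      also have "\<dots> = 192 * (real N * L ^ 3)" using L by (simp add: field_simps eval_nat_numeral)
      finally show "(\<Sum>n\<in>{N<..N+m}. \<bar>weighted_mangoldt n\<bar>) \<le> 192 * (real N * L ^ 3)" .
    qed
    also have "\<dots> = (2 * \<bar>K\<bar> + 192) * (real N * L ^ 3)" by (simp add: algebra_simps)
    finally show ?case using L by (simp add: L_def[symmetric] abs_mult)
  qed
  then show ?thesis by (rule bigoI)
qed

definition chebyshev_psi :: "nat \<Rightarrow> real" where
  "chebyshev_psi N = (\<Sum>n\<in>{1..N}. mangoldt n)"

text \<open>Partial summation removes the weight \<open>ln\<^sup>5 n\<close>.\<close>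

lemma chebyshev_psi_bigo: "(\<lambda>N. chebyshev_psi N - real N) \<in> O(\<lambda>N. real N / ln (real N) ^ 2)"
proof -
  define B where "B = (\<lambda>N. \<Sum>n\<le>N. weighted_mangoldt n)"
  define L where "L = (\<lambda>N::nat. ln (real N))"
  obtain C where C: "C > 0" "eventually (\<lambda>N. norm (B N) \<le> C * norm (real N * L N ^ 3)) sequentially"
    using landau_o.bigE[OF weighted_mangoldt_sum_bigo] unfolding B_def L_def by blast
  \<comment> \<open>The left side is about 5 / ln^3 N and the right side about 1 / ln^2 N. This
    inequality lets the errors of the partial summation telescope.\<close>
  have ev: "eventually (\<lambda>N. real N * L N ^ 3 * (1 / L N ^ 5 - 1 / L (Suc N) ^ 5) \<le> real (Suc N) / L (Suc N) ^ 2 - real N / L N ^ 2) sequentially"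
    unfolding L_def by real_asymp
  have ev2: "eventually (\<lambda>N. L N > 0) sequentially" unfolding L_def by real_asymp
  obtain N0 where N0: "\<And>N. N \<ge> N0 \<Longrightarrow> norm (B N) \<le> C * norm (real N * L N ^ 3)"
    "\<And>N. N \<ge> N0 \<Longrightarrow> real N * L N ^ 3 * (1 / L N ^ 5 - 1 / L (Suc N) ^ 5) \<le> real (Suc N) / L (Suc N) ^ 2 - real N / L N ^ 2"
    "\<And>N. N \<ge> N0 \<Longrightarrow> L N > 0"
    using eventually_conj[OF C(2) eventually_conj[OF ev ev2]] unfolding eventually_sequentially by blast
  \<comment> \<open>Passing from N to N + 1 cancels the new term of \<open>weighted_mangoldt\<close>
    divided by its weight, so the quantity inside the absolute value changes only by B N times the
    difference of the reciprocal weights.\<close>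
  define D where "D = (\<lambda>N. \<bar>chebyshev_psi N - real N - B N / L N ^ 5\<bar>)"
  have D: "D N \<le> D N0 + C * (real N / L N ^ 2 - real N0 / L N0 ^ 2)" if "N \<ge> N0" for N
    using that
  proof (induction N rule: dec_induct)
    case base
    show ?case by simp
  next
    case (step N)
    have LN: "L N > 0" "L (Suc N) > 0" using N0(3)[of N] N0(3)[of "Suc N"] step by auto
    have LL: "L N \<le> L (Suc N)" using LN by (cases "N = 0") (auto simp: L_def)
    have "chebyshev_psi (Suc N) - real (Suc N) - B (Suc N) / L (Suc N) ^ 5
       = chebyshev_psi N - real N + (mangoldt (Suc N) - 1) - (B N + L (Suc N) ^ 5 * (mangoldt (Suc N) - 1)) / L (Suc N) ^ 5"
      by (simp add: chebyshev_psi_def B_def weighted_mangoldt_def L_def)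
    also have "\<dots> = chebyshev_psi N - real N - B N / L (Suc N) ^ 5"
      using LN by (simp add: add_divide_distrib)
    also have "\<dots> = (chebyshev_psi N - real N - B N / L N ^ 5) + B N * (1 / L N ^ 5 - 1 / L (Suc N) ^ 5)"
      by (simp add: algebra_simps)
    also have "\<bar>\<dots>\<bar> \<le> D N + \<bar>B N\<bar> * (1 / L N ^ 5 - 1 / L (Suc N) ^ 5)"
    proof -
      have "1 / L (Suc N) ^ 5 \<le> 1 / L N ^ 5" using LN LL by (intro divide_left_mono power_mono) auto
      then have "\<bar>B N * (1 / L N ^ 5 - 1 / L (Suc N) ^ 5)\<bar> = \<bar>B N\<bar> * (1 / L N ^ 5 - 1 / L (Suc N) ^ 5)"
        by (simp add: abs_mult)
      then show ?thesis unfolding D_def by linarith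
    qed
    also have "\<bar>B N\<bar> * (1 / L N ^ 5 - 1 / L (Suc N) ^ 5) \<le> (C * (real N * L N ^ 3)) * (1 / L N ^ 5 - 1 / L (Suc N) ^ 5)"
    proof (rule mult_right_mono)
      show "\<bar>B N\<bar> \<le> C * (real N * L N ^ 3)" using N0(1)[of N] step LN by (simp add: abs_mult)
      show "0 \<le> 1 / L N ^ 5 - 1 / L (Suc N) ^ 5" using LN LL by (simp add: divide_left_mono power_mono)
    qed
    also have "\<dots> \<le> C * (real (Suc N) / L (Suc N) ^ 2 - real N / L N ^ 2)"
      using N0(2)[of N] step C by (simp only: mult.assoc) (intro mult_left_mono, auto)
    finally have "D (Suc N) \<le> D N + C * (real (Suc N) / L (Suc N) ^ 2 - real N / L N ^ 2)"
      unfolding D_def by linarith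
    with step.IH show ?case by (simp add: algebra_simps)
  qed
  have "(\<lambda>N. chebyshev_psi N - real N - B N / L N ^ 5) \<in> O(\<lambda>N. \<bar>D N0\<bar> + C * (real N / L N ^ 2))"
  proof (rule bigoI[where c = 1])
    show "eventually (\<lambda>N. norm (chebyshev_psi N - real N - B N / L N ^ 5) \<le> 1 * norm (\<bar>D N0\<bar> + C * (real N / L N ^ 2))) sequentially"
      using eventually_ge_at_top[of N0]
    proof eventually_elim
      case (elim N)
      have "0 \<le> C * (real N0 / L N0 ^ 2)" "0 \<le> C * (real N / L N ^ 2)" using C by auto
      then have "D N \<le> \<bar>D N0\<bar> + C * (real N / L N ^ 2)" using D[OF elim] by (simp add: right_diff_distrib)
      then show ?case unfolding D_def by auto
    qed
  qed
  also have "(\<lambda>N. \<bar>D N0\<bar> + C * (real N / L N ^ 2)) \<in> O(\<lambda>N. real N / L N ^ 2)"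
    unfolding L_def using C(1) by real_asymp
  finally have 1: "(\<lambda>N. chebyshev_psi N - real N - B N / L N ^ 5) \<in> O(\<lambda>N. real N / L N ^ 2)" .
  have "(\<lambda>N. B N / L N ^ 5) \<in> O(\<lambda>N. real N * L N ^ 3 / L N ^ 5)"
    using ev2 unfolding B_def L_def
    by (intro landau_o.big.divide_right weighted_mangoldt_sum_bigo) (auto elim!: eventually_mono)
  also have "(\<lambda>N. real N * L N ^ 3 / L N ^ 5) \<in> O(\<lambda>N. real N / L N ^ 2)"
    unfolding L_def by real_asymp
  finally have 2: "(\<lambda>N. B N / L N ^ 5) \<in> O(\<lambda>N. real N / L N ^ 2)" .
  from sum_in_bigo(1)[OF 1 2] show ?thesis by (simp add: L_def)
qed

section \<open>From psi to theta and from integers to real arguments\<close>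

lemma chebyshev_theta_nat: "chebyshev_theta (real N) = (\<Sum>p | prime p \<and> p \<le> N. ln (real p))"
  by (simp add: chebyshev_theta_def)

lemma chebyshev_theta_floor:
  assumes "x \<ge> 0"
  shows "chebyshev_theta x = chebyshev_theta (real (nat \<lfloor>x\<rfloor>))"
proof -
  have "real p \<le> x \<longleftrightarrow> real p \<le> real (nat \<lfloor>x\<rfloor>)" for p
    using assms by (metis le_nat_floor of_nat_floor of_nat_le_iff order_trans)
  then show ?thesis unfolding chebyshev_theta_def by simp
qed

text \<open>A prime power that is not prime has exponent at least 2, hence its base is at most the
  square root of N. The exponent is at most 2 ln N because ln 2 \<ge> 1/2. The resulting crude count
  is enough for psi - theta.\<close>

lemma primepow_le_in_image:
  fixes n N :: nat
  assumes "primepow n" "\<not> prime n" "n \<le> N"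
  shows "n \<in> (\<lambda>(p, k). p ^ k) ` ({..nat \<lfloor>sqrt N\<rfloor>} \<times> {..nat \<lfloor>2 * ln N\<rfloor>})"
proof -
  from assms(1) obtain p k where pk: "prime p" "k > 0" "n = p ^ k"
    by (auto simp: primepow_def)
  have k2: "k \<ge> 2" using pk assms(2) by (cases "k = 1") auto
  have p2: "p \<ge> 2" using pk prime_ge_2_nat by auto
  have "p ^ 2 \<le> p ^ k" using k2 p2 by (intro power_increasing) auto
  also have "p ^ k \<le> N" using pk(3) assms(3) by simp
  finally have "p ^ 2 \<le> N" .
  then have "real p ^ 2 \<le> real N" by (metis of_nat_le_iff of_nat_power)
  then have "real p \<le> sqrt N" by (rule real_le_rsqrt)
  then have 1: "p \<le> nat \<lfloor>sqrt N\<rfloor>" by (rule le_nat_floor)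
  have "2 ^ k \<le> p ^ k" using p2 by (intro power_mono) auto
  also have "p ^ k \<le> N" using pk(3) assms(3) by simp
  finally have "2 ^ k \<le> N" .
  then have "(2::real) ^ k \<le> real N" by (metis of_nat_le_iff of_nat_power of_nat_numeral)
  then have "ln ((2::real) ^ k) \<le> ln (real N)" by (intro ln_mono) auto
  then have "real k * ln 2 \<le> ln (real N)" by (simp add: ln_realpow)
  moreover have "real k * (1/2) \<le> real k * ln 2" using ln2_ge_two_thirds by (intro mult_left_mono) auto
  ultimately have "real k \<le> 2 * ln (real N)" by simp
  then have 2: "k \<le> nat \<lfloor>2 * ln N\<rfloor>" by (rule le_nat_floor)
  show ?thesis using 1 2 pk by (intro image_eqI[of _ _ "(p, k)"]) auto
qed

lemma chebyshev_psi_minus_theta: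
  assumes "N \<ge> 1"
  shows "\<bar>chebyshev_psi N - chebyshev_theta (real N)\<bar> \<le> (sqrt N + 1) * (2 * ln N + 1) * ln N"
proof -
  define P where "P = {p. prime p \<and> p \<le> N}"
  define Q where "Q = {n. primepow n \<and> \<not> prime n \<and> n \<le> N}"
  have fin: "finite P" "finite Q" by (auto simp: P_def Q_def)
  have "chebyshev_psi N = (\<Sum>n\<in>P \<union> Q. mangoldt n)"
    unfolding chebyshev_psi_def
  proof (rule sum.mono_neutral_right)
    show "P \<union> Q \<subseteq> {1..N}" by (auto simp: P_def Q_def prime_ge_1_nat primepow_gt_0_nat Suc_le_eq)
    show "\<forall>i\<in>{1..N} - (P \<union> Q). mangoldt i = (0::real)"
      by (auto simp: P_def Q_def mangoldt_def)
  qed auto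
  also have "\<dots> = (\<Sum>n\<in>P. mangoldt n) + (\<Sum>n\<in>Q. mangoldt n)"
    by (rule sum.union_disjoint) (use fin in \<open>auto simp: P_def Q_def\<close>)
  also have "(\<Sum>n\<in>P. mangoldt n) = chebyshev_theta (real N)"
    unfolding chebyshev_theta_nat P_def by (intro sum.cong) auto
  finally have "chebyshev_psi N - chebyshev_theta (real N) = (\<Sum>n\<in>Q. mangoldt n)" by simp
  moreover have "(\<Sum>n\<in>Q. mangoldt n :: real) \<ge> 0" by (intro sum_nonneg mangoldt_nonneg)
  moreover have "(\<Sum>n\<in>Q. mangoldt n :: real) \<le> real (card Q) * ln N"
  proof (rule sum_bounded_above)
    fix n assume n: "n \<in> Q"
    then have "n > 0" by (auto simp: Q_def primepow_gt_0_nat)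
    then have "mangoldt n \<le> ln (real n)" by (rule mangoldt_le)
    also have "\<dots> \<le> ln (real N)" using n \<open>n > 0\<close> by (simp add: Q_def)
    finally show "mangoldt n \<le> ln (real N)" .
  qed
  moreover have "real (card Q) \<le> (sqrt N + 1) * (2 * ln N + 1)"
  proof -
    have "Q \<subseteq> (\<lambda>(p, k). p ^ k) ` ({..nat \<lfloor>sqrt N\<rfloor>} \<times> {..nat \<lfloor>2 * ln N\<rfloor>})"
      using primepow_le_in_image[of _ N] unfolding Q_def by blast
    then have "card Q \<le> card ({..nat \<lfloor>sqrt N\<rfloor>} \<times> {..nat \<lfloor>2 * ln N\<rfloor>})"
      by (intro surj_card_le) auto
    also have "\<dots> = (nat \<lfloor>sqrt N\<rfloor> + 1) * (nat \<lfloor>2 * ln N\<rfloor> + 1)" by (simp add: card_cartesian_product)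
    finally have "real (card Q) \<le> real ((nat \<lfloor>sqrt N\<rfloor> + 1) * (nat \<lfloor>2 * ln N\<rfloor> + 1))"
      by (rule of_nat_mono)
    also have "\<dots> = (real (nat \<lfloor>sqrt N\<rfloor>) + 1) * (real (nat \<lfloor>2 * ln N\<rfloor>) + 1)"
      by (simp only: of_nat_mult of_nat_add of_nat_1)
    also have "\<dots> \<le> (sqrt N + 1) * (2 * ln N + 1)"
      using assms by (intro mult_mono add_mono of_nat_floor) auto
    finally show ?thesis .
  qed
  ultimately show ?thesis using assms
    by (smt (verit, best) mult_right_mono ln_ge_zero of_nat_1 of_nat_le_iff)
qed

lemma chebyshev_theta_nat_bigo: "(\<lambda>N. chebyshev_theta (real N) - real N) \<in> O(\<lambda>N. real N / ln (real N) ^ 2)"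
proof -
  have "(\<lambda>N. chebyshev_psi N - chebyshev_theta (real N)) \<in> O(\<lambda>N. (sqrt N + 1) * (2 * ln N + 1) * ln N)"
  proof (rule bigoI[where c = 1])
    show "eventually (\<lambda>N. norm (chebyshev_psi N - chebyshev_theta (real N)) \<le> 1 * norm ((sqrt N + 1) * (2 * ln N + 1) * ln N)) sequentially"
      using eventually_ge_at_top[of 1]
    proof eventually_elim
      case (elim N)
      show ?case using chebyshev_psi_minus_theta[OF elim] by (auto intro: order_trans)
    qed
  qed
  also have "(\<lambda>N. (sqrt N + 1) * (2 * ln N + 1) * ln N) \<in> O(\<lambda>N. real N / ln (real N) ^ 2)"
    by real_asymp
  finally show ?thesis using sum_in_bigo(2)[OF chebyshev_psi_bigo] by fastforce
qed

theorem prime_number_theorem_theta: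
  "(\<lambda>x. chebyshev_theta x - x) \<in> O(\<lambda>x. x / ln x ^ 2)"
proof -
  have lim: "filterlim (\<lambda>x::real. nat \<lfloor>x\<rfloor>) sequentially at_top"
    by (intro filterlim_compose[OF filterlim_nat_sequentially filterlim_floor_sequentially])
  have "(\<lambda>x::real. chebyshev_theta (real (nat \<lfloor>x\<rfloor>)) - real (nat \<lfloor>x\<rfloor>)) \<in> O(\<lambda>x. real (nat \<lfloor>x\<rfloor>) / ln (real (nat \<lfloor>x\<rfloor>)) ^ 2)"
    using landau_o.big.compose[OF chebyshev_theta_nat_bigo lim] by simp
  also have "(\<lambda>x::real. real (nat \<lfloor>x\<rfloor>) / ln (real (nat \<lfloor>x\<rfloor>)) ^ 2) \<in> O(\<lambda>x. x / ln x ^ 2)"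
    by real_asymp
  finally have 1: "(\<lambda>x::real. chebyshev_theta (real (nat \<lfloor>x\<rfloor>)) - real (nat \<lfloor>x\<rfloor>)) \<in> O(\<lambda>x. x / ln x ^ 2)" .
  have "(\<lambda>x::real. real (nat \<lfloor>x\<rfloor>) - x) \<in> O(\<lambda>_. 1 :: real)"
  proof (rule bigoI[where c = 1])
    show "eventually (\<lambda>x::real. norm (real (nat \<lfloor>x\<rfloor>) - x) \<le> 1 * norm (1 :: real)) at_top"
      using eventually_ge_at_top[of 0] 
    proof eventually_elim
      case (elim x)
      have "x - 1 \<le> real (nat \<lfloor>x\<rfloor>)" "real (nat \<lfloor>x\<rfloor>) \<le> x"
        using elim by linarith+
      then have "\<bar>real (nat \<lfloor>x\<rfloor>) - x\<bar> \<le> 1" by linarith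
      then show ?case by (simp only: real_norm_def abs_one mult_1)
    qed
  qed
  also have "(\<lambda>_. 1) \<in> O(\<lambda>x::real. x / ln x ^ 2)" by real_asymp
  finally have 2: "(\<lambda>x::real. real (nat \<lfloor>x\<rfloor>) - x) \<in> O(\<lambda>x. x / ln x ^ 2)" .
  have "(\<lambda>x. chebyshev_theta (real (nat \<lfloor>x\<rfloor>)) - x) \<in> O(\<lambda>x. x / ln x ^ 2)"
    using sum_in_bigo(1)[OF 1 2] by simp
  also have "?this \<longleftrightarrow> ?thesis"
  proof (rule landau_o.big.in_cong)
    show "eventually (\<lambda>x. chebyshev_theta (real (nat \<lfloor>x\<rfloor>)) - x = chebyshev_theta x - x) at_top"
      using eventually_ge_at_top[of 0] by eventually_elim (metis chebyshev_theta_floor)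
  qed
  finally show ?thesis .
qed

section \<open>Sums of powers of primes\<close>

definition layer :: "nat \<Rightarrow> nat \<Rightarrow> nat set" where
  "layer Z k = {q. prime q \<and> zval (q, k) \<le> Z}"

lemma zval_Suc: "zval (q, Suc k) = zval (q, k) + q ^ Suc k"
  by (simp add: zval_def)

lemma power_le_zval: "k \<ge> 1 \<Longrightarrow> q ^ k \<le> zval (q, k)"
  by (cases k) (auto simp: zval_Suc)

lemma zval_geometric: "zval (q, k) * (q - 1) = q * (q ^ k - 1)" if "q \<ge> 1" for q k :: nat
proof -
  have "(zval (q, k) * (q - 1) :: nat) + q = q * q ^ k"
  proof (induction k)
    case 0
    then show ?case by (simp add: zval_def)
  next
    case (Suc k)
    obtain r where r: "q = Suc r" using \<open>q \<ge> 1\<close> by (cases q) auto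
    from Suc show ?case by (simp add: zval_Suc r algebra_simps)
  qed
  then show ?thesis by (simp add: diff_mult_distrib2)
qed

text \<open>Induction along the Horner form q + q * zval (q, n), compared with (q + 1)^(n + 1) = (q
  + 1)^n + q (q + 1)^n.\<close>

lemma zval_le_Suc_power: "zval (q, Suc k) \<le> (q + 1) ^ Suc k"
proof (induction k)
  case 0
  then show ?case by (simp add: zval_def)
next
  case (Suc k)
  have q: "zval (q, Suc n) = q + q * zval (q, n)" for n
    unfolding zval_def by (simp add: sum.atLeast_Suc_atMost sum_distrib_left sum.shift_bounds_cl_Suc_ivl del: sum.cl_ivl_Suc)
  have "q + 1 \<le> (q + 1) ^ Suc k" by (rule self_le_power) auto
  then have "q \<le> (q + 1) ^ Suc k" by linarith
  then have "q + q * zval (q, Suc k) \<le> (q + 1) ^ Suc k + q * (q + 1) ^ Suc k"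
    using Suc by (intro add_mono mult_left_mono) auto
  then show ?case by (simp add: q[of "Suc k"])
qed

lemma finite_layer: "k \<ge> 1 \<Longrightarrow> finite (layer Z k)"
  by (rule finite_subset[of _ "{..Z}"]) (auto simp: layer_def prime_exp_pairs_def intro: order_trans[OF zval_ge(1)])

text \<open>Summing over indices is summing over pairs, so the rule for ties in the enumeration has
  no influence on \<open>psi_Z\<close>.\<close>

lemma psi_Z_eq_pairs:
  assumes "z_enumeration e"
  shows "psi_Z e x = (\<Sum>p | p \<in> prime_exp_pairs \<and> real (zval p) \<le> x. ln (real (zval p)))"
  unfolding psi_Z_def
proof (rule sum.reindex_bij_betw)
  have bij: "bij_betw e {1..} prime_exp_pairs" using assms by (simp add: z_enumeration_def)
  then show "bij_betw e {i. 1 \<le> i \<and> real (zval (e i)) \<le> x} {p. p \<in> prime_exp_pairs \<and> real (zval p) \<le> x}"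
    unfolding bij_betw_def by (fastforce simp: inj_on_def image_iff set_eq_iff)
qed

lemma le_log2_of_power_le:
  assumes "2 ^ k \<le> (Z::nat)"
  shows "k \<le> nat \<lfloor>ln (real Z) / ln 2\<rfloor>"
proof -
  have "(2::real) ^ k \<le> real Z" using assms by (metis of_nat_le_iff of_nat_power of_nat_numeral)
  then have "ln ((2::real) ^ k) \<le> ln (real Z)" by (intro ln_mono) auto
  then have "real k \<le> ln (real Z) / ln 2" by (simp add: ln_realpow field_simps)
  then show ?thesis by (rule le_nat_floor)
qed

text \<open>Every prime is at least 2, so 2^k \<le> Z for each nonempty layer and none lies beyond
  K. The layer k = 1 consists of the primes up to Z and gives theta.\<close>

lemma psi_Z_eq_layers:
  assumes e: "z_enumeration e" and Z: "Z \<ge> 2"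
  defines "K \<equiv> nat \<lfloor>ln (real Z) / ln 2\<rfloor>"
  shows "psi_Z e (real Z) = chebyshev_theta (real Z) + (\<Sum>k=2..K. \<Sum>q\<in>layer Z k. ln (real (zval (q, k))))"
proof -
  have K1: "K \<ge> 1" unfolding K_def using Z by (intro le_log2_of_power_le) auto
  have "psi_Z e (real Z) = (\<Sum>p | p \<in> prime_exp_pairs \<and> zval p \<le> Z. ln (real (zval p)))"
    using psi_Z_eq_pairs[OF e] by simp
  also have "\<dots> = (\<Sum>(k, q)\<in>Sigma {1..K} (layer Z). ln (real (zval (q, k))))"
  proof (rule sum.reindex_bij_witness[of _ "\<lambda>(k, q). (q, k)" "\<lambda>(q, k). (k, q)"])
    fix p assume "p \<in> {p. p \<in> prime_exp_pairs \<and> zval p \<le> Z}"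
    then obtain q k where p: "p = (q, k)" "prime q" "1 \<le> k" "zval (q, k) \<le> Z"
      by (auto simp: prime_exp_pairs_def)
    have "2 ^ k \<le> q ^ k" using p prime_ge_2_nat by (intro power_mono) auto
    also have "\<dots> \<le> Z" using power_le_zval[OF p(3), of q] p by linarith
    finally have "k \<le> K" unfolding K_def by (rule le_log2_of_power_le)
    then show "(case p of (q, k) \<Rightarrow> (k, q)) \<in> Sigma {1..K} (layer Z)" using p by (auto simp: layer_def)
  qed (auto simp: layer_def prime_exp_pairs_def)
  also have "\<dots> = (\<Sum>k=1..K. \<Sum>q\<in>layer Z k. ln (real (zval (q, k))))"
    by (rule sum.Sigma[symmetric]) (auto intro: finite_layer)
  also have "\<dots> = (\<Sum>q\<in>layer Z 1. ln (real (zval (q, 1)))) + (\<Sum>k=2..K. \<Sum>q\<in>layer Z k. ln (real (zval (q, k))))"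
    using K1 by (simp add: sum.atLeast_Suc_atMost numeral_2_eq_2)
  also have "(\<Sum>q\<in>layer Z 1. ln (real (zval (q, 1)))) = chebyshev_theta (real Z)"
    unfolding chebyshev_theta_nat layer_def by (simp add: zval_def)
  finally show ?thesis .
qed

section \<open>A layer compared with the primes up to the k-th root\<close>

definition root_layer :: "nat \<Rightarrow> nat \<Rightarrow> nat set" where
  "root_layer Z k = {q. prime q \<and> q ^ k \<le> Z}"

lemma le_powr_inverse_iff:
  assumes "k \<ge> 1" "Z \<ge> 1"
  shows "real q \<le> real Z powr (1 / real k) \<longleftrightarrow> q ^ k \<le> Z"
proof -
  have "real q \<le> real Z powr (1 / real k) \<longleftrightarrow> real q ^ k \<le> (real Z powr (1 / real k)) ^ k"
    using assms by (intro power_mono_iff[symmetric]) auto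
  also have "(real Z powr (1 / real k)) ^ k = real Z"
    using assms by (simp add: powr_power)
  also have "real q ^ k \<le> real Z \<longleftrightarrow> q ^ k \<le> Z"
    by (metis of_nat_le_iff of_nat_power)
  finally show ?thesis .
qed

lemma chebyshev_theta_root:
  assumes "k \<ge> 1" "Z \<ge> 1"
  shows "chebyshev_theta (real Z powr (1 / real k)) = (\<Sum>q\<in>root_layer Z k. ln (real q))"
  unfolding chebyshev_theta_def root_layer_def using le_powr_inverse_iff[OF assms] by simp

lemma finite_root_layer:
  assumes "k \<ge> 1"
  shows "finite (root_layer Z k)"
proof (rule finite_subset)
  show "root_layer Z k \<subseteq> {..Z}"
  proof
    fix q assume q: "q \<in> root_layer Z k"
    then have "q \<le> q ^ k" using assms prime_ge_1_nat[of q] by (intro self_le_power) (auto simp: root_layer_def)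
    then show "q \<in> {..Z}" using q by (simp add: root_layer_def)
  qed
qed simp

lemma layer_subset: "k \<ge> 1 \<Longrightarrow> layer Z k \<subseteq> root_layer Z k"
  unfolding layer_def root_layer_def using power_le_zval[of k] order_trans by blast

lemma ln_zval_le:
  assumes "prime q" "k \<ge> 1"
  shows "ln (real (zval (q, k))) \<le> real k * ln (real q) + (ln (real q) - ln (real (q - 1)))"
proof -
  have q: "q \<ge> 2" using assms prime_ge_2_nat by auto
  have "zval (q, k) * (q - 1) \<le> q * q ^ k"
    using zval_geometric[of q k] q by simp
  then have "real (zval (q, k)) * real (q - 1) \<le> real q * real q ^ k"
    by (metis of_nat_le_iff of_nat_mult of_nat_power)
  moreover have zpos: "real (zval (q, k)) > 0"
    using power_le_zval[OF assms(2), of q] q by (simp add: gr0I order.strict_trans2[of 0 "q ^ k"])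
  ultimately have "ln (real (zval (q, k)) * real (q - 1)) \<le> ln (real q * real q ^ k)"
    using q by (intro ln_mono) auto
  then show ?thesis using q zpos by (simp add: ln_mult ln_realpow)
qed

text \<open>Serves twice: for the corrections ln (q / (q - 1)) within a layer and for the harmonic
  sum over the layers.\<close>

lemma sum_ln_ratio: "R \<ge> 1 \<Longrightarrow> (\<Sum>n\<in>{2..R}. ln (real n) - ln (real (n - 1))) = ln (real R)"
proof (induction R rule: dec_induct)
  case (step n)
  then have "{2..Suc n} = insert (Suc n) {2..n}" by auto
  then show ?case using step by simp
qed simp

lemma layer_sum_le:
  assumes k: "k \<ge> 1" and Z: "Z \<ge> 1"
  shows "(\<Sum>q\<in>layer Z k. ln (real (zval (q, k)))) \<le> real k * chebyshev_theta (real Z powr (1 / real k)) + ln (real Z) / real k"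
proof -
  define y where "y = real Z powr (1 / real k)"
  define R where "R = nat \<lfloor>y\<rfloor>"
  have y: "y \<ge> 1" using Z by (auto simp: y_def intro!: ge_one_powr_ge_zero)
  have R: "R \<ge> 1" "real R \<le> y" using y by (auto simp: R_def le_nat_floor)
  have sub: "root_layer Z k \<subseteq> {2..R}"
  proof
    fix q assume q: "q \<in> root_layer Z k"
    then have "real q \<le> y" using le_powr_inverse_iff[OF k Z] by (simp add: y_def root_layer_def)
    then have "q \<le> R" unfolding R_def by (rule le_nat_floor)
    then show "q \<in> {2..R}" using q prime_ge_2_nat by (auto simp: root_layer_def)
  qed
  have "(\<Sum>q\<in>layer Z k. ln (real (zval (q, k)))) \<le> (\<Sum>q\<in>layer Z k. real k * ln (real q) + (ln (real q) - ln (real (q - 1))))"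
    using k by (intro sum_mono ln_zval_le) (auto simp: layer_def)
  also have "\<dots> \<le> (\<Sum>q\<in>root_layer Z k. real k * ln (real q) + (ln (real q) - ln (real (q - 1))))"
  proof (rule sum_mono2[OF finite_root_layer[OF k] layer_subset[OF k]])
    fix q assume "q \<in> root_layer Z k - layer Z k"
    then have "q \<ge> 2" using prime_ge_2_nat by (auto simp: root_layer_def)
    then show "0 \<le> real k * ln (real q) + (ln (real q) - ln (real (q - 1)))" by simp
  qed
  also have "\<dots> = real k * chebyshev_theta y + (\<Sum>q\<in>root_layer Z k. ln (real q) - ln (real (q - 1)))"
    unfolding y_def chebyshev_theta_root[OF k Z] by (simp add: sum.distrib sum_distrib_left)
  also have "(\<Sum>q\<in>root_layer Z k. ln (real q) - ln (real (q - 1))) \<le> (\<Sum>q\<in>{2..R}. ln (real q) - ln (real (q - 1)))"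
    by (rule sum_mono2[OF _ sub]) auto
  also have "\<dots> = ln (real R)" by (rule sum_ln_ratio[OF R(1)])
  also have "\<dots> \<le> ln y" using R y by (intro ln_mono) auto
  also have "ln y = ln (real Z) / real k" using Z by (simp add: y_def ln_powr)
  finally show ?thesis by (simp add: y_def)
qed

text \<open>If two primes \<open>p < q\<close> had \<open>q\<^sup>k \<le> Z\<close> and were both missing from the layer, then
  \<open>Z < p + \<dots> + p\<^sup>k \<le> (p + 1)\<^sup>k \<le> q\<^sup>k \<le> Z\<close>.\<close>

lemma layer_sum_ge:
  assumes k: "k \<ge> 1" and Z: "Z \<ge> 1"
  shows "real k * chebyshev_theta (real Z powr (1 / real k)) - ln (real Z) \<le> (\<Sum>q\<in>layer Z k. ln (real (zval (q, k))))"
proof -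
  define D where "D = root_layer Z k - layer Z k"
  have finD: "finite D" unfolding D_def by (intro finite_Diff finite_root_layer k)
  have no: "\<not> p < q" if "p \<in> D" "q \<in> D" for p q
  proof
    assume "p < q"
    have "Z < zval (p, k)" using that by (auto simp: D_def layer_def root_layer_def)
    also have "\<dots> \<le> (p + 1) ^ k" using zval_le_Suc_power[of p "k - 1"] k by simp
    also have "\<dots> \<le> q ^ k" using \<open>p < q\<close> by (intro power_mono) auto
    also have "\<dots> \<le> Z" using that by (auto simp: D_def root_layer_def)
    finally show False by simp
  qed
  then have "card D \<le> Suc 0"
    unfolding card_le_Suc0_iff_eq[OF finD] by (metis linorder_neqE_nat)
  then have card: "card D \<le> 1" by simp
  have bound: "real k * ln (real q) \<le> ln (real Z)" if "q \<in> D" for q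
  proof -
    have "q > 0" "q ^ k \<le> Z" using that by (auto simp: D_def root_layer_def prime_gt_0_nat)
    then have "real q ^ k \<le> real Z" by (metis of_nat_le_iff of_nat_power)
    then have "ln (real q ^ k) \<le> ln (real Z)" using \<open>q > 0\<close> by (intro ln_mono) auto
    then show ?thesis using \<open>q > 0\<close> by (simp add: ln_realpow)
  qed
  have "real k * chebyshev_theta (real Z powr (1 / real k)) = (\<Sum>q\<in>root_layer Z k. real k * ln (real q))"
    unfolding chebyshev_theta_root[OF k Z] by (simp add: sum_distrib_left)
  also have "\<dots> = (\<Sum>q\<in>D. real k * ln (real q)) + (\<Sum>q\<in>layer Z k. real k * ln (real q))"
    unfolding D_def by (rule sum.subset_diff[OF layer_subset[OF k] finite_root_layer[OF k]])
  also have "(\<Sum>q\<in>D. real k * ln (real q)) \<le> real (card D) * ln (real Z)"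
    by (rule sum_bounded_above) (rule bound)
  also have "\<dots> \<le> 1 * ln (real Z)" using card Z by (intro mult_right_mono) auto
  also have "(\<Sum>q\<in>layer Z k. real k * ln (real q)) \<le> (\<Sum>q\<in>layer Z k. ln (real (zval (q, k))))"
  proof (rule sum_mono)
    fix q assume "q \<in> layer Z k"
    then have "q > 0" by (auto simp: layer_def prime_gt_0_nat)
    have "real q ^ k \<le> real (zval (q, k))" using power_le_zval[OF k, of q] by (metis of_nat_le_iff of_nat_power)
    then have "ln (real q ^ k) \<le> ln (real (zval (q, k)))" using \<open>q > 0\<close> by (intro ln_mono) auto
    then show "real k * ln (real q) \<le> ln (real (zval (q, k)))" using \<open>q > 0\<close> by (simp add: ln_realpow)
  qed
  finally show ?thesis by simp
qed

section \<open>Summation over the layers\<close>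

lemma sum_inverse_le_ln: "K \<ge> 1 \<Longrightarrow> (\<Sum>k=2..K. 1 / real k) \<le> ln (real K)"
proof -
  assume K: "K \<ge> 1"
  have "(\<Sum>k=2..K. 1 / real k) \<le> (\<Sum>k=2..K. ln (real k) - ln (real (k - 1)))"
  proof (rule sum_mono)
    fix k assume k: "k \<in> {2..K}"
    have "ln (real (k - 1) / real k) \<le> real (k - 1) / real k - 1"
      using k by (intro ln_le_minus_one) auto
    also have "\<dots> = - (1 / real k)" using k by (simp add: of_nat_diff field_simps)
    finally show "1 / real k \<le> ln (real k) - ln (real (k - 1))" using k by (simp add: ln_div)
  qed
  also have "\<dots> = ln (real K)" by (rule sum_ln_ratio[OF K])
  finally show ?thesis .
qed

text \<open>The strictness of the upper bound comes from here. Since K ln 2 \<le> ln Z, it suffices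
  that (2 - ln 2) ln K > -2 ln (ln 2). For K \<ge> 2 the left side is at least (2 - ln 2) ln 2,
  which is at least 8/9 because 2/3 \<le> ln 2 < 1, and the right side is below 8/9. For K \<le> 1
  it suffices that ln (ln Z) > 0, which holds as Z \<ge> 3 exceeds e.\<close>

lemma ln_K_less:
  assumes Z: "Z \<ge> 3"
  defines "K \<equiv> nat \<lfloor>ln (real Z) / ln 2\<rfloor>"
  shows "ln (real K) < 2 * ln (ln (real Z)) / ln 2"
proof -
  define l where "l = ln (2::real)"
  have l: "2/3 \<le> l" "l < 1" using ln2_ge_two_thirds ln_2_less_1 by (auto simp: l_def)
  have "exp 1 < real Z" using exp_le Z e_less_272 by linarith
  then have "1 < ln (real Z)" by (metis exp_gt_zero ln_exp ln_less_cancel_iff less_trans)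
  then have a0: "ln (ln (real Z)) > 0" by simp
  show ?thesis
  proof (cases "K \<le> 1")
    case True
    then have "ln (real K) \<le> 0" by (cases "K = 0") auto
    also have "0 < 2 * ln (ln (real Z)) / ln 2" using a0 by simp
    finally show ?thesis .
  next
    case False
    then have K: "K \<ge> 2" by simp
    have "real K \<le> ln (real Z) / ln 2" unfolding K_def using Z by (intro of_nat_floor) auto
    then have "real K * l \<le> ln (real Z)" by (simp add: l_def field_simps)
    then have "ln (real K * l) \<le> ln (ln (real Z))" using K l by (intro ln_mono) auto
    then have a: "ln (real K) + ln l \<le> ln (ln (real Z))" using K l by (simp add: ln_mult)
    \<comment> \<open>Equivalent to ln 2 > exp(-4/9), which follows from ln 2 \<ge> 2/3 since the
      quadratic Taylor polynomial already gives exp(4/9) > 3/2.\<close>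
    have lnl: "ln l > - 4/9"
    proof -
      have "exp (4/9 :: real) \<ge> 1 + 4/9 + (4/9)\<^sup>2 / 2" by (rule exp_lower_Taylor_quadratic) simp
      then have "exp (4/9 :: real) > 3/2" by (simp add: power2_eq_square)
      then have "exp (-4/9 :: real) < 2/3"
        using exp_gt_zero[of "4/9::real"] by (simp add: exp_minus field_simps)
      with l have "exp (-4/9 :: real) < l" by simp
      then show ?thesis using l by (metis exp_gt_zero ln_exp ln_less_cancel_iff order_less_trans)
    qed
    have lK: "ln (real K) \<ge> l" using K by (simp add: l_def)
    have "(2 - l) * ln (real K) \<ge> (2 - l) * l" using lK l by (intro mult_left_mono) auto
    moreover have "(2 - l) * l \<ge> 8/9"
    proof -
      have "(2 - l) * l - 8/9 = (l - 2/3) * (4/3 - l)" by (simp add: algebra_simps)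
      also have "\<dots> \<ge> 0" using l by (intro mult_nonneg_nonneg) auto
      finally show ?thesis by simp
    qed
    ultimately have "l * ln (real K) < 2 * (ln (real K) + ln l)" using lnl by (simp add: algebra_simps)
    also have "\<dots> \<le> 2 * ln (ln (real Z))" using a by simp
    finally show ?thesis using l by (simp add: l_def field_simps)
  qed
qed

lemma psi_Z_bounds:
  assumes e: "z_enumeration e" and Z: "Z \<ge> 3"
  defines "K \<equiv> nat \<lfloor>ln (real Z) / ln 2\<rfloor>"
  shows "chebyshev_theta (real Z) + (\<Sum>k = 2..K. real k * chebyshev_theta (real Z powr (1 / real k)))
              - (ln (real Z))\<^sup>2 / ln 2 \<le> psi_Z e (real Z)" (is ?lower)
    and "psi_Z e (real Z) < chebyshev_theta (real Z)
              + (\<Sum>k = 2..K. real k * chebyshev_theta (real Z powr (1 / real k)))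
              + 2 * ln (real Z) * ln (ln (real Z)) / ln 2" (is ?upper)
proof -
  have Z1: "Z \<ge> 1" using Z by simp
  have K1: "K \<ge> 1" unfolding K_def using Z by (intro le_log2_of_power_le) auto
  have lnZ: "ln (real Z) > 0" using Z by simp
  have layers: "psi_Z e (real Z) = chebyshev_theta (real Z) + (\<Sum>k=2..K. \<Sum>q\<in>layer Z k. ln (real (zval (q, k))))"
    unfolding K_def using Z by (intro psi_Z_eq_layers e) auto
  have "(\<Sum>k=2..K. \<Sum>q\<in>layer Z k. ln (real (zval (q, k))))
      \<le> (\<Sum>k=2..K. real k * chebyshev_theta (real Z powr (1 / real k)) + ln (real Z) / real k)"
    by (intro sum_mono layer_sum_le Z1) auto
  also have "\<dots> = (\<Sum>k=2..K. real k * chebyshev_theta (real Z powr (1 / real k))) + ln (real Z) * (\<Sum>k=2..K. 1 / real k)"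
    by (simp add: sum.distrib sum_distrib_left)
  also have "ln (real Z) * (\<Sum>k=2..K. 1 / real k) \<le> ln (real Z) * ln (real K)"
    using lnZ by (intro mult_left_mono sum_inverse_le_ln K1) auto
  also have "\<dots> < ln (real Z) * (2 * ln (ln (real Z)) / ln 2)"
    unfolding K_def by (rule mult_strict_left_mono[OF ln_K_less[OF Z] lnZ])
  finally show ?upper unfolding layers by (simp add: mult_ac)
  have "(\<Sum>k=2..K. real k * chebyshev_theta (real Z powr (1 / real k))) - real (card {2..K}) * ln (real Z)
      = (\<Sum>k=2..K. real k * chebyshev_theta (real Z powr (1 / real k)) - ln (real Z))"
    by (simp add: sum_subtractf)
  also have "\<dots> \<le> (\<Sum>k=2..K. \<Sum>q\<in>layer Z k. ln (real (zval (q, k))))"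
    by (intro sum_mono layer_sum_ge Z1) auto
  finally have "(\<Sum>k=2..K. real k * chebyshev_theta (real Z powr (1 / real k))) - real (card {2..K}) * ln (real Z)
    \<le> (\<Sum>k=2..K. \<Sum>q\<in>layer Z k. ln (real (zval (q, k))))" .
  moreover have "real (card {2..K}) * ln (real Z) \<le> (ln (real Z))\<^sup>2 / ln 2"
  proof -
    have "real (card {2..K}) \<le> real K" by simp
    also have "\<dots> \<le> ln (real Z) / ln 2" unfolding K_def using Z by (intro of_nat_floor) auto
    finally have "real (card {2..K}) * ln (real Z) \<le> ln (real Z) / ln 2 * ln (real Z)"
      using lnZ by (intro mult_right_mono) auto
    then show ?thesis by (simp add: power2_eq_square)
  qed
  ultimately show ?lower unfolding layers by linarith
qed

section \<open>The enumeration at small and large indices, and the asymptotic formula\<close>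

lemma zval_ge_3:
  assumes "(q, k) \<in> prime_exp_pairs" "(q, k) \<noteq> (2, 1)"
  shows "zval (q, k) \<ge> 3"
proof (cases "q = 2")
  case True
  then have "k \<ge> 2" using assms by (auto simp: prime_exp_pairs_def)
  then have "2 ^ 2 \<le> (2::nat) ^ k" by (intro power_increasing) auto
  also have "\<dots> \<le> zval (2, k)" using \<open>k \<ge> 2\<close> by (intro power_le_zval) auto
  finally show ?thesis using True by simp
next
  case False
  then have "q \<ge> 3" using assms prime_ge_2_nat[of q] by (auto simp: prime_exp_pairs_def)
  then show ?thesis using zval_ge(1)[OF assms(1)] by simp
qed

text \<open>Only the pair (2, 1) has a value below 3. If it stood at index m \<ge> 2, monotonicity
  would put it at index 1 as well, against injectivity. This is what m \<ge> 2 is for: it makes ln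
  (ln z) positive.\<close>

lemma zval_enumeration_ge_3:
  assumes e: "z_enumeration e" and m: "m \<ge> 2"
  shows "zval (e m) \<ge> 3"
proof (rule ccontr)
  assume less: "\<not> ?thesis"
  have bij: "bij_betw e {1..} prime_exp_pairs" 
    and mono: "zval (e 1) \<le> zval (e m)" using e m by (auto simp: z_enumeration_def)
  have "e i \<in> prime_exp_pairs" if "i \<ge> 1" for i using bij_betwE[OF bij] that by simp
  then have "e i = (2, 1)" if "i \<ge> 1" "zval (e i) < 3" for i
    using zval_ge_3[of "fst (e i)" "snd (e i)"] that by (metis linorder_not_less prod.collapse)
  from this[of 1] this[of m] have "e 1 = e m" using less mono m by simp
  then show False using inj_onD[OF bij_betw_imp_inj_on[OF bij], of 1 m] m by simp
qed

lemma filterlim_zval_enumeration: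
  assumes e: "z_enumeration e"
  shows "filterlim (\<lambda>m. real (zval (e m))) at_top sequentially"
  unfolding filterlim_at_top
proof
  fix x :: real
  have "finite {i. 1 \<le> i \<and> real (zval (e i)) \<le> x}" by (rule finite_z_enumeration_le[OF e])
  then obtain b where b: "\<And>i. 1 \<le> i \<Longrightarrow> real (zval (e i)) \<le> x \<Longrightarrow> i \<le> b"
    unfolding finite_nat_set_iff_bounded_le by blast
  show "eventually (\<lambda>m. x \<le> real (zval (e m))) sequentially"
    using eventually_ge_at_top[of "Suc b"]
  proof eventually_elim
    case (elim m)
    then show ?case using b[of m] by (cases "real (zval (e m)) \<le> x") auto
  qed
qed

lemma chebyshev_theta_le:
  assumes "y \<ge> 1"
  shows "chebyshev_theta y \<le> y * ln y"
proof -
  define P where "P = {p. prime p \<and> real p \<le> y}"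
  have sub: "P \<subseteq> {1..nat \<lfloor>y\<rfloor>}" by (auto simp: P_def le_nat_floor prime_ge_1_nat Suc_le_eq prime_gt_0_nat)
  have "chebyshev_theta y \<le> real (card P) * ln y"
    unfolding chebyshev_theta_def P_def[symmetric]
    by (rule sum_bounded_above) (auto simp: P_def prime_gt_0_nat intro!: ln_mono)
  also have "real (card P) \<le> y"
  proof -
    have "card P \<le> nat \<lfloor>y\<rfloor>" using card_mono[OF _ sub] by simp
    then show ?thesis using assms by linarith
  qed
  finally show ?thesis using assms by (simp add: mult_right_mono)
qed

lemma chebyshev_theta_mono:
  assumes "x \<le> y"
  shows "chebyshev_theta x \<le> chebyshev_theta y"
  unfolding chebyshev_theta_def
proof (rule sum_mono2)
  show "finite {p. prime p \<and> real p \<le> y}"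
    by (rule finite_subset[of _ "{..nat \<lfloor>y\<rfloor>}"]) (auto simp: le_nat_floor)
qed (use assms in \<open>auto simp: prime_ge_1_nat Suc_le_eq prime_gt_0_nat\<close>)

lemma chebyshev_theta_nonneg: "chebyshev_theta x \<ge> 0"
  unfolding chebyshev_theta_def by (intro sum_nonneg) (auto simp: Suc_le_eq prime_gt_0_nat)

text \<open>The term k = 2 is twice theta at the square root, where the prime number theorem
  applies. The other terms are fewer than ln x / ln 2 in number, and with theta(y) \<le> y ln y each
  is at most (ln x / ln 2) x^(1/3) ln (x^(1/3)).\<close>

lemma sum_theta_roots_bigo:
  "(\<lambda>x. (\<Sum>k = 2..nat \<lfloor>ln x / ln 2\<rfloor>. real k * chebyshev_theta (x powr (1 / real k))) - 2 * sqrt x)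
     \<in> O(\<lambda>x. sqrt x / (ln x)\<^sup>2)"
proof -
  define K where "K = (\<lambda>x::real. nat \<lfloor>ln x / ln 2\<rfloor>)"
  define tail where "tail = (\<lambda>x. \<Sum>k = 3..K x. real k * chebyshev_theta (x powr (1 / real k)))"
  have "(\<lambda>x. chebyshev_theta (sqrt x) - sqrt x) \<in> O(\<lambda>x. sqrt x / ln (sqrt x) ^ 2)"
    by (rule landau_o.big.compose[OF prime_number_theorem_theta sqrt_at_top])
  also have "(\<lambda>x. sqrt x / ln (sqrt x) ^ 2) \<in> O(\<lambda>x. sqrt x / (ln x)\<^sup>2)" by real_asymp
  finally have 1: "(\<lambda>x. 2 * (chebyshev_theta (sqrt x) - sqrt x)) \<in> O(\<lambda>x. sqrt x / (ln x)\<^sup>2)"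
    by (subst landau_o.big.cmult_in_iff) simp_all
  have "tail \<in> O(\<lambda>x. (ln x / ln 2)\<^sup>2 * (x powr (1/3) * ln (x powr (1/3))))"
  proof (rule bigoI[where c = 1])
    show "eventually (\<lambda>x. norm (tail x) \<le> 1 * norm ((ln x / ln 2)\<^sup>2 * (x powr (1/3) * ln (x powr (1/3))))) at_top"
      using eventually_ge_at_top[of 1]
    proof eventually_elim
      case (elim x)
      have y: "x powr (1/3) \<ge> 1" using elim by (intro ge_one_powr_ge_zero) auto
      have Kx: "real (K x) \<le> ln x / ln 2" unfolding K_def using elim by (intro of_nat_floor) auto
      have t0: "tail x \<ge> 0" unfolding tail_def by (intro sum_nonneg mult_nonneg_nonneg chebyshev_theta_nonneg) auto
      have "tail x \<le> real (card {3..K x}) * (real (K x) * (x powr (1/3) * ln (x powr (1/3))))"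
        unfolding tail_def
      proof (rule sum_bounded_above)
        fix k assume k: "k \<in> {3..K x}"
        have "chebyshev_theta (x powr (1 / real k)) \<le> chebyshev_theta (x powr (1/3))"
          using k elim by (intro chebyshev_theta_mono powr_mono) (auto simp: field_simps)
        also have "\<dots> \<le> x powr (1/3) * ln (x powr (1/3))" by (rule chebyshev_theta_le[OF y])
        finally show "real k * chebyshev_theta (x powr (1 / real k)) \<le> real (K x) * (x powr (1/3) * ln (x powr (1/3)))"
          using k chebyshev_theta_nonneg by (intro mult_mono) auto
      qed
      also have "\<dots> \<le> real (K x) * (real (K x) * (x powr (1/3) * ln (x powr (1/3))))"
        using y elim by (intro mult_right_mono) auto
      also have "\<dots> = (real (K x))\<^sup>2 * (x powr (1/3) * ln (x powr (1/3)))" by (simp add: power2_eq_square)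
      also have "\<dots> \<le> (ln x / ln 2)\<^sup>2 * (x powr (1/3) * ln (x powr (1/3)))"
        using y Kx elim by (intro mult_right_mono power_mono) auto
      finally show ?case using t0 by (simp add: order_trans[OF _ abs_ge_self])
    qed
  qed
  also have "(\<lambda>x::real. (ln x / ln 2)\<^sup>2 * (x powr (1/3) * ln (x powr (1/3)))) \<in> O(\<lambda>x. sqrt x / (ln x)\<^sup>2)"
    by real_asymp
  finally have 2: "tail \<in> O(\<lambda>x. sqrt x / (ln x)\<^sup>2)" .
  have "(\<lambda>x. 2 * (chebyshev_theta (sqrt x) - sqrt x) + tail x) \<in> O(\<lambda>x. sqrt x / (ln x)\<^sup>2)"
    by (rule sum_in_bigo(1)[OF 1 2])
  also have "?this \<longleftrightarrow> ?thesis"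
  proof (rule landau_o.big.in_cong)
    show "eventually (\<lambda>x. 2 * (chebyshev_theta (sqrt x) - sqrt x) + tail x
      = (\<Sum>k = 2..nat \<lfloor>ln x / ln 2\<rfloor>. real k * chebyshev_theta (x powr (1 / real k))) - 2 * sqrt x) at_top"
      \<comment> \<open>From x = 4 on the range of k contains 2, so that term can be split
        off.\<close>
      using eventually_ge_at_top[of 4]
    proof eventually_elim
      case (elim x)
      have "ln (2 * 2) = 2 * ln (2::real)" by (subst ln_mult) auto
      moreover have "ln (2 * 2) \<le> ln x" using elim by (intro ln_mono) auto
      ultimately have "2 * ln 2 \<le> ln x" by linarith
      then have "real 2 \<le> ln x / ln 2" by (simp add: field_simps)
      then have "2 \<le> K x" unfolding K_def by (rule le_nat_floor)
      then have "(\<Sum>k = 2..K x. real k * chebyshev_theta (x powr (1 / real k))) = real 2 * chebyshev_theta (x powr (1 / real 2)) + tail x"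
        unfolding tail_def by (subst sum.atLeast_Suc_atMost) (auto simp: numeral_3_eq_3 numeral_2_eq_2)
      also have "x powr (1 / real 2) = sqrt x" using elim by (simp add: powr_half_sqrt)
      finally show ?case by (simp add: K_def)
    qed
  qed
  finally show ?thesis .
qed

theorem theorem6:
  fixes e :: "nat \<Rightarrow> nat \<times> nat" and z :: "nat \<Rightarrow> real"
  assumes enum: "z_enumeration e"
    and z_def: "\<And>i. z i = real (zval (e i))"
  shows "(\<forall>m\<ge>2. let K = nat \<lfloor>ln (z m) / ln 2\<rfloor> in
            chebyshev_theta (z m)
              + (\<Sum>k = 2..K. real k * chebyshev_theta (z m powr (1 / real k)))
              - (ln (z m))\<^sup>2 / ln 2
            \<le> psi_Z e (z m) \<and>
            psi_Z e (z m)
            < chebyshev_theta (z m)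
              + (\<Sum>k = 2..K. real k * chebyshev_theta (z m powr (1 / real k)))
              + 2 * ln (z m) * ln (ln (z m)) / ln 2)
       \<and> (\<lambda>m. psi_Z e (z m) - (chebyshev_theta (z m) + 2 * sqrt (z m)))
            \<in> O(\<lambda>m. sqrt (z m) / (ln (z m))\<^sup>2)"
proof -
  define F where "F = (\<lambda>x. \<Sum>k = 2..nat \<lfloor>ln x / ln 2\<rfloor>. real k * chebyshev_theta (x powr (1 / real k)))"
  have bounds: "chebyshev_theta (z m) + F (z m) - (ln (z m))\<^sup>2 / ln 2 \<le> psi_Z e (z m)"
    "psi_Z e (z m) < chebyshev_theta (z m) + F (z m) + 2 * ln (z m) * ln (ln (z m)) / ln 2" if "m \<ge> 2" for m
    unfolding F_def z_def using psi_Z_bounds[OF enum zval_enumeration_ge_3[OF enum that]] by simp_all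
  have lim: "filterlim z at_top sequentially"
    using filterlim_zval_enumeration[OF enum] by (simp only: z_def[symmetric])
  \<comment> \<open>Dominates the errors of both inequalities at once. It is polylogarithmic and
    disappears in the error term of the asymptotic formula.\<close>
  define g where "g = (\<lambda>x::real. (ln x)\<^sup>2 / ln 2 + \<bar>2 * ln x * ln (ln x) / ln 2\<bar>)"
  have "(\<lambda>m. psi_Z e (z m) - chebyshev_theta (z m) - F (z m)) \<in> O(\<lambda>m. g (z m))"
  proof (rule bigoI[where c = 1])
    show "eventually (\<lambda>m. norm (psi_Z e (z m) - chebyshev_theta (z m) - F (z m)) \<le> 1 * norm (g (z m))) sequentially"
      using eventually_ge_at_top[of 2]
    proof eventually_elim
      case (elim m)
      have "(ln (z m))\<^sup>2 / ln 2 \<ge> 0" by simp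
      then have "\<bar>psi_Z e (z m) - chebyshev_theta (z m) - F (z m)\<bar> \<le> g (z m)"
        using bounds[OF elim] unfolding g_def by linarith
      then show ?case by auto
    qed
  qed
  also have "(\<lambda>m. g (z m)) \<in> O(\<lambda>m. sqrt (z m) / (ln (z m))\<^sup>2)"
  proof -
    have "g \<in> O(\<lambda>x. sqrt x / (ln x)\<^sup>2)" unfolding g_def by real_asymp
    from landau_o.big.compose[OF this lim] show ?thesis .
  qed
  finally have 1: "(\<lambda>m. psi_Z e (z m) - chebyshev_theta (z m) - F (z m)) \<in> O(\<lambda>m. sqrt (z m) / (ln (z m))\<^sup>2)" .
  have 2: "(\<lambda>m. F (z m) - 2 * sqrt (z m)) \<in> O(\<lambda>m. sqrt (z m) / (ln (z m))\<^sup>2)"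
    unfolding F_def by (rule landau_o.big.compose[OF sum_theta_roots_bigo lim])
  have "(\<lambda>m. psi_Z e (z m) - (chebyshev_theta (z m) + 2 * sqrt (z m))) \<in> O(\<lambda>m. sqrt (z m) / (ln (z m))\<^sup>2)"
    using sum_in_bigo(1)[OF 1 2] by (simp add: algebra_simps)
  then show ?thesis using bounds by (auto simp: Let_def F_def)
qed

end
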